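(* Let $k\in\mathbb N\cup\{\infty\}$ and let $X$ be a separable normed space admitting a $C^k$ and Lipschitz bump function (i.e. a non-zero function $X\to\mathbb R$ that is of class $C^k$, Lipschitz, and has bounded support). Let $\omega:(0,\infty)\to(0,\infty)$ be a non-decreasing function such that $\lim_{t\to 0}\omega(t)=0$, $\lim_{t\to\infty}\omega(t)=\infty$, $\lim_{t\to 0}t/\omega(t)=0$, and, for some constant $C_{\mathrm{db}}>1$, $\omega(2t)\le C_{\mathrm{db}}\,\omega(t)$ for all $t\in(0,\infty)$. Then: (i) $\overline{C^k(X)\cap \mathrm{Lip}(X)\cap\dot C^{0,\omega}(X)}^{\,\dot C^{0,\omega}(X)}=\dot{\mathrm{VC}}^{0,\omega}_{\mathrm{small}}(X)$; (ii) $\overline{C^k_{\mathrm{bs}}(X)\cap\mathrm{Lip}(X)}^{\,\dot C^{0,\omega}(X)}=\dot{\mathrm{VC}}^{0,\omega}(X)$.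
   Context: All function classes here consist of real-valued functions on $X$: e.g. $\dot C^{0,\omega}(X)=\dot C^{0,\omega}(X,\mathbb R)$. $\dot C^{0,\omega}(X)$ is the set of $f:X\to\mathbb R$ with $\|f\|_{\dot C^{0,\omega}(X)}:=\sup_{x\ne y}\frac{|f(x)-f(y)|}{\omega(\|x-y\|)}<\infty$. For $x\neq y$ put $\mathrm{osc}^\omega_{(x,y)}(f)=\frac{|f(x)-f(y)|}{\omega(\|x-y\|)}$, and for $\delta>0$ put $\mathrm{osc}^\omega_\delta(f)=\sup\{\mathrm{osc}^\omega_{(x,y)}(f): x,y\in X,\ \|x-y\|=\delta\}$. Define $\dot{\mathrm{VC}}^{0,\omega}_{\mathrm{small}}(X)=\{f\in\dot C^{0,\omega}(X):\lim_{\delta\to0}\mathrm{osc}^\omega_\delta(f)=0\}$, $\dot{\mathrm{VC}}^{0,\omega}_{\mathrm{large}}(X)=\{f\in\dot C^{0,\omega}(X):\lim_{\delta\to\infty}\mathrm{osc}^\omega_\delta(f)=0\}$, $\dot{\mathrm{VC}}^{0,\omega}_{\mathrm{far}}(X)=\{f\in\dot C^{0,\omega}(X):\lim_{\delta\to\infty}\sup_{x\ne y,\ \min(\|x\|,\|y\|)>\delta}\mathrm{osc}^\omega_{(x,y)}(f)=0\}$, and $\dot{\mathrm{VC}}^{0,\omega}(X)$ as the intersection of these three sets. $\mathrm{Lip}(X)$ is the set of (not necessarily bounded) Lipschitz functions $X\to\mathbb R$. $C^k(X)$ is the set of functions $X\to\mathbb R$ with continuous Fréchet derivatives (over the real scalars)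 up to order $k$; $C^k_{\mathrm{bs}}(X)$ is the subset of those with bounded support (vanishing outside some ball $B(0,R)$). For $\mathcal C\subset\dot C^{0,\omega}(X)$, $\overline{\mathcal C}^{\,\dot C^{0,\omega}(X)}$ is the set of $f\in\dot C^{0,\omega}(X)$ for which there is a sequence $(f_n)\subset\mathcal C$ with $\|f_n-f\|_{\dot C^{0,\omega}(X)}\to0$. *)

theory Defs
  imports "HOL-Analysis.Analysis" "HOL-Library.Extended_Nat"
begin

section \<open>Hoelder spaces with modulus \<open>\<omega>\<close> and vanishing scales\<close>

text \<open>The modulus is a function on \<open>(0,\<infinity>)\<close>; it is given a total type, but its values
  outside \<open>{0<..}\<close> are never used.  All suprema are taken in \<^typ>\<open>ennreal\<close>, so that an
  unbounded family has supremum \<open>\<infinity>\<close> and an empty one (which only occurs when the space is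
  trivial) has supremum 0.\<close>

definition osc :: "(real \<Rightarrow> real) \<Rightarrow> 'a::real_normed_vector \<Rightarrow> 'a \<Rightarrow> ('a \<Rightarrow> real) \<Rightarrow> real"
  where "osc \<omega> x y f = \<bar>f x - f y\<bar> / \<omega> (norm (x - y))"

definition osc_scale :: "(real \<Rightarrow> real) \<Rightarrow> real \<Rightarrow> ('a::real_normed_vector \<Rightarrow> real) \<Rightarrow> ennreal"
  where "osc_scale \<omega> \<delta> f =
    (SUP (x, y) \<in> {(x, y). norm (x - y) = \<delta>}. ennreal (osc \<omega> x y f))"

definition osc_far :: "(real \<Rightarrow> real) \<Rightarrow> real \<Rightarrow> ('a::real_normed_vector \<Rightarrow> real) \<Rightarrow> ennreal"
  where "osc_far \<omega> \<delta> f =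
    (SUP (x, y) \<in> {(x, y). x \<noteq> y \<and> min (norm x) (norm y) > \<delta>}. ennreal (osc \<omega> x y f))"

definition holder_seminorm :: "(real \<Rightarrow> real) \<Rightarrow> ('a::real_normed_vector \<Rightarrow> real) \<Rightarrow> ennreal"
  where "holder_seminorm \<omega> f =
    (SUP (x, y) \<in> {(x, y). x \<noteq> y}. ennreal (osc \<omega> x y f))"

definition holder_space :: "(real \<Rightarrow> real) \<Rightarrow> ('a::real_normed_vector \<Rightarrow> real) set"
  where "holder_space \<omega> = {f. holder_seminorm \<omega> f < \<infinity>}"

definition VC_small :: "(real \<Rightarrow> real) \<Rightarrow> ('a::real_normed_vector \<Rightarrow> real) set"
  where "VC_small \<omega> =
    {f \<in> holder_space \<omega>. ((\<lambda>\<delta>. osc_scale \<omega> \<delta> f) \<longlongrightarrow> 0) (at_right 0)}"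

definition VC_large :: "(real \<Rightarrow> real) \<Rightarrow> ('a::real_normed_vector \<Rightarrow> real) set"
  where "VC_large \<omega> =
    {f \<in> holder_space \<omega>. ((\<lambda>\<delta>. osc_scale \<omega> \<delta> f) \<longlongrightarrow> 0) at_top}"

definition VC_far :: "(real \<Rightarrow> real) \<Rightarrow> ('a::real_normed_vector \<Rightarrow> real) set"
  where "VC_far \<omega> =
    {f \<in> holder_space \<omega>. ((\<lambda>\<delta>. osc_far \<omega> \<delta> f) \<longlongrightarrow> 0) at_top}"

definition VC :: "(real \<Rightarrow> real) \<Rightarrow> ('a::real_normed_vector \<Rightarrow> real) set"
  where "VC \<omega> = VC_small \<omega> \<inter> VC_large \<omega> \<inter> VC_far \<omega>"

definition holder_closure ::
    "(real \<Rightarrow> real) \<Rightarrow> ('a::real_normed_vector \<Rightarrow> real) set \<Rightarrow> ('a \<Rightarrow> real) set"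
  where "holder_closure \<omega> C =
    {f \<in> holder_space \<omega>. \<exists>F :: nat \<Rightarrow> 'a \<Rightarrow> real.
        (\<forall>n. F n \<in> C) \<and> (\<lambda>n. holder_seminorm \<omega> (\<lambda>x. F n x - f x)) \<longlonglongrightarrow> 0}"


section \<open>Lipschitz functions and functions of class \<open>C\<^sup>k\<close>\<close>

definition Lip :: "('a::real_normed_vector \<Rightarrow> real) set"
  where "Lip = {f. \<exists>L. L-lipschitz_on UNIV f}"

text \<open>A \<open>j\<close>-linear form is represented as a function on argument lists, of which only the
  values on lists of length \<open>j\<close> matter.  With the operator norm \<open>form_norm j\<close> these
  forms are the space \<open>L(X, L(X, \<dots> L(X, \<real>)\<dots>))\<close> in which the \<open>j\<close>-th Frechet
  derivative takes its values; the iterated space itself has no uniform HOL type.\<close>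

definition bounded_form :: "nat \<Rightarrow> ('a::real_normed_vector list \<Rightarrow> real) \<Rightarrow> bool"
  where "bounded_form j M \<longleftrightarrow>
    (\<forall>vs i. length vs = j \<and> i < j \<longrightarrow> linear (\<lambda>h. M (vs[i := h]))) \<and>
    (\<exists>K. \<forall>vs. length vs = j \<longrightarrow> \<bar>M vs\<bar> \<le> K * (\<Prod>v\<leftarrow>vs. norm v))"

definition form_norm :: "nat \<Rightarrow> ('a::real_normed_vector list \<Rightarrow> real) \<Rightarrow> real"
  where "form_norm j M = (SUP vs \<in> {vs. length vs = j \<and> (\<forall>v \<in> set vs. norm v \<le> 1)}. \<bar>M vs\<bar>)"

text \<open>\<open>D j x\<close> is the \<open>j\<close>-th Frechet derivative of \<open>f\<close> at \<open>x\<close>.  The third clause says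
  that \<open>D j\<close> is Frechet differentiable at \<open>x\<close> with derivative
  \<open>h \<mapsto> D (j + 1) x (h, \<dots>)\<close>, the fourth that \<open>D j\<close> is continuous, both with respect to
  the operator norm.\<close>

definition C_class :: "enat \<Rightarrow> ('a::real_normed_vector \<Rightarrow> real) set"
  where "C_class k = {f. \<exists>D :: nat \<Rightarrow> 'a \<Rightarrow> 'a list \<Rightarrow> real.
    (\<forall>x. D 0 x [] = f x) \<and>
    (\<forall>j x. enat j \<le> k \<longrightarrow> bounded_form j (D j x)) \<and>
    (\<forall>j x. enat j < k \<longrightarrow>
      ((\<lambda>h. form_norm j (\<lambda>vs. D j (x + h) vs - D j x vs - D (Suc j) x (h # vs)) / norm h)
        \<longlongrightarrow> 0) (at 0)) \<and>
    (\<forall>j x. enat j \<le> k \<longrightarrow>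
      ((\<lambda>y. form_norm j (\<lambda>vs. D j y vs - D j x vs)) \<longlongrightarrow> 0) (at x))}"

definition C_class_bs :: "enat \<Rightarrow> ('a::real_normed_vector \<Rightarrow> real) set"
  where "C_class_bs k = {f \<in> C_class k. \<exists>R. \<forall>x. x \<notin> ball 0 R \<longrightarrow> f x = 0}"

text \<open>Consistency with the library for \<open>k = 0\<close> and \<open>k = 1\<close>.\<close>

lemma form_norm_0:
  fixes M :: "'a::real_normed_vector list \<Rightarrow> real"
  shows "form_norm 0 M = \<bar>M []\<bar>"
proof -
  have "{vs::'a list. length vs = 0 \<and> (\<forall>v \<in> set vs. norm v \<le> 1)} = {[]}" by auto
  then show ?thesis unfolding form_norm_def by simp
qed

lemma form_norm_1:
  fixes T :: "'a::real_normed_vector \<Rightarrow>\<^sub>L real"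
  shows "form_norm (Suc 0) (\<lambda>vs. blinfun_apply T (hd vs)) = norm T"
proof -
  have eq: "{vs::'a list. length vs = Suc 0 \<and> (\<forall>v \<in> set vs. norm v \<le> 1)} = (\<lambda>v. [v]) ` cball 0 1"
    by (auto simp: length_Suc_conv image_iff)
  have "form_norm (Suc 0) (\<lambda>vs. blinfun_apply T (hd vs)) = (SUP v \<in> cball 0 1. norm (T v))"
    unfolding form_norm_def eq image_image by simp
  also have "\<dots> = norm T"
  proof (rule antisym)
    show "(SUP v \<in> cball 0 1. norm (T v)) \<le> norm T"
    proof (rule cSUP_least)
      fix v :: 'a assume "v \<in> cball 0 1"
      then have "norm T * norm v \<le> norm T * 1" by (intro mult_left_mono) auto
      then show "norm (T v) \<le> norm T" using norm_blinfun[of T v] by linarith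
    qed auto
    have bdd: "bdd_above ((\<lambda>v. norm (T v)) ` cball 0 1)"
    proof (rule bdd_aboveI2)
      fix v :: 'a assume "v \<in> cball 0 1"
      then have "norm T * norm v \<le> norm T * 1" by (intro mult_left_mono) auto
      then show "norm (T v) \<le> norm T" using norm_blinfun[of T v] by linarith
    qed
    show "norm T \<le> (SUP v \<in> cball 0 1. norm (T v))"
    proof (rule norm_blinfun_bound)
      show "0 \<le> (SUP v \<in> cball 0 1. norm (T v))"
        by (rule cSUP_upper2[OF bdd, of 0]) auto
      fix x :: 'a
      show "norm (T x) \<le> (SUP v \<in> cball 0 1. norm (T v)) * norm x"
      proof (cases "x = 0")
        case False
        have "norm (T (x /\<^sub>R norm x)) \<le> (SUP v \<in> cball 0 1. norm (T v))"
          using False by (intro cSUP_upper[OF _ bdd]) auto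
        then show ?thesis using False by (simp add: blinfun.scaleR_right field_simps)
      qed (simp add: blinfun.zero_right)
    qed
  qed
  finally show ?thesis .
qed

lemma C_class_0:
  fixes f :: "'a::real_normed_vector \<Rightarrow> real"
  shows "f \<in> C_class 0 \<longleftrightarrow> continuous_on UNIV f"
proof
  assume "f \<in> C_class 0"
  then obtain D :: "nat \<Rightarrow> 'a \<Rightarrow> 'a list \<Rightarrow> real" where D: "\<forall>x. D 0 x [] = f x"
    and c: "\<forall>j x. enat j \<le> 0 \<longrightarrow> ((\<lambda>y. form_norm j (\<lambda>vs. D j y vs - D j x vs)) \<longlongrightarrow> 0) (at x)"
    unfolding C_class_def by blast
  have "((\<lambda>y. \<bar>f y - f x\<bar>) \<longlongrightarrow> 0) (at x)" for x
    using c[rule_format, of 0 x] D by (simp add: form_norm_0 zero_enat_def)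
  then have "(f \<longlongrightarrow> f x) (at x)" for x
    by (rule LIM_zero_cancel[OF tendsto_rabs_zero_cancel])
  then show "continuous_on UNIV f" by (simp add: continuous_on_def)
next
  assume "continuous_on UNIV f"
  then have "((\<lambda>y. \<bar>f y - f x\<bar>) \<longlongrightarrow> 0) (at x)" for x
    unfolding continuous_on_def by (intro tendsto_rabs_zero LIM_zero) simp
  then have c: "((\<lambda>y. form_norm 0 (\<lambda>vs::'a list. f y - f x)) \<longlongrightarrow> 0) (at x)" for x
    by (simp add: form_norm_0)
  have b: "bounded_form 0 (\<lambda>vs::'a list. f x)" for x
    unfolding bounded_form_def by auto
  have le0: "enat j \<le> 0 \<longleftrightarrow> j = 0" for j by (simp add: zero_enat_def)
  have lt0: "\<not> enat j < 0" for j by (simp add: zero_enat_def)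
  show "f \<in> C_class 0"
    unfolding C_class_def mem_Collect_eq
    by (rule exI[of _ "\<lambda>j x vs. f x"]) (use b c in \<open>simp add: le0 lt0 enat_0_iff\<close>)
qed

lemma C_class_1:
  fixes f :: "'a::real_normed_vector \<Rightarrow> real"
  shows "f \<in> C_class 1 \<longleftrightarrow>
    (\<exists>f'. (\<forall>x. (f has_derivative blinfun_apply (f' x)) (at x)) \<and> continuous_on UNIV f')"
proof
  assume "f \<in> C_class 1"
  then obtain D where D: "\<And>x. D 0 x [] = f x"
    and b: "\<And>j x. enat j \<le> 1 \<Longrightarrow> bounded_form j (D j x)"
    and d: "\<And>j x. enat j < 1 \<Longrightarrow>
      ((\<lambda>h. form_norm j (\<lambda>vs. D j (x + h) vs - D j x vs - D (Suc j) x (h # vs)) / norm h)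
        \<longlongrightarrow> 0) (at 0)"
    and c: "\<And>j x. enat j \<le> 1 \<Longrightarrow> ((\<lambda>y. form_norm j (\<lambda>vs. D j y vs - D j x vs)) \<longlongrightarrow> 0) (at x)"
    unfolding C_class_def by blast
  define f' where "f' x = Blinfun (\<lambda>h. D 1 x [h])" for x
  have bl: "bounded_linear (\<lambda>h. D 1 x [h])" for x
  proof -
    have "bounded_form 1 (D 1 x)" using b[of 1 x] by (simp add: one_enat_def)
    then have lin0: "\<forall>vs i. length vs = 1 \<and> i < 1 \<longrightarrow> linear (\<lambda>h. D 1 x (vs[i := h]))"
      and K0: "\<exists>K. \<forall>vs. length vs = 1 \<longrightarrow> \<bar>D 1 x vs\<bar> \<le> K * (\<Prod>v\<leftarrow>vs. norm v)"
      unfolding bounded_form_def by blast+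
    have lin: "linear (\<lambda>h. D 1 x [h])"
      using lin0[rule_format, of "[0]" 0] by simp
    from K0 obtain K where K: "\<And>vs. length vs = 1 \<Longrightarrow> \<bar>D 1 x vs\<bar> \<le> K * (\<Prod>v\<leftarrow>vs. norm v)"
      by blast
    have "\<bar>D 1 x [v]\<bar> \<le> K * norm v" for v using K[of "[v]"] by simp
    then show ?thesis
      using linear_add[OF lin] linear_scale[OF lin]
      by (intro bounded_linear_intro[where K=K]) (simp_all add: mult.commute)
  qed
  have f'_apply: "blinfun_apply (f' x) h = D 1 x [h]" for x h
    unfolding f'_def using bl by (simp add: bounded_linear_Blinfun_apply)
  have "(f has_derivative blinfun_apply (f' x)) (at x)" for x
    unfolding has_derivative_at
  proof
    show "bounded_linear (blinfun_apply (f' x))" by (rule blinfun.bounded_linear_right)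
    show "(\<lambda>h. norm (f (x + h) - f x - blinfun_apply (f' x) h) / norm h) \<midarrow>0\<rightarrow> 0"
      using d[of 0 x] D by (simp add: form_norm_0 f'_apply one_enat_def)
  qed
  moreover have "(f' \<longlongrightarrow> f' x) (at x)" for x
  proof -
    have "form_norm (Suc 0) (\<lambda>vs. D 1 y vs - D 1 x vs) = norm (f' y - f' x)" for y
      unfolding form_norm_1[symmetric]
      unfolding form_norm_def
      by (rule SUP_cong) (auto simp: length_Suc_conv f'_apply blinfun.diff_left)
    then have "((\<lambda>y. norm (f' y - f' x)) \<longlongrightarrow> 0) (at x)"
      using c[of 1 x] by (simp add: one_enat_def)
    then show ?thesis by (rule LIM_zero_cancel[OF tendsto_norm_zero_cancel])
  qed
  ultimately show "\<exists>f'. (\<forall>x. (f has_derivative blinfun_apply (f' x)) (at x)) \<and> continuous_on UNIV f'"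
    by (auto simp: continuous_on_def)
next
  assume "\<exists>f'. (\<forall>x. (f has_derivative blinfun_apply (f' x)) (at x)) \<and> continuous_on UNIV f'"
  then obtain f' where f': "\<And>x. (f has_derivative blinfun_apply (f' x)) (at x)"
    and cont: "continuous_on UNIV f'" by blast
  define D where "D j x vs = (if j = 0 then f x else blinfun_apply (f' x) (hd vs))"
    for j :: nat and x and vs :: "'a list"
  have le1: "enat j \<le> 1 \<longleftrightarrow> j = 0 \<or> j = Suc 0" for j by (auto simp: one_enat_def)
  have lt1: "enat j < 1 \<longleftrightarrow> j = 0" for j by (auto simp: one_enat_def)
  have "bounded_form (Suc 0) (D (Suc 0) x)" for x
    unfolding bounded_form_def
  proof (intro conjI allI impI exI)
    fix vs :: "'a list" and i
    assume "length vs = Suc 0 \<and> i < Suc 0"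
    then obtain v where "vs = [v]" "i = 0" by (auto simp: length_Suc_conv)
    then show "linear (\<lambda>h. D (Suc 0) x (vs[i := h]))"
      by (simp add: D_def blinfun.bounded_linear_right bounded_linear.linear)
  next
    fix vs :: "'a list"
    assume "length vs = Suc 0"
    then obtain v where "vs = [v]" by (auto simp: length_Suc_conv)
    then show "\<bar>D (Suc 0) x vs\<bar> \<le> norm (f' x) * (\<Prod>v\<leftarrow>vs. norm v)"
      using norm_blinfun[of "f' x" v] by (simp add: D_def)
  qed
  moreover have "bounded_form 0 (D 0 x)" for x
    unfolding bounded_form_def D_def by auto
  moreover have "((\<lambda>h. form_norm 0 (\<lambda>vs. D 0 (x + h) vs - D 0 x vs - D (Suc 0) x (h # vs)) / norm h)
        \<longlongrightarrow> 0) (at 0)" for x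
    using f'[of x] by (simp add: has_derivative_at form_norm_0 D_def)
  moreover have "((\<lambda>y. form_norm 0 (\<lambda>vs. D 0 y vs - D 0 x vs)) \<longlongrightarrow> 0) (at x)" for x
  proof -
    have "(f \<longlongrightarrow> f x) (at x)"
      using f'[of x] has_derivative_continuous isCont_def by blast
    from tendsto_rabs_zero[OF LIM_zero[OF this]] show ?thesis
      by (simp add: form_norm_0 D_def)
  qed
  moreover have "((\<lambda>y. form_norm (Suc 0) (\<lambda>vs. D (Suc 0) y vs - D (Suc 0) x vs)) \<longlongrightarrow> 0) (at x)" for x
  proof -
    have "form_norm (Suc 0) (\<lambda>vs. D (Suc 0) y vs - D (Suc 0) x vs) = norm (f' y - f' x)" for y
      unfolding form_norm_1[symmetric] D_def by (simp add: blinfun.diff_left)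
    moreover have "(f' \<longlongrightarrow> f' x) (at x)" using cont by (simp add: continuous_on_def)
    from tendsto_norm_zero[OF LIM_zero[OF this]]
    have "((\<lambda>y. norm (f' y - f' x)) \<longlongrightarrow> 0) (at x)" .
    ultimately show ?thesis by simp
  qed
  moreover have "D 0 x [] = f x" for x by (simp add: D_def)
  ultimately show "f \<in> C_class 1"
    unfolding C_class_def mem_Collect_eq by (intro exI[of _ D]) (auto simp: le1 lt1)
qed

end

theory Submission
  imports Defs
begin

text \<open>
  The core is a smoothing theorem: if \<open>f\<close> varies by at most \<open>M\<close> at scale \<open>r\<close>, there is a \<open>D M / r\<close>-Lipschitz
  function \<open>g\<close> of class \<open>C\<^sup>k\<close> with \<open>\<bar>f - g\<bar> \<le> D M\<close> that vanishes wherever \<open>f\<close> does, where \<open>D\<close> depends on the bump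
  only.  It comes from iterating the smooth maximum \<open>(a, b) \<mapsto> b + \<epsilon> \<rho> ((a - b) / \<epsilon>)\<close>, which is 1-Lipschitz for
  the sup norm and equals \<open>a\<close> when \<open>a \<ge> b + \<epsilon>\<close>: with summable errors \<open>\<epsilon>\<close> the iteration is
  locally stationary as soon as the family is locally dominated by finitely many members, so its limit keeps both the
  smoothness and the Lipschitz constant.

  If \<open>f\<close> has small oscillation at small scales, smoothing it at a small scale \<open>r\<close> where \<open>\<omega> r / r\<close> is almost
  minimal gives (i).  For (ii) one first truncates \<open>f - f 0\<close> between \<open>- w\<close> and \<open>w\<close> for a very wide cone \<open>w\<close>.
\<close>

section \<open>Calculus of functions of class \<open>C\<^sup>k\<close>\<close>

text \<open>A sum over a partition of unity needs bounded overlap to keep a Lipschitz constant, and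
  in infinite dimensions no compactness provides it. A maximum keeps the constant however many
  members it has, which is why the smoothing runs through suprema; separability makes the family of
  centres a sequence, so that the maximum can be iterated.

  The two bounds on \<open>g\<close> serve two ranges of distances. With
  \<open>M = \<eta> * \<omega> r\<close> the uniform error is harmless at distances
  \<open>t \<ge> r\<close>, because \<open>\<omega>\<close> is monotone. Below \<open>r\<close> the
  Lipschitz bound \<open>D * \<eta> * \<omega> r / r * t\<close> must be of order
  \<open>\<eta> * \<omega> t\<close>, and this is what almost minimality of
  \<open>\<omega> r / r\<close> gives.

  In (ii) the truncation destroys smoothness, so it has to precede the smoothing; bounded support
  survives since \<open>g\<close> vanishes wherever the smoothed function does. A cone of fixed
  height has small oscillation at large distances because \<open>\<omega>\<close> tends to infinity,
  and at the remaining ones once its slope is small, because \<open>t / \<omega> t\<close> is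
  bounded on bounded intervals.\<close>

definition cont_form :: "nat \<Rightarrow> ('a::real_normed_vector \<Rightarrow> 'a list \<Rightarrow> real) \<Rightarrow> 'a \<Rightarrow> bool"
  where "cont_form j F x \<longleftrightarrow> (\<forall>e>0. \<forall>\<^sub>F y in nhds x. \<forall>vs. length vs = j \<longrightarrow>
    \<bar>F y vs - F x vs\<bar> \<le> e * (\<Prod>v\<leftarrow>vs. norm v))"

text \<open>Here and in \<open>cont_form\<close> the operator norm is replaced by an estimate for
  every argument list. Such estimates add and multiply directly, and they stay meaningful for
  families not known to be bounded, for which the supremum in \<open>form_norm\<close> is an
  unspecified real.\<close>

definition has_dform ::
    "nat \<Rightarrow> ('a::real_normed_vector \<Rightarrow> 'a list \<Rightarrow> real) \<Rightarrow> ('a list \<Rightarrow> real) \<Rightarrow> 'a \<Rightarrow> bool"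
  where "has_dform j F M x \<longleftrightarrow> (\<forall>e>0. \<forall>\<^sub>F y in nhds x. \<forall>vs. length vs = j \<longrightarrow>
    \<bar>F y vs - F x vs - M ((y - x) # vs)\<bar> \<le> e * norm (y - x) * (\<Prod>v\<leftarrow>vs. norm v))"

lemma cont_formD:
  "cont_form j F x \<Longrightarrow> e > 0 \<Longrightarrow> \<forall>\<^sub>F y in nhds x. \<forall>vs. length vs = j \<longrightarrow>
    \<bar>F y vs - F x vs\<bar> \<le> e * (\<Prod>v\<leftarrow>vs. norm v)"
  unfolding cont_form_def by (drule spec, drule mp)

lemma has_dformD:
  "has_dform j F M x \<Longrightarrow> e > 0 \<Longrightarrow> \<forall>\<^sub>F y in nhds x. \<forall>vs. length vs = j \<longrightarrow>
    \<bar>F y vs - F x vs - M ((y - x) # vs)\<bar> \<le> e * norm (y - x) * (\<Prod>v\<leftarrow>vs. norm v)"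
  unfolding has_dform_def by (drule spec, drule mp)

definition dform :: "('a::real_normed_vector \<Rightarrow> 'a list \<Rightarrow> real) \<Rightarrow> 'a \<Rightarrow> 'a list \<Rightarrow> real"
  where "dform F x vs = deriv (\<lambda>t. F (x + t *\<^sub>R hd vs) (tl vs)) 0"

text \<open>Unlike in \<^const>\<open>C_class\<close>, the derivatives are fixed to be the directional ones, so that the condition depends
  only on the germ of \<open>F\<close> at \<open>x\<close> and the case \<open>k = \<infinity>\<close> needs no consistent choice over all orders.\<close>
fun Ck_form :: "nat \<Rightarrow> nat \<Rightarrow> ('a::real_normed_vector \<Rightarrow> 'a list \<Rightarrow> real) \<Rightarrow> 'a \<Rightarrow> bool"
  where
    "Ck_form 0 j F x \<longleftrightarrow> bounded_form j (F x) \<and> cont_form j F x"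
  | "Ck_form (Suc n) j F x \<longleftrightarrow> bounded_form j (F x) \<and> cont_form j F x \<and>
      has_dform j F (dform F x) x \<and> Ck_form n (Suc j) (dform F) x"

section \<open>Bounded multilinear forms and their operator norm\<close>

lemma prod_norm_nonneg [simp]: "0 \<le> (\<Prod>v\<leftarrow>vs. norm v)"
  by (induction vs) auto

lemma bounded_form_linear:
  "bounded_form j M \<Longrightarrow> length vs = j \<Longrightarrow> i < j \<Longrightarrow> linear (\<lambda>h. M (vs[i := h]))"
  unfolding bounded_form_def by blast

lemma bounded_form_bound:
  assumes "bounded_form j M"
  obtains K where "K \<ge> 0" "\<And>vs. length vs = j \<Longrightarrow> \<bar>M vs\<bar> \<le> K * (\<Prod>v\<leftarrow>vs. norm v)"
proof -
  from assms obtain K where K: "\<And>vs. length vs = j \<Longrightarrow> \<bar>M vs\<bar> \<le> K * (\<Prod>v\<leftarrow>vs. norm v)"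
    unfolding bounded_form_def by blast
  show thesis
  proof (rule that[of "max K 0"])
    fix vs :: "'a list" assume "length vs = j"
    then have "\<bar>M vs\<bar> \<le> K * (\<Prod>v\<leftarrow>vs. norm v)" by (rule K)
    also have "\<dots> \<le> max K 0 * (\<Prod>v\<leftarrow>vs. norm v)" by (intro mult_right_mono) auto
    finally show "\<bar>M vs\<bar> \<le> max K 0 * (\<Prod>v\<leftarrow>vs. norm v)" .
  qed auto
qed

lemma bounded_formI:
  assumes "\<And>vs i. length vs = j \<Longrightarrow> i < j \<Longrightarrow> linear (\<lambda>h. M (vs[i := h]))"
    and "\<And>vs. length vs = j \<Longrightarrow> \<bar>M vs\<bar> \<le> K * (\<Prod>v\<leftarrow>vs. norm v)"
  shows "bounded_form j M"
  using assms unfolding bounded_form_def by blast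

lemma bounded_form_cong:
  assumes "\<And>vs. length vs = j \<Longrightarrow> M vs = N vs" "bounded_form j M"
  shows "bounded_form j N"
  using assms unfolding bounded_form_def by (metis (no_types, lifting) ext length_list_update)

lemma bounded_form_add:
  assumes "bounded_form j M" "bounded_form j N"
  shows "bounded_form j (\<lambda>vs. M vs + N vs)"
proof -
  obtain K where K: "\<And>vs. length vs = j \<Longrightarrow> \<bar>M vs\<bar> \<le> K * (\<Prod>v\<leftarrow>vs. norm v)"
    using bounded_form_bound[OF assms(1)] by blast
  obtain L where L: "\<And>vs. length vs = j \<Longrightarrow> \<bar>N vs\<bar> \<le> L * (\<Prod>v\<leftarrow>vs. norm v)"
    using bounded_form_bound[OF assms(2)] by blast
  show ?thesis
  proof (rule bounded_formI[where K="K + L"])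
    fix vs :: "'a list" assume "length vs = j"
    from K[OF this] L[OF this] show "\<bar>M vs + N vs\<bar> \<le> (K + L) * (\<Prod>v\<leftarrow>vs. norm v)"
      by (simp add: algebra_simps)
  qed (intro linear_compose_add bounded_form_linear[OF assms(1)] bounded_form_linear[OF assms(2)])
qed

lemma bounded_form_scale:
  assumes "bounded_form j M"
  shows "bounded_form j (\<lambda>vs. c * M vs)"
proof -
  obtain K where K: "\<And>vs. length vs = j \<Longrightarrow> \<bar>M vs\<bar> \<le> K * (\<Prod>v\<leftarrow>vs. norm v)"
    using bounded_form_bound[OF assms(1)] by blast
  show ?thesis
  proof (rule bounded_formI[where K="\<bar>c\<bar> * K"])
    fix vs :: "'a list" assume "length vs = j"
    from mult_left_mono[OF K[OF this], of "\<bar>c\<bar>"]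
    show "\<bar>c * M vs\<bar> \<le> \<bar>c\<bar> * K * (\<Prod>v\<leftarrow>vs. norm v)" by (simp add: abs_mult)
  next
    fix vs :: "'a list" and i assume "length vs = j" "i < j"
    from linear_compose_scale_right[OF bounded_form_linear[OF assms this], of c]
    show "linear (\<lambda>h. c * M (vs[i := h]))" by simp
  qed
qed

lemma bounded_form_diff:
  "bounded_form j M \<Longrightarrow> bounded_form j N \<Longrightarrow> bounded_form j (\<lambda>vs. M vs - N vs)"
  using bounded_form_add[of j M "\<lambda>vs. (- 1) * N vs"] bounded_form_scale[of j N "- 1"] by simp

lemma bounded_form_Cons:
  assumes "bounded_form (Suc j) M"
  shows "bounded_form j (\<lambda>vs. M (h # vs))"
proof -
  obtain K where K: "\<And>vs. length vs = Suc j \<Longrightarrow> \<bar>M vs\<bar> \<le> K * (\<Prod>v\<leftarrow>vs. norm v)"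
    using bounded_form_bound[OF assms(1)] by blast
  show ?thesis
  proof (rule bounded_formI[where K="K * norm h"])
    fix vs :: "'a list" assume "length vs = j"
    then show "\<bar>M (h # vs)\<bar> \<le> K * norm h * (\<Prod>v\<leftarrow>vs. norm v)"
      using K[of "h # vs"] by (simp add: mult.assoc)
  next
    fix vs :: "'a list" and i assume "length vs = j" "i < j"
    then show "linear (\<lambda>v. M (h # vs[i := v]))"
      using bounded_form_linear[OF assms, of "h # vs" "Suc i"] by simp
  qed
qed

lemma bounded_form_linear_hd:
  assumes "bounded_form (Suc j) M" "length vs = j"
  shows "linear (\<lambda>h. M (h # vs))"
  using bounded_form_linear[OF assms(1), of "undefined # vs" 0] assms(2) by simp

lemma prod_norm_le_1: "(\<And>v. v \<in> set vs \<Longrightarrow> norm v \<le> 1) \<Longrightarrow> (\<Prod>v\<leftarrow>vs. norm v) \<le> 1"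
  by (induction vs) (auto intro: mult_le_one)

lemma form_norm_le:
  assumes "K \<ge> 0" "\<And>vs. length vs = j \<Longrightarrow> \<bar>M vs\<bar> \<le> K * (\<Prod>v\<leftarrow>vs. norm v)"
  shows "form_norm j M \<le> K"
  unfolding form_norm_def
proof (rule cSUP_least)
  have "replicate j 0 \<in> {vs::'a list. length vs = j \<and> (\<forall>v \<in> set vs. norm v \<le> 1)}" by auto
  then show "{vs::'a list. length vs = j \<and> (\<forall>v \<in> set vs. norm v \<le> 1)} \<noteq> {}" by blast
  fix vs :: "'a list" assume "vs \<in> {vs. length vs = j \<and> (\<forall>v \<in> set vs. norm v \<le> 1)}"
  then show "\<bar>M vs\<bar> \<le> K"
    using assms(2)[of vs] mult_left_mono[OF prod_norm_le_1[of vs] assms(1)] by simp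
qed

lemma form_norm_upper:
  assumes bf: "bounded_form j M" and vs: "length vs = j" "\<And>v. v \<in> set vs \<Longrightarrow> norm v \<le> 1"
  shows "\<bar>M vs\<bar> \<le> form_norm j M"
  unfolding form_norm_def
proof (rule cSUP_upper)
  obtain K where K: "K \<ge> 0" "\<And>vs. length vs = j \<Longrightarrow> \<bar>M vs\<bar> \<le> K * (\<Prod>v\<leftarrow>vs. norm v)"
    using bounded_form_bound[OF bf] by blast
  show "bdd_above ((\<lambda>vs. \<bar>M vs\<bar>) ` {vs. length vs = j \<and> (\<forall>v \<in> set vs. norm v \<le> 1)})"
  proof (rule bdd_aboveI2)
    fix vs assume "vs \<in> {vs::'a list. length vs = j \<and> (\<forall>v \<in> set vs. norm v \<le> 1)}"
    then show "\<bar>M vs\<bar> \<le> K" using K(2)[of vs] mult_left_mono[OF prod_norm_le_1[of vs] K(1)] by simp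
  qed
qed (use vs in auto)

text \<open>Homogeneity in each slot: the arguments are normalised one at a time,
  \<open>scale\<close> recording the factors already pulled out. A zero argument cannot be
  normalised, but then the bound defining \<open>bounded_form\<close> already forces
  \<open>M vs = 0\<close>.\<close>

lemma form_norm_bound:
  assumes bf: "bounded_form j M" and len: "length vs = j"
  shows "\<bar>M vs\<bar> \<le> form_norm j M * (\<Prod>v\<leftarrow>vs. norm v)"
proof (cases "0 \<in> set vs")
  case True
  obtain K where "\<And>vs. length vs = j \<Longrightarrow> \<bar>M vs\<bar> \<le> K * (\<Prod>v\<leftarrow>vs. norm v)"
    using bounded_form_bound[OF bf] by blast
  moreover have "(\<Prod>v\<leftarrow>vs. norm v) = 0" using True by (force simp: prod_list_zero_iff)
  ultimately show ?thesis using len by force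
next
  case False
  define us where "us = map (\<lambda>v. v /\<^sub>R norm v) vs"
  have scale: "M (take i us @ drop i vs) * (\<Prod>v\<leftarrow>take i vs. norm v) = M vs" if "i \<le> j" for i
    using that
  proof (induction i)
    case (Suc i)
    let ?ws = "take i us @ drop i vs"
    have i: "i < j" "i < length vs" using Suc.prems len by auto
    have lin: "linear (\<lambda>h. M (?ws[i := h]))"
      using bounded_form_linear[OF bf, of ?ws i] i len by (simp add: us_def)
    have "?ws[i := h] = take i us @ h # drop (Suc i) vs" for h
      using i by (simp add: us_def list_update_append Cons_nth_drop_Suc[symmetric])
    note upd = this
    have "take (Suc i) us = take i us @ [vs ! i /\<^sub>R norm (vs ! i)]"
      using i by (simp add: us_def take_Suc_conv_app_nth)
    then have "M (take (Suc i) us @ drop (Suc i) vs) = M (?ws[i := vs ! i /\<^sub>R norm (vs ! i)])"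
      by (simp add: upd)
    also have "\<dots> = M (?ws[i := vs ! i]) / norm (vs ! i)"
      using linear_scale[OF lin] by (simp add: divide_inverse mult.commute)
    also have "?ws[i := vs ! i] = ?ws"
      using i by (simp add: upd Cons_nth_drop_Suc)
    finally have "M (take (Suc i) us @ drop (Suc i) vs) = M ?ws / norm (vs ! i)" .
    moreover have "norm (vs ! i) \<noteq> 0" using False i by (metis norm_eq_zero nth_mem)
    moreover have "(\<Prod>v\<leftarrow>take (Suc i) vs. norm v) = (\<Prod>v\<leftarrow>take i vs. norm v) * norm (vs ! i)"
      using i by (simp add: take_Suc_conv_app_nth)
    ultimately show ?case using Suc.IH i by simp
  qed simp
  have "\<bar>M us\<bar> \<le> form_norm j M"
  proof (rule form_norm_upper[OF bf])
    fix u assume "u \<in> set us"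
    then obtain v where "v \<in> set vs" "u = v /\<^sub>R norm v" by (auto simp: us_def)
    with False show "norm u \<le> 1" by (cases "v = 0") auto
  qed (use len in \<open>simp add: us_def\<close>)
  moreover have "M us * (\<Prod>v\<leftarrow>vs. norm v) = M vs" using scale[of j] len by (simp add: us_def)
  then have "\<bar>M vs\<bar> = \<bar>M us\<bar> * (\<Prod>v\<leftarrow>vs. norm v)"
    using abs_mult[of "M us" "\<Prod>v\<leftarrow>vs. norm v"] by simp
  ultimately show ?thesis by (simp add: mult_right_mono)
qed

text \<open>The bridge between the limits in \<open>C_class\<close> and the estimates used here. The
  weight \<open>c\<close> is 1 for continuity and \<open>norm (y - x)\<close> for differentiability,
  so it may vanish at \<open>x\<close> itself.\<close>

lemma form_norm_tendsto_iff:
  fixes N :: "'b::topological_space \<Rightarrow> 'a::real_normed_vector list \<Rightarrow> real"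
  assumes bf: "\<And>y. bounded_form j (N y)" and c: "\<And>y. y \<noteq> x \<Longrightarrow> c y > (0::real)"
  shows "((\<lambda>y. form_norm j (N y) / c y) \<longlongrightarrow> 0) (at x) \<longleftrightarrow>
    (\<forall>e>0. \<forall>\<^sub>F y in at x. \<forall>vs. length vs = j \<longrightarrow> \<bar>N y vs\<bar> \<le> e * c y * (\<Prod>v\<leftarrow>vs. norm v))"
    (is "?L \<longleftrightarrow> ?R")
proof
  assume ?L
  show ?R
  proof (intro allI impI)
    fix e :: real assume "e > 0"
    with \<open>?L\<close> have "\<forall>\<^sub>F y in at x. form_norm j (N y) / c y < e"
      by (metis order_tendstoD(2))
    moreover have "\<forall>\<^sub>F y in at x. c y > 0"
      using c by (auto simp: eventually_at_filter)
    ultimately show "\<forall>\<^sub>F y in at x. \<forall>vs. length vs = j \<longrightarrow> \<bar>N y vs\<bar> \<le> e * c y * (\<Prod>v\<leftarrow>vs. norm v)"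
    proof eventually_elim
      case (elim y)
      show ?case
      proof (intro allI impI)
        fix vs :: "'a list" assume "length vs = j"
        have "\<bar>N y vs\<bar> \<le> form_norm j (N y) * (\<Prod>v\<leftarrow>vs. norm v)"
          by (rule form_norm_bound[OF bf]) fact
        also have "\<dots> \<le> e * c y * (\<Prod>v\<leftarrow>vs. norm v)"
          using elim by (intro mult_right_mono) (auto simp: field_simps)
        finally show "\<bar>N y vs\<bar> \<le> e * c y * (\<Prod>v\<leftarrow>vs. norm v)" .
      qed
    qed
  qed
next
  assume R: ?R
  show ?L
  proof (rule tendstoI)
    fix e :: real assume "e > 0"
    then have "\<forall>\<^sub>F y in at x. \<forall>vs. length vs = j \<longrightarrow> \<bar>N y vs\<bar> \<le> e/2 * c y * (\<Prod>v\<leftarrow>vs. norm v)"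
      using R[rule_format, of "e/2"] by simp
    moreover have "\<forall>\<^sub>F y in at x. c y > 0"
      using c by (auto simp: eventually_at_filter)
    ultimately show "\<forall>\<^sub>F y in at x. dist (form_norm j (N y) / c y) 0 < e"
    proof eventually_elim
      case (elim y)
      then have "form_norm j (N y) \<le> e/2 * c y"
        using \<open>e > 0\<close> by (intro form_norm_le) auto
      moreover have "0 \<le> form_norm j (N y)"
        using form_norm_upper[OF bf, of "replicate j 0" y] by simp
      moreover have "0 < e * c y" using elim \<open>e > 0\<close> by simp
      ultimately show ?case using elim by (simp add: field_simps)
    qed
  qed
qed

lemma cont_form_iff:
  assumes "\<And>y. bounded_form j (F y)"
  shows "cont_form j F x \<longleftrightarrow> ((\<lambda>y. form_norm j (\<lambda>vs. F y vs - F x vs)) \<longlongrightarrow> 0) (at x)"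
proof -
  have bf: "bounded_form j (\<lambda>vs. F y vs - F x vs)" for y
    by (intro bounded_form_diff assms)
  from form_norm_tendsto_iff[where N="\<lambda>y vs. F y vs - F x vs" and c="\<lambda>_. 1", OF bf]
  show ?thesis
    unfolding cont_form_def eventually_nhds_conv_at by simp
qed

lemma has_dform_iff:
  assumes "\<And>y. bounded_form j (F y)" "bounded_form (Suc j) M"
  shows "has_dform j F M x \<longleftrightarrow>
    ((\<lambda>h. form_norm j (\<lambda>vs. F (x + h) vs - F x vs - M (h # vs)) / norm h) \<longlongrightarrow> 0) (at 0)"
proof -
  have bf: "bounded_form j (\<lambda>vs. F y vs - F x vs - M ((y - x) # vs))" for y
    by (intro bounded_form_diff bounded_form_Cons assms)
  \<comment> \<open>\<open>has_dform\<close> is stated with \<open>nhds x\<close> and thus includes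
    the point \<open>x\<close>, where the estimate says exactly this.\<close>
  have 0: "M (0 # vs) = 0" if "length vs = j" for vs
    using linear_0[OF bounded_form_linear_hd[OF assms(2) that]] .
  from form_norm_tendsto_iff[where c="\<lambda>y. norm (y - x)", OF bf]
  have "has_dform j F M x \<longleftrightarrow> ((\<lambda>y. form_norm j (\<lambda>vs. F y vs - F x vs - M ((y - x) # vs)) / norm (y - x)) \<longlongrightarrow> 0) (at x)"
    unfolding has_dform_def eventually_nhds_conv_at by (simp add: 0)
  also have "\<dots> \<longleftrightarrow> ((\<lambda>h. form_norm j (\<lambda>vs. F (x + h) vs - F x vs - M (h # vs)) / norm h) \<longlongrightarrow> 0) (at 0)"
    by (subst LIM_offset_zero_iff) (auto simp: algebra_simps)
  finally show ?thesis .
qed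

text \<open>Uniqueness of the derivative: restricted to the line through \<open>x\<close> in the
  direction of the first argument, the Frechet estimate becomes an ordinary derivative in one
  variable.\<close>

lemma dform_eq:
  assumes d: "has_dform j F M x" and bf: "bounded_form (Suc j) M" and len: "length vs = Suc j"
  shows "dform F x vs = M vs"
proof -
  obtain h us where vs: "vs = h # us" and us: "length us = j"
    using len by (auto simp: length_Suc_conv)
  have lin: "linear (\<lambda>h. M (h # us))" by (rule bounded_form_linear_hd[OF bf us])
  have "((\<lambda>t. F (x + t *\<^sub>R h) us) has_real_derivative M (h # us)) (at 0)"
    unfolding has_field_derivative_def has_derivative_at_alt
  proof (intro conjI allI impI)
    show "bounded_linear ((*) (M (h # us)))" by (rule bounded_linear_mult_right)
    fix e :: real assume e: "e > 0"
    define P where "P = norm h * (\<Prod>v\<leftarrow>us. norm v)"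
    have P: "P \<ge> 0" by (simp add: P_def)
    \<comment> \<open>\<open>P\<close> is 0 when one of the arguments vanishes, hence the
      \<open>+ 1\<close>.\<close>
    have "e / (P + 1) > 0" using P e by simp
    then have "\<forall>\<^sub>F y in nhds x. \<forall>vs. length vs = j \<longrightarrow>
        \<bar>F y vs - F x vs - M ((y - x) # vs)\<bar> \<le> e / (P + 1) * norm (y - x) * (\<Prod>v\<leftarrow>vs. norm v)"
      using d unfolding has_dform_def by blast
    moreover have "((\<lambda>t. x + t *\<^sub>R h) \<longlongrightarrow> x) (nhds 0)"
      by (auto intro!: tendsto_eq_intros filterlim_ident)
    ultimately have "\<forall>\<^sub>F t in nhds (0::real). \<forall>vs. length vs = j \<longrightarrow>
        \<bar>F (x + t *\<^sub>R h) vs - F x vs - M ((x + t *\<^sub>R h - x) # vs)\<bar> \<le> e / (P + 1) * norm (x + t *\<^sub>R h - x) * (\<Prod>v\<leftarrow>vs. norm v)"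
      by (rule eventually_compose_filterlim)
    then obtain d where d: "d > 0" and D: "\<And>t vs. dist t 0 < d \<Longrightarrow> length vs = j \<Longrightarrow>
        \<bar>F (x + t *\<^sub>R h) vs - F x vs - M ((x + t *\<^sub>R h - x) # vs)\<bar> \<le> e / (P + 1) * norm (x + t *\<^sub>R h - x) * (\<Prod>v\<leftarrow>vs. norm v)"
      unfolding eventually_nhds_metric by blast
    have "norm (F (x + t *\<^sub>R h) us - F (x + 0 *\<^sub>R h) us - M (h # us) * (t - 0)) \<le> e * norm (t - 0)"
      if "norm (t - 0) < d" for t
    proof -
      have "\<bar>F (x + t *\<^sub>R h) us - F x us - M ((t *\<^sub>R h) # us)\<bar> \<le> e / (P + 1) * (\<bar>t\<bar> * P)"
        using D[of t us] that us by (simp add: P_def mult.assoc)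
      also have "\<dots> = P / (P + 1) * (e * \<bar>t\<bar>)" by simp
      also have "\<dots> \<le> 1 * (e * \<bar>t\<bar>)" using P e by (intro mult_right_mono) auto
      finally show ?thesis using linear_scale[OF lin] by (simp add: mult.commute)
    qed
    with d show "\<exists>d>0. \<forall>t. norm (t - 0) < d \<longrightarrow>
        norm (F (x + t *\<^sub>R h) us - F (x + 0 *\<^sub>R h) us - M (h # us) * (t - 0)) \<le> e * norm (t - 0)"
      by blast
  qed
  then show ?thesis unfolding dform_def vs by (simp add: DERIV_imp_deriv)
qed

section \<open>Locality of \<open>Ck_form\<close> and its equivalence with
  \<open>C_class\<close>\<close>

lemma Ck_form_bounded: "Ck_form n j F x \<Longrightarrow> bounded_form j (F x)"
  and Ck_form_cont: "Ck_form n j F x \<Longrightarrow> cont_form j F x"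
  by (cases n; simp)+

lemma has_dform_cong:
  assumes ev: "\<forall>\<^sub>F y in nhds x. \<forall>vs. length vs = j \<longrightarrow> F y vs = G y vs"
    and MN: "\<And>vs. length vs = Suc j \<Longrightarrow> M vs = N vs"
    and d: "has_dform j F M x"
  shows "has_dform j G N x"
  unfolding has_dform_def
proof (intro allI impI)
  fix e :: real assume "e > 0"
  with d have "\<forall>\<^sub>F y in nhds x. \<forall>vs. length vs = j \<longrightarrow>
      \<bar>F y vs - F x vs - M ((y - x) # vs)\<bar> \<le> e * norm (y - x) * (\<Prod>v\<leftarrow>vs. norm v)"
    unfolding has_dform_def by blast
  with ev show "\<forall>\<^sub>F y in nhds x. \<forall>vs. length vs = j \<longrightarrow>
      \<bar>G y vs - G x vs - N ((y - x) # vs)\<bar> \<le> e * norm (y - x) * (\<Prod>v\<leftarrow>vs. norm v)"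
  proof eventually_elim
    case (elim y)
    then show ?case using eventually_nhds_x_imp_x[OF ev] MN by simp
  qed
qed

lemma cont_form_cong:
  assumes ev: "\<forall>\<^sub>F y in nhds x. \<forall>vs. length vs = j \<longrightarrow> F y vs = G y vs"
    and d: "cont_form j F x"
  shows "cont_form j G x"
  unfolding cont_form_def
proof (intro allI impI)
  fix e :: real assume "e > 0"
  with d have "\<forall>\<^sub>F y in nhds x. \<forall>vs. length vs = j \<longrightarrow> \<bar>F y vs - F x vs\<bar> \<le> e * (\<Prod>v\<leftarrow>vs. norm v)"
    unfolding cont_form_def by blast
  with ev show "\<forall>\<^sub>F y in nhds x. \<forall>vs. length vs = j \<longrightarrow> \<bar>G y vs - G x vs\<bar> \<le> e * (\<Prod>v\<leftarrow>vs. norm v)"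
  proof eventually_elim
    case (elim y)
    then show ?case using eventually_nhds_x_imp_x[OF ev] by simp
  qed
qed

lemma dform_cong:
  assumes "\<forall>\<^sub>F y in nhds x. \<forall>vs. length vs = j \<longrightarrow> F y vs = G y vs" "length vs = Suc j"
  shows "dform F x vs = dform G x vs"
proof -
  have "((\<lambda>t. x + t *\<^sub>R hd vs) \<longlongrightarrow> x) (nhds (0::real))"
    by (auto intro!: tendsto_eq_intros filterlim_ident)
  with assms(1) have "\<forall>\<^sub>F t in nhds (0::real). \<forall>ws. length ws = j \<longrightarrow> F (x + t *\<^sub>R hd vs) ws = G (x + t *\<^sub>R hd vs) ws"
    by (rule eventually_compose_filterlim)
  then have "\<forall>\<^sub>F t in nhds (0::real). F (x + t *\<^sub>R hd vs) (tl vs) = G (x + t *\<^sub>R hd vs) (tl vs)"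
    by eventually_elim (use assms(2) in simp)
  then show ?thesis unfolding dform_def by (intro deriv_cong_ev) auto
qed

text \<open>Equality near \<open>x\<close> is also equality near every point close to
  \<open>x\<close> (\<open>eventually_eventually\<close>), so it passes to the directional
  derivatives and the induction can continue.\<close>

lemma Ck_form_cong:
  assumes "\<forall>\<^sub>F y in nhds x. \<forall>vs. length vs = j \<longrightarrow> F y vs = G y vs" "Ck_form n j F x"
  shows "Ck_form n j G x"
  using assms
proof (induction n arbitrary: j F G)
  case 0
  then show ?case
    using cont_form_cong[OF 0(1)] bounded_form_cong[of j "F x" "G x"] eventually_nhds_x_imp_x[OF 0(1)]
    by simp
next
  case (Suc n)
  from Suc.prems(1)
  have "\<forall>\<^sub>F y in nhds x. \<forall>\<^sub>F z in nhds y. \<forall>vs. length vs = j \<longrightarrow> F z vs = G z vs"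
    by (simp add: eventually_eventually)
  then have ev: "\<forall>\<^sub>F y in nhds x. \<forall>vs. length vs = Suc j \<longrightarrow> dform F y vs = dform G y vs"
    by eventually_elim (use dform_cong in blast)
  have "has_dform j G (dform G x) x"
    using Suc.prems(2) eventually_nhds_x_imp_x[OF ev] by (intro has_dform_cong[OF Suc.prems(1), where M="dform F x"]) auto
  moreover have "Ck_form n (Suc j) (dform G) x"
    using Suc.IH[OF ev] Suc.prems(2) by simp
  ultimately show ?case
    using Suc.prems cont_form_cong[OF Suc.prems(1)] bounded_form_cong[of j "F x" "G x"] eventually_nhds_x_imp_x[OF Suc.prems(1)]
    by simp
qed

text \<open>Lets a proof exhibit a derivative \<open>F'\<close> by formula instead of computing
  \<open>dform F\<close>. The assumptions range over all points because \<open>F'\<close> and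
  \<open>dform F\<close> have to agree in a neighbourhood before the remaining orders can be
  transferred.\<close>

lemma Ck_form_SucI:
  assumes "\<And>y. bounded_form j (F y)" "\<And>y. cont_form j F y" "\<And>y. has_dform j F (F' y) y"
    and "\<And>y. Ck_form n (Suc j) F' y"
  shows "Ck_form (Suc n) j F x"
proof -
  have eq: "F' y vs = dform F y vs" if "length vs = Suc j" for y vs
    using dform_eq[OF assms(3) Ck_form_bounded[OF assms(4)] that] by simp
  have "has_dform j F (dform F x) x"
    by (rule has_dform_cong[OF _ eq assms(3)]) auto
  moreover have "Ck_form n (Suc j) (dform F) x"
    by (rule Ck_form_cong[OF _ assms(4)]) (auto simp: eq)
  ultimately show ?thesis using assms by simp
qed

lemma Ck_form_mono: "Ck_form (Suc n) j F x \<Longrightarrow> Ck_form n j F x"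
  by (induction n arbitrary: j F) auto

lemma Ck_form_iterate: "Ck_form (m + i) j F x \<Longrightarrow> Ck_form m (i + j) ((dform ^^ i) F) x"
proof (induction i arbitrary: j F)
  case (Suc i)
  then have "Ck_form (m + i) (Suc j) (dform F) x" by simp
  from Suc.IH[OF this] show ?case by (simp add: funpow_Suc_right del: funpow.simps)
qed simp

text \<open>A witness \<open>D\<close> agrees with the directional derivatives by uniqueness.
  Conversely the iterates of \<open>dform\<close> form one sequence that serves every order up to
  \<open>k\<close>, so finite orders can be treated separately afterwards.\<close>

lemma C_class_iff:
  "f \<in> C_class k \<longleftrightarrow> (\<forall>n x. enat n \<le> k \<longrightarrow> Ck_form n 0 (\<lambda>x vs. f x) x)"
proof
  assume "f \<in> C_class k"
  then obtain D where D: "\<And>x. D 0 x [] = f x"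
    and b: "\<And>j x. enat j \<le> k \<Longrightarrow> bounded_form j (D j x)"
    and d: "\<And>j x. enat j < k \<Longrightarrow>
      ((\<lambda>h. form_norm j (\<lambda>vs. D j (x + h) vs - D j x vs - D (Suc j) x (h # vs)) / norm h)
        \<longlongrightarrow> 0) (at 0)"
    and c: "\<And>j x. enat j \<le> k \<Longrightarrow> ((\<lambda>y. form_norm j (\<lambda>vs. D j y vs - D j x vs)) \<longlongrightarrow> 0) (at x)"
    unfolding C_class_def by blast
  have cont: "cont_form j (D j) x" if "enat j \<le> k" for j x
    using cont_form_iff[where F="D j", OF b[OF that]] c[OF that] by blast
  have "\<forall>x. Ck_form n j (D j) x" if "enat (n + j) \<le> k" for n j
    using that
  proof (induction n arbitrary: j)
    case 0
    then show ?case using b cont by simp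
  next
    case (Suc n)
    have le: "enat j \<le> k" "enat (Suc j) \<le> k" "enat j < k"
      using Suc.prems by (cases k; simp)+
    have "has_dform j (D j) (D (Suc j) x) x" for x
      using has_dform_iff[where F="D j" and M="D (Suc j) x", OF b[OF le(1)] b[OF le(2)]] d[OF le(3)] by blast
    moreover have "Ck_form n (Suc j) (D (Suc j)) x" for x
      using Suc.IH[of "Suc j"] Suc.prems by simp
    ultimately show ?case
      using b[OF le(1)] cont[OF le(1)] by (intro allI Ck_form_SucI[where F'="D (Suc j)"]) auto
  qed
  then have *: "Ck_form n 0 (D 0) x" if "enat n \<le> k" for n x using that by simp
  show "\<forall>n x. enat n \<le> k \<longrightarrow> Ck_form n 0 (\<lambda>x vs. f x) x"
    using D by (auto intro!: Ck_form_cong[OF _ *])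
next
  assume C: "\<forall>n x. enat n \<le> k \<longrightarrow> Ck_form n 0 (\<lambda>x vs. f x) x"
  define D where "D j = (dform ^^ j) (\<lambda>x vs. f x)" for j
  have C0: "bounded_form j (D j x)" "cont_form j (D j) x" if "enat j \<le> k" for j x
    using C[rule_format, OF that, of x] Ck_form_iterate[of 0 j 0 "\<lambda>x vs. f x" x] by (simp_all add: D_def)
  have C1: "has_dform j (D j) (D (Suc j) x) x" if "enat j < k" for j x
  proof -
    have "enat (Suc j) \<le> k" using that by (simp add: Suc_ile_eq)
    then show ?thesis
      using C[rule_format, of "Suc j" x] Ck_form_iterate[of "Suc 0" j 0 "\<lambda>x vs. f x" x]
      by (simp add: D_def)
  qed
  show "f \<in> C_class k"
    unfolding C_class_def mem_Collect_eq
  proof (intro exI[of _ D] conjI allI impI)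
    fix j x assume j: "enat j < k"
    then have "enat j \<le> k" "enat (Suc j) \<le> k" by (simp_all add: Suc_ile_eq)
    then show "((\<lambda>h. form_norm j (\<lambda>vs. D j (x + h) vs - D j x vs - D (Suc j) x (h # vs)) / norm h) \<longlongrightarrow> 0) (at 0)"
      using has_dform_iff[where F="D j" and M="D (Suc j) x", OF C0(1) C0(1)] C1[OF j] by blast
  next
    fix j x assume j: "enat j \<le> k"
    show "((\<lambda>y. form_norm j (\<lambda>vs. D j y vs - D j x vs)) \<longlongrightarrow> 0) (at x)"
      using cont_form_iff[where F="D j", OF C0(1)[OF j]] C0(2)[OF j] by blast
  qed (use C0 in \<open>auto simp: D_def\<close>)
qed

section \<open>Sums and products of forms\<close>

lemma Ck_form_add:
  assumes "\<And>x. Ck_form n j F x" "\<And>x. Ck_form n j G x"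
  shows "Ck_form n j (\<lambda>x vs. F x vs + G x vs) x"
  using assms
proof (induction n arbitrary: j F G x)
  have halves: "e * P = e/2 * P + e/2 * P" "e * c * P = e/2 * c * P + e/2 * c * P" for e c P :: real
    by simp_all
  have cont: "cont_form j (\<lambda>x vs. F x vs + G x vs) x"
    if "cont_form j F x" "cont_form j G x" for j and F G :: "'a \<Rightarrow> 'a list \<Rightarrow> real" and x
    unfolding cont_form_def
  proof (intro allI impI)
    fix e :: real assume "e > 0"
    then have e: "e/2 > 0" by simp
    have "\<forall>\<^sub>F y in nhds x. \<forall>vs. length vs = j \<longrightarrow> \<bar>F y vs - F x vs\<bar> \<le> e/2 * (\<Prod>v\<leftarrow>vs. norm v)"
      "\<forall>\<^sub>F y in nhds x. \<forall>vs. length vs = j \<longrightarrow> \<bar>G y vs - G x vs\<bar> \<le> e/2 * (\<Prod>v\<leftarrow>vs. norm v)"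
      by (rule cont_formD[OF that(1) e], rule cont_formD[OF that(2) e])
    then show "\<forall>\<^sub>F y in nhds x. \<forall>vs. length vs = j \<longrightarrow>
        \<bar>F y vs + G y vs - (F x vs + G x vs)\<bar> \<le> e * (\<Prod>v\<leftarrow>vs. norm v)"
    proof eventually_elim
      case (elim y)
      show ?case
      proof (intro allI impI)
        fix vs :: "'a list" assume "length vs = j"
        with elim have "\<bar>F y vs - F x vs\<bar> \<le> e/2 * (\<Prod>v\<leftarrow>vs. norm v)"
          "\<bar>G y vs - G x vs\<bar> \<le> e/2 * (\<Prod>v\<leftarrow>vs. norm v)" by blast+
        then show "\<bar>F y vs + G y vs - (F x vs + G x vs)\<bar> \<le> e * (\<Prod>v\<leftarrow>vs. norm v)"
          using halves(1)[of e "\<Prod>v\<leftarrow>vs. norm v"] by linarith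
      qed
    qed
  qed
  {
    case 0
    then show ?case by (simp add: cont bounded_form_add)
  next
    case (Suc n)
    show ?case
    proof (rule Ck_form_SucI[where F'="\<lambda>x vs. dform F x vs + dform G x vs"])
      fix y
      show "Ck_form n (Suc j) (\<lambda>x vs. dform F x vs + dform G x vs) y"
        using Suc by auto
      show "bounded_form j (\<lambda>vs. F y vs + G y vs)" "cont_form j (\<lambda>x vs. F x vs + G x vs) y"
        using Suc.prems by (auto intro!: cont bounded_form_add)
      have d: "has_dform j F (dform F y) y" "has_dform j G (dform G y) y"
        using Suc.prems by auto
      show "has_dform j (\<lambda>x vs. F x vs + G x vs) (\<lambda>vs. dform F y vs + dform G y vs) y"
        unfolding has_dform_def
      proof (intro allI impI)
        fix e :: real assume "e > 0"
        then have e: "e/2 > 0" by simp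
        have "\<forall>\<^sub>F z in nhds y. \<forall>vs. length vs = j \<longrightarrow>
            \<bar>F z vs - F y vs - dform F y ((z - y) # vs)\<bar> \<le> e/2 * norm (z - y) * (\<Prod>v\<leftarrow>vs. norm v)"
          "\<forall>\<^sub>F z in nhds y. \<forall>vs. length vs = j \<longrightarrow>
            \<bar>G z vs - G y vs - dform G y ((z - y) # vs)\<bar> \<le> e/2 * norm (z - y) * (\<Prod>v\<leftarrow>vs. norm v)"
          by (rule has_dformD[OF d(1) e], rule has_dformD[OF d(2) e])
        then show "\<forall>\<^sub>F z in nhds y. \<forall>vs. length vs = j \<longrightarrow>
            \<bar>F z vs + G z vs - (F y vs + G y vs) - (dform F y ((z - y) # vs) + dform G y ((z - y) # vs))\<bar>
              \<le> e * norm (z - y) * (\<Prod>v\<leftarrow>vs. norm v)"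
        proof eventually_elim
          case (elim z)
          show ?case
          proof (intro allI impI)
            fix vs :: "'a list" assume "length vs = j"
            with elim have "\<bar>F z vs - F y vs - dform F y ((z - y) # vs)\<bar> \<le> e/2 * norm (z - y) * (\<Prod>v\<leftarrow>vs. norm v)"
              "\<bar>G z vs - G y vs - dform G y ((z - y) # vs)\<bar> \<le> e/2 * norm (z - y) * (\<Prod>v\<leftarrow>vs. norm v)" by blast+
            then show "\<bar>F z vs + G z vs - (F y vs + G y vs) - (dform F y ((z - y) # vs) + dform G y ((z - y) # vs))\<bar>
              \<le> e * norm (z - y) * (\<Prod>v\<leftarrow>vs. norm v)"
              using halves(2)[of e "norm (z - y)" "\<Prod>v\<leftarrow>vs. norm v"] by linarith
          qed
        qed
      qed
    qed
  }
qed

lemma prod_norm_nths: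
  "(\<Prod>v\<leftarrow>vs. norm v) = (\<Prod>v\<leftarrow>nths vs A. norm v) * (\<Prod>v\<leftarrow>nths vs (- A). norm v)"
proof (induction vs arbitrary: A)
  case (Cons v vs)
  have "- {j. Suc j \<in> A} = {j. Suc j \<in> - A}" by auto
  with Cons.IH[of "{j. Suc j \<in> A}"] show ?case
    by (auto simp: nths_Cons)
qed simp

lemma nths_list_update_notin:
  "p \<notin> A \<Longrightarrow> nths (vs[p := h]) A = nths vs A"
proof (induction vs arbitrary: p A)
  case (Cons v vs)
  then show ?case by (cases p) (auto simp: nths_Cons)
qed simp

lemma nths_list_update_in:
  assumes "p \<in> A" "p < length vs"
  obtains q where "q < length (nths vs A)" "\<And>h. nths (vs[p := h]) A = (nths vs A)[q := h]"
proof -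
  have "\<exists>q<length (nths vs A). \<forall>h. nths (vs[p := h]) A = (nths vs A)[q := h]"
    using assms
  proof (induction vs arbitrary: p A)
    case (Cons v vs)
    show ?case
    proof (cases p)
      case 0
      with Cons.prems show ?thesis by (auto simp: nths_Cons)
    next
      case (Suc r)
      with Cons.prems have "r \<in> {j. Suc j \<in> A}" "r < length vs" by simp_all
      from Cons.IH[OF this] obtain q where q: "q < length (nths vs {j. Suc j \<in> A})"
        "\<And>h. nths (vs[r := h]) {j. Suc j \<in> A} = (nths vs {j. Suc j \<in> A})[q := h]" by blast
      show ?thesis
      proof (cases "0 \<in> A")
        case True
        with q show ?thesis by (intro exI[of _ "Suc q"]) (simp add: nths_Cons Suc)
      next
        case False
        with q show ?thesis by (intro exI[of _ q]) (simp add: nths_Cons Suc)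
      qed
    qed
  qed simp
  then show thesis using that by blast
qed

definition splits :: "nat \<Rightarrow> nat \<Rightarrow> nat set \<Rightarrow> bool"
  where "splits i j A \<longleftrightarrow> card {p. p < i + j \<and> p \<in> A} = i"

lemma splits_length:
  assumes "splits i j A" "length vs = i + j"
  shows "length (nths vs A) = i" "length (nths vs (- A)) = j"
proof -
  show 1: "length (nths vs A) = i" using assms by (simp add: splits_def length_nths)
  have "{p. p < i + j} = {p. p < i + j \<and> p \<in> A} \<union> {p. p < i + j \<and> p \<in> - A}" by auto
  also have "card \<dots> = card {p. p < i + j \<and> p \<in> A} + card {p. p < i + j \<and> p \<in> - A}"
    by (rule card_Un_disjoint) auto
  finally show "length (nths vs (- A)) = j" using assms by (simp add: splits_def length_nths)
qed

text \<open>The arguments at the positions in \<open>A\<close> go to the first factor.  Derivatives add their argument in front,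
  hence the product rule leads from \<open>A\<close> to \<open>insert 0 (Suc ` A)\<close> and \<open>Suc ` A\<close>.\<close>
definition form_prod :: "nat set \<Rightarrow> ('a list \<Rightarrow> real) \<Rightarrow> ('a list \<Rightarrow> real) \<Rightarrow> 'a list \<Rightarrow> real"
  where "form_prod A M N vs = M (nths vs A) * N (nths vs (- A))"

lemma form_prod_bound:
  assumes A: "splits i j A" and len: "length vs = i + j"
    and M: "\<And>vs. length vs = i \<Longrightarrow> \<bar>M vs\<bar> \<le> a * (\<Prod>v\<leftarrow>vs. norm v)"
    and N: "\<And>vs. length vs = j \<Longrightarrow> \<bar>N vs\<bar> \<le> b * (\<Prod>v\<leftarrow>vs. norm v)"
    and "a \<ge> 0"
  shows "\<bar>form_prod A M N vs\<bar> \<le> a * b * (\<Prod>v\<leftarrow>vs. norm v)"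
proof -
  have "\<bar>form_prod A M N vs\<bar> \<le> (a * (\<Prod>v\<leftarrow>nths vs A. norm v)) * (b * (\<Prod>v\<leftarrow>nths vs (- A). norm v))"
    unfolding form_prod_def abs_mult using M N splits_length[OF A len] \<open>a \<ge> 0\<close>
    by (intro mult_mono) auto
  also have "\<dots> = a * b * (\<Prod>v\<leftarrow>vs. norm v)"
    unfolding prod_norm_nths[of vs A] by simp
  finally show ?thesis .
qed

text \<open>Each argument position feeds exactly one of the two factors; as a function of that
  argument the other factor is a constant.\<close>

lemma bounded_form_prod:
  assumes M: "bounded_form i M" and N: "bounded_form j N" and A: "splits i j A"
  shows "bounded_form (i + j) (form_prod A M N)"
proof -
  obtain K where K: "K \<ge> 0" "\<And>vs. length vs = i \<Longrightarrow> \<bar>M vs\<bar> \<le> K * (\<Prod>v\<leftarrow>vs. norm v)"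
    using bounded_form_bound[OF M] by blast
  obtain L where L: "\<And>vs. length vs = j \<Longrightarrow> \<bar>N vs\<bar> \<le> L * (\<Prod>v\<leftarrow>vs. norm v)"
    using bounded_form_bound[OF N] by blast
  show ?thesis
  proof (rule bounded_formI[where K="K * L"])
    fix vs :: "'a list" assume len: "length vs = i + j"
    show "\<bar>form_prod A M N vs\<bar> \<le> K * L * (\<Prod>v\<leftarrow>vs. norm v)"
      by (rule form_prod_bound[OF A len K(2) L K(1)])
    fix p assume p: "p < i + j"
    have lenA: "length (nths vs A) = i" "length (nths vs (- A)) = j"
      using splits_length[OF A len] .
    consider q where "p \<in> A" "q < i" "\<And>h. nths (vs[p := h]) A = (nths vs A)[q := h]"
      | q where "p \<notin> A" "q < j" "\<And>h. nths (vs[p := h]) (- A) = (nths vs (- A))[q := h]"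
    proof (cases "p \<in> A")
      case True
      then show ?thesis using nths_list_update_in[of p A vs] p len lenA that(1) by metis
    next
      case False
      then have "p \<in> - A" by simp
      then show ?thesis using nths_list_update_in[of p "- A" vs] p len lenA that(2) False by metis
    qed
    then show "linear (\<lambda>h. form_prod A M N (vs[p := h]))"
    proof cases
      case (1 q)
      from linear_compose_scale_right[OF bounded_form_linear[OF M lenA(1) 1(2)], of "N (nths vs (- A))"]
      show ?thesis by (simp add: form_prod_def 1 nths_list_update_notin mult.commute)
    next
      case (2 q)
      from linear_compose_scale_right[OF bounded_form_linear[OF N lenA(2) 2(2)], of "M (nths vs A)"]
      show ?thesis by (simp add: form_prod_def 2 nths_list_update_notin)
    qed
  qed
qed

lemma splits_Suc:
  assumes "splits i j A"
  shows "splits (Suc i) j (insert 0 (Suc ` A))" "splits i (Suc j) (Suc ` A)"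
proof -
  have 1: "{p. p < Suc (i + j) \<and> p \<in> insert 0 (Suc ` A)} = insert 0 (Suc ` {p. p < i + j \<and> p \<in> A})"
    and 2: "{p. p < Suc (i + j) \<and> p \<in> Suc ` A} = Suc ` {p. p < i + j \<and> p \<in> A}" by auto
  show "splits (Suc i) j (insert 0 (Suc ` A))" "splits i (Suc j) (Suc ` A)"
    unfolding splits_def add_Suc add_Suc_right 1 2
    using assms by (simp_all add: splits_def card_image card_insert_if image_iff)
qed

lemma form_prod_Cons:
  "form_prod (insert 0 (Suc ` A)) M N (h # vs) = M (h # nths vs A) * N (nths vs (- A))"
  "form_prod (Suc ` A) M N (h # vs) = M (nths vs A) * N (h # nths vs (- A))"
proof -
  have "{j. Suc j \<in> insert 0 (Suc ` A)} = A" "{j. Suc j \<in> Suc ` A} = A"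
    "{j. Suc j \<in> - insert 0 (Suc ` A)} = - A" "{j. Suc j \<in> - Suc ` A} = - A" by auto
  then show "form_prod (insert 0 (Suc ` A)) M N (h # vs) = M (h # nths vs A) * N (nths vs (- A))"
    "form_prod (Suc ` A) M N (h # vs) = M (nths vs A) * N (h # nths vs (- A))"
    by (simp_all add: form_prod_def nths_Cons)
qed

lemma cont_form_locally_bounded:
  assumes "cont_form j F x" "bounded_form j (F x)"
  obtains K where "K > 0" "\<forall>\<^sub>F y in nhds x. \<forall>vs. length vs = j \<longrightarrow> \<bar>F y vs\<bar> \<le> K * (\<Prod>v\<leftarrow>vs. norm v)"
proof -
  obtain K where K: "K \<ge> 0" "\<And>vs. length vs = j \<Longrightarrow> \<bar>F x vs\<bar> \<le> K * (\<Prod>v\<leftarrow>vs. norm v)"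
    using bounded_form_bound[OF assms(2)] by blast
  have "\<forall>\<^sub>F y in nhds x. \<forall>vs. length vs = j \<longrightarrow> \<bar>F y vs - F x vs\<bar> \<le> 1 * (\<Prod>v\<leftarrow>vs. norm v)"
    using assms(1)[unfolded cont_form_def, THEN spec, of 1] by simp
  then have "\<forall>\<^sub>F y in nhds x. \<forall>vs. length vs = j \<longrightarrow> \<bar>F y vs\<bar> \<le> (K + 1) * (\<Prod>v\<leftarrow>vs. norm v)"
  proof eventually_elim
    case (elim y)
    show ?case
    proof (intro allI impI)
      fix vs :: "'a list" assume "length vs = j"
      with elim K(2) have "\<bar>F y vs - F x vs\<bar> \<le> 1 * (\<Prod>v\<leftarrow>vs. norm v)" "\<bar>F x vs\<bar> \<le> K * (\<Prod>v\<leftarrow>vs. norm v)"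
        by blast+
      then show "\<bar>F y vs\<bar> \<le> (K + 1) * (\<Prod>v\<leftarrow>vs. norm v)"
        unfolding distrib_right by linarith
    qed
  qed
  with K(1) that[of "K + 1"] show thesis by simp
qed

lemma cont_form_prod:
  assumes F: "cont_form i F x" "bounded_form i (F x)" and G: "cont_form j G x" "bounded_form j (G x)"
    and A: "splits i j A"
  shows "cont_form (i + j) (\<lambda>x. form_prod A (F x) (G x)) x"
  unfolding cont_form_def
proof (intro allI impI)
  fix e :: real assume e: "e > 0"
  obtain K where K: "K > 0" "\<forall>\<^sub>F y in nhds x. \<forall>vs. length vs = i \<longrightarrow> \<bar>F y vs\<bar> \<le> K * (\<Prod>v\<leftarrow>vs. norm v)"
    using cont_form_locally_bounded[OF F] .
  obtain L where L: "L > 0" "\<forall>\<^sub>F y in nhds x. \<forall>vs. length vs = j \<longrightarrow> \<bar>G y vs\<bar> \<le> L * (\<Prod>v\<leftarrow>vs. norm v)"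
    using cont_form_locally_bounded[OF G] .
  have GL: "\<bar>G x vs\<bar> \<le> L * (\<Prod>v\<leftarrow>vs. norm v)" if "length vs = j" for vs
    using eventually_nhds_x_imp_x[OF L(2)] that by blast
  have eL: "e / (2 * L) > 0" and eK: "e / (2 * K) > 0" using e K L by simp_all
  have "\<forall>\<^sub>F y in nhds x. \<forall>vs. length vs = i \<longrightarrow> \<bar>F y vs - F x vs\<bar> \<le> e / (2 * L) * (\<Prod>v\<leftarrow>vs. norm v)"
    "\<forall>\<^sub>F y in nhds x. \<forall>vs. length vs = j \<longrightarrow> \<bar>G y vs - G x vs\<bar> \<le> e / (2 * K) * (\<Prod>v\<leftarrow>vs. norm v)"
    by (rule cont_formD[OF F(1) eL], rule cont_formD[OF G(1) eK])
  with K(2) show "\<forall>\<^sub>F y in nhds x. \<forall>vs. length vs = i + j \<longrightarrow>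
      \<bar>form_prod A (F y) (G y) vs - form_prod A (F x) (G x) vs\<bar> \<le> e * (\<Prod>v\<leftarrow>vs. norm v)"
  proof eventually_elim
    case (elim y)
    show ?case
    proof (intro allI impI)
      fix vs :: "'a list" assume len: "length vs = i + j"
      have "form_prod A (F y) (G y) vs - form_prod A (F x) (G x) vs =
          form_prod A (F y) (\<lambda>vs. G y vs - G x vs) vs + form_prod A (\<lambda>vs. F y vs - F x vs) (G x) vs"
        by (simp add: form_prod_def algebra_simps)
      moreover have "\<bar>form_prod A (F y) (\<lambda>vs. G y vs - G x vs) vs\<bar> \<le> K * (e / (2 * K)) * (\<Prod>v\<leftarrow>vs. norm v)"
        using elim K by (intro form_prod_bound[OF A len]) auto
      moreover have "\<bar>form_prod A (\<lambda>vs. F y vs - F x vs) (G x) vs\<bar> \<le> (e / (2 * L)) * L * (\<Prod>v\<leftarrow>vs. norm v)"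
        using elim L e by (intro form_prod_bound[OF A len] GL) auto
      ultimately show "\<bar>form_prod A (F y) (G y) vs - form_prod A (F x) (G x) vs\<bar> \<le> e * (\<Prod>v\<leftarrow>vs. norm v)"
        using K(1) L(1) field_sum_of_halves[of "e * (\<Prod>v\<leftarrow>vs. norm v)"] by simp
    qed
  qed
qed

lemma has_dform_prod:
  assumes F: "cont_form i F x" "bounded_form i (F x)" "has_dform i F F' x" "bounded_form (Suc i) F'"
    and G: "cont_form j G x" "bounded_form j (G x)" "has_dform j G G' x"
    and A: "splits i j A"
  shows "has_dform (i + j) (\<lambda>x. form_prod A (F x) (G x))
    (\<lambda>vs. form_prod (insert 0 (Suc ` A)) F' (G x) vs + form_prod (Suc ` A) (F x) G' vs) x"
  unfolding has_dform_def
proof (intro allI impI)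
  fix e :: real assume e: "e > 0"
  obtain K where K: "K > 0" "\<forall>\<^sub>F y in nhds x. \<forall>vs. length vs = i \<longrightarrow> \<bar>F y vs\<bar> \<le> K * (\<Prod>v\<leftarrow>vs. norm v)"
    using cont_form_locally_bounded[OF F(1,2)] .
  have FK: "\<bar>F x vs\<bar> \<le> K * (\<Prod>v\<leftarrow>vs. norm v)" if "length vs = i" for vs
    using eventually_nhds_x_imp_x[OF K(2)] that by blast
  obtain L where L: "L > 0" "\<forall>\<^sub>F y in nhds x. \<forall>vs. length vs = j \<longrightarrow> \<bar>G y vs\<bar> \<le> L * (\<Prod>v\<leftarrow>vs. norm v)"
    using cont_form_locally_bounded[OF G(1,2)] .
  obtain K' where K': "K' \<ge> 0" "\<And>vs. length vs = Suc i \<Longrightarrow> \<bar>F' vs\<bar> \<le> K' * (\<Prod>v\<leftarrow>vs. norm v)"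
    using bounded_form_bound[OF F(4)] by blast
  \<comment> \<open>One third of the error for each of the three terms below. \<open>K'\<close> may
    be 0, hence \<open>K' + 1\<close>.\<close>
  have e3: "e / (3 * L) > 0" "e / (3 * K) > 0" "e / (3 * (K' + 1)) > 0" using e K L K' by simp_all
  have "\<forall>\<^sub>F y in nhds x. \<forall>vs. length vs = i \<longrightarrow>
      \<bar>F y vs - F x vs - F' ((y - x) # vs)\<bar> \<le> e / (3 * L) * norm (y - x) * (\<Prod>v\<leftarrow>vs. norm v)"
    "\<forall>\<^sub>F y in nhds x. \<forall>vs. length vs = j \<longrightarrow>
      \<bar>G y vs - G x vs - G' ((y - x) # vs)\<bar> \<le> e / (3 * K) * norm (y - x) * (\<Prod>v\<leftarrow>vs. norm v)"
    "\<forall>\<^sub>F y in nhds x. \<forall>vs. length vs = j \<longrightarrow> \<bar>G y vs - G x vs\<bar> \<le> e / (3 * (K' + 1)) * (\<Prod>v\<leftarrow>vs. norm v)"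
    by (rule has_dformD[OF F(3) e3(1)], rule has_dformD[OF G(3) e3(2)], rule cont_formD[OF G(1) e3(3)])
  with L(2) show "\<forall>\<^sub>F y in nhds x. \<forall>vs. length vs = i + j \<longrightarrow>
      \<bar>form_prod A (F y) (G y) vs - form_prod A (F x) (G x) vs -
        (form_prod (insert 0 (Suc ` A)) F' (G x) ((y - x) # vs) + form_prod (Suc ` A) (F x) G' ((y - x) # vs))\<bar>
      \<le> e * norm (y - x) * (\<Prod>v\<leftarrow>vs. norm v)"
  proof eventually_elim
    case (elim y)
    show ?case
    proof (intro allI impI)
      fix vs :: "'a list" assume len: "length vs = i + j"
      \<comment> \<open>The remainder of the product rule: the remainder of \<open>F\<close> against
        \<open>G y\<close>, the derivative of \<open>F\<close> against the increment of
        \<open>G\<close>, and \<open>F x\<close> against the remainder of \<open>G\<close>. Only the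
        middle term needs continuity of \<open>G\<close> rather than a local bound or
        differentiability.\<close>
      let ?T1 = "form_prod A (\<lambda>vs. F y vs - F x vs - F' ((y - x) # vs)) (G y) vs"
      let ?T2 = "form_prod A (\<lambda>vs. F' ((y - x) # vs)) (\<lambda>vs. G y vs - G x vs) vs"
      let ?T3 = "form_prod A (F x) (\<lambda>vs. G y vs - G x vs - G' ((y - x) # vs)) vs"
      have "form_prod A (F y) (G y) vs - form_prod A (F x) (G x) vs -
        (form_prod (insert 0 (Suc ` A)) F' (G x) ((y - x) # vs) + form_prod (Suc ` A) (F x) G' ((y - x) # vs))
        = ?T1 + ?T2 + ?T3"
        unfolding form_prod_Cons by (simp add: form_prod_def algebra_simps)
      moreover have "\<bar>?T1\<bar> \<le> (e / (3 * L) * norm (y - x)) * L * (\<Prod>v\<leftarrow>vs. norm v)"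
        using elim L e by (intro form_prod_bound[OF A len]) auto
      then have "\<bar>?T1\<bar> \<le> e * norm (y - x) * (\<Prod>v\<leftarrow>vs. norm v) / 3" using L(1) by simp
      moreover have "\<bar>?T2\<bar> \<le> (K' * norm (y - x)) * (e / (3 * (K' + 1))) * (\<Prod>v\<leftarrow>vs. norm v)"
        using elim K'(1) K'(2)[of "_ # _"] by (intro form_prod_bound[OF A len]) (auto simp: mult.assoc)
      moreover have "(K' * norm (y - x)) * (e / (3 * (K' + 1))) * (\<Prod>v\<leftarrow>vs. norm v)
          = (K' / (K' + 1)) * (e * norm (y - x) * (\<Prod>v\<leftarrow>vs. norm v) / 3)"
        using K' by (simp add: field_simps)
      moreover have "\<dots> \<le> 1 * (e * norm (y - x) * (\<Prod>v\<leftarrow>vs. norm v) / 3)"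
        using K' e by (intro mult_right_mono) auto
      moreover have "\<bar>?T3\<bar> \<le> K * (e / (3 * K) * norm (y - x)) * (\<Prod>v\<leftarrow>vs. norm v)"
        using elim K by (intro form_prod_bound[OF A len] FK) auto
      then have "\<bar>?T3\<bar> \<le> e * norm (y - x) * (\<Prod>v\<leftarrow>vs. norm v) / 3" using K(1) by simp
      ultimately show "\<bar>form_prod A (F y) (G y) vs - form_prod A (F x) (G x) vs -
          (form_prod (insert 0 (Suc ` A)) F' (G x) ((y - x) # vs) + form_prod (Suc ` A) (F x) G' ((y - x) # vs))\<bar>
        \<le> e * norm (y - x) * (\<Prod>v\<leftarrow>vs. norm v)"
        by linarith
    qed
  qed
qed

text \<open>Both summands of the product rule are again products of forms, but with other degrees
  and another distribution of the arguments; therefore \<open>i\<close>, \<open>j\<close> and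
  \<open>A\<close> stay arbitrary in the induction. The factor that is not differentiated gives up
  one order by \<open>Ck_form_mono\<close>.\<close>

lemma Ck_form_prod:
  assumes "\<And>x. Ck_form n i F x" "\<And>x. Ck_form n j G x" "splits i j A"
  shows "Ck_form n (i + j) (\<lambda>x. form_prod A (F x) (G x)) x"
  using assms
proof (induction n arbitrary: i j F G A x)
  case 0
  then show ?case by (simp add: cont_form_prod bounded_form_prod)
next
  case (Suc n)
  show ?case
  proof (rule Ck_form_SucI[where F'="\<lambda>x vs. form_prod (insert 0 (Suc ` A)) (dform F x) (G x) vs
      + form_prod (Suc ` A) (F x) (dform G x) vs"])
    fix y
    have mono: "Ck_form n i F x" "Ck_form n j G x" for x
      using Suc.prems(1,2) by (auto intro: Ck_form_mono simp del: Ck_form.simps)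
    note F = Suc.prems(1)[of y, simplified] and G = Suc.prems(2)[of y, simplified]
    show "bounded_form (i + j) (form_prod A (F y) (G y))"
      using F G Suc.prems(3) by (intro bounded_form_prod) auto
    show "cont_form (i + j) (\<lambda>x. form_prod A (F x) (G x)) y"
      using F G Suc.prems(3) by (intro cont_form_prod) auto
    show "has_dform (i + j) (\<lambda>x. form_prod A (F x) (G x)) (\<lambda>vs. form_prod (insert 0 (Suc ` A)) (dform F y) (G y) vs
      + form_prod (Suc ` A) (F y) (dform G y) vs) y"
      using F G Suc.prems(3) Ck_form_bounded by (intro has_dform_prod) blast+
    show "Ck_form n (Suc (i + j)) (\<lambda>x vs. form_prod (insert 0 (Suc ` A)) (dform F x) (G x) vs
      + form_prod (Suc ` A) (F x) (dform G x) vs) y"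
    proof (rule Ck_form_add)
      fix x
      show "Ck_form n (Suc (i + j)) (\<lambda>x. form_prod (insert 0 (Suc ` A)) (dform F x) (G x)) x"
        using Suc.IH[of "Suc i" "dform F" j G] splits_Suc[OF Suc.prems(3)] Suc.prems mono by auto
      show "Ck_form n (Suc (i + j)) (\<lambda>x. form_prod (Suc ` A) (F x) (dform G x)) x"
        using Suc.IH[of i F "Suc j" "dform G"] splits_Suc[OF Suc.prems(3)] Suc.prems mono by auto
    qed
  qed
qed

section \<open>Constants, chain rule, scaling and affine substitutions\<close>

lemma Ck_form_zero: "Ck_form n j (\<lambda>x vs. 0) x"
proof (induction n arbitrary: j x)
  have b: "bounded_form j (\<lambda>vs::'a list. 0)" for j
    by (rule bounded_formI[where K=0]) (auto simp: linear_zero)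
  {
    case 0
    then show ?case using b by (simp add: cont_form_def)
  next
    case (Suc n)
    show ?case
      by (rule Ck_form_SucI[where F'="\<lambda>x vs. 0"]) (auto simp: b Suc cont_form_def has_dform_def)
  }
qed

lemma bounded_form_0: "bounded_form 0 M"
  by (rule bounded_formI[where K="\<bar>M []\<bar>"]) auto

lemma Ck_form_const: "Ck_form n 0 (\<lambda>x vs. c) x"
proof (cases n)
  case (Suc m)
  show ?thesis unfolding Suc
    by (rule Ck_form_SucI[where F'="\<lambda>x vs. 0"])
      (auto simp: bounded_form_0 Ck_form_zero cont_form_def has_dform_def)
qed (simp add: bounded_form_0 cont_form_def)

lemma cont_form_0: "cont_form 0 F x \<longleftrightarrow> ((\<lambda>y. F y []) \<longlongrightarrow> F x []) (nhds x)"
proof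
  assume c: "cont_form 0 F x"
  show "((\<lambda>y. F y []) \<longlongrightarrow> F x []) (nhds x)"
  proof (rule tendstoI)
    fix e :: real assume "e > 0"
    then have e: "e/2 > 0" by simp
    have "\<forall>\<^sub>F y in nhds x. \<forall>vs. length vs = 0 \<longrightarrow> \<bar>F y vs - F x vs\<bar> \<le> e/2 * (\<Prod>v\<leftarrow>vs. norm v)"
      by (rule cont_formD[OF c e])
    then show "\<forall>\<^sub>F y in nhds x. dist (F y []) (F x []) < e"
      by eventually_elim (use \<open>e > 0\<close> in \<open>simp add: dist_real_def\<close>)
  qed
next
  assume t: "((\<lambda>y. F y []) \<longlongrightarrow> F x []) (nhds x)"
  show "cont_form 0 F x"
    unfolding cont_form_def
  proof (intro allI impI)
    fix e :: real assume "e > 0"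
    from tendstoD[OF t this]
    show "\<forall>\<^sub>F y in nhds x. \<forall>vs. length vs = 0 \<longrightarrow> \<bar>F y vs - F x vs\<bar> \<le> e * (\<Prod>v\<leftarrow>vs. norm v)"
      by eventually_elim (simp add: dist_real_def)
  qed
qed

lemma has_dform_0:
  assumes "bounded_form 1 M"
  shows "has_dform 0 F M x \<longleftrightarrow> ((\<lambda>y. F y []) has_derivative (\<lambda>h. M [h])) (at x)"
proof -
  obtain K where K: "\<And>vs. length vs = 1 \<Longrightarrow> \<bar>M vs\<bar> \<le> K * (\<Prod>v\<leftarrow>vs. norm v)"
    using bounded_form_bound[OF assms] by blast
  have lin: "linear (\<lambda>h. M [h])" using bounded_form_linear_hd[of 0 M "[]"] assms by simp
  have "bounded_linear (\<lambda>h. M [h])"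
    using K[of "[_]"] linear_add[OF lin] linear_scale[OF lin]
    by (intro bounded_linear_intro[where K=K]) (simp_all add: mult.commute)
  then show ?thesis
    unfolding has_dform_def has_derivative_at_alt eventually_nhds_metric dist_norm by auto
qed

text \<open>The derivative of \<open>\<rho> \<circ> f\<close> is the product of \<open>\<rho>' \<circ> f\<close> and \<open>f'\<close>, so the
  induction runs over all derivatives of \<open>\<rho>\<close> simultaneously.\<close>
lemma Ck_form_compose:
  assumes d: "\<And>m t. (d m has_real_derivative d (Suc m) t) (at t)"
    and f: "\<And>x. Ck_form n 0 (\<lambda>x vs. f x) x"
  shows "Ck_form n 0 (\<lambda>x vs. d m (f x)) x"
  using f
proof (induction n arbitrary: m x)
  have cont: "cont_form 0 (\<lambda>x vs. d m (f x)) x" if "cont_form 0 (\<lambda>x vs. f x) x" for m x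
  proof -
    have "isCont (d m) (f x)" using d DERIV_isCont by blast
    with that show ?thesis unfolding cont_form_0
      by (metis isCont_def tendsto_compose tendsto_at_iff_tendsto_nhds)
  qed
  {
    case 0
    then show ?case using cont by (simp add: bounded_form_0)
  next
    case (Suc n)
    \<comment> \<open>With \<open>A = {}\<close> all arguments go to the second factor:
      \<open>form_prod {}\<close> multiplies a form by a scalar.\<close>
    have s: "splits 0 1 {}" by (simp add: splits_def)
    define f' where "f' = dform (\<lambda>x vs. f x)"
    have bf: "bounded_form 1 (f' x)" and fder: "(f has_derivative (\<lambda>h. f' x [h])) (at x)" for x
      using Suc.prems[of x] Ck_form_bounded has_dform_0[of "f' x" "\<lambda>x vs. f x" x] by (auto simp: f'_def)
    show ?case
    proof (rule Ck_form_SucI[where F'="\<lambda>x. form_prod {} (\<lambda>vs. d (Suc m) (f x)) (f' x)"])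
      fix y
      show "bounded_form 0 (\<lambda>vs. d m (f y))" by (rule bounded_form_0)
      show "cont_form 0 (\<lambda>x vs. d m (f x)) y" using cont Suc.prems by simp
      have "bounded_form 1 (form_prod {} (\<lambda>vs. d (Suc m) (f y)) (f' y))"
        using bounded_form_prod[OF bounded_form_0 bf s] by simp
      moreover have "((\<lambda>x. d m (f x)) has_derivative (\<lambda>h. d (Suc m) (f y) * f' y [h])) (at y)"
        using has_derivative_compose[OF fder d[unfolded has_field_derivative_def]] .
      ultimately show "has_dform 0 (\<lambda>x vs. d m (f x)) (form_prod {} (\<lambda>vs. d (Suc m) (f y)) (f' y)) y"
        by (subst has_dform_0) (simp_all add: form_prod_def)
      have "Ck_form n (0 + 1) (\<lambda>x. form_prod {} (\<lambda>vs. d (Suc m) (f x)) (f' x)) y"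
        using Suc.prems Ck_form_mono[OF Suc.prems] by (intro Ck_form_prod[OF _ _ s] Suc.IH) (auto simp: f'_def)
      then show "Ck_form n (Suc 0) (\<lambda>x. form_prod {} (\<lambda>vs. d (Suc m) (f x)) (f' x)) y" by simp
    qed
  }
qed

text \<open>A product with a constant form of degree 0.\<close>

lemma Ck_form_scale:
  assumes "\<And>x. Ck_form n j F x"
  shows "Ck_form n j (\<lambda>x vs. c * F x vs) x"
proof -
  have "splits 0 j {}" by (simp add: splits_def)
  from Ck_form_prod[OF Ck_form_const assms this, of c x]
  show ?thesis by (simp add: form_prod_def[abs_def] nths_all)
qed

lemma Ck_form_affine:
  fixes b :: "'a::real_normed_vector"
  assumes "\<And>x. Ck_form n j F x"
  shows "Ck_form n j (\<lambda>x. F (a *\<^sub>R x + b)) x"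
  using assms
proof (induction n arbitrary: j F x)
  have lim: "((\<lambda>x. a *\<^sub>R x + b) \<longlongrightarrow> a *\<^sub>R x + b) (nhds x)" for x
    by (intro tendsto_intros filterlim_ident)
  have cont: "cont_form j (\<lambda>x. F (a *\<^sub>R x + b)) x" if "cont_form j F (a *\<^sub>R x + b)"
    for j x and F :: "'a \<Rightarrow> 'a list \<Rightarrow> real"
    unfolding cont_form_def using eventually_compose_filterlim[OF cont_formD[OF that] lim] by simp
  {
    case 0
    then show ?case using cont by simp
  next
    case (Suc n)
    show ?case
    proof (rule Ck_form_SucI[where F'="\<lambda>x vs. a * dform F (a *\<^sub>R x + b) vs"])
      fix y
      let ?z = "a *\<^sub>R y + b"
      show "bounded_form j (F ?z)" "cont_form j (\<lambda>x. F (a *\<^sub>R x + b)) y"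
        using Suc.prems[of ?z] cont by auto
      show "Ck_form n (Suc j) (\<lambda>x vs. a * dform F (a *\<^sub>R x + b) vs) y"
        using Suc by (intro Ck_form_scale Suc.IH) auto
      have bf: "bounded_form (Suc j) (dform F ?z)" and hd: "has_dform j F (dform F ?z) ?z"
        using Suc.prems[of ?z] Ck_form_bounded by auto
      show "has_dform j (\<lambda>x. F (a *\<^sub>R x + b)) (\<lambda>vs. a * dform F ?z vs) y"
        unfolding has_dform_def
      proof (intro allI impI)
        fix e :: real assume e: "e > 0"
        then have e': "e / (\<bar>a\<bar> + 1) > 0" by simp
        have "\<forall>\<^sub>F z in nhds ?z. \<forall>vs. length vs = j \<longrightarrow>
            \<bar>F z vs - F ?z vs - dform F ?z ((z - ?z) # vs)\<bar> \<le> e / (\<bar>a\<bar> + 1) * norm (z - ?z) * (\<Prod>v\<leftarrow>vs. norm v)"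
          by (rule has_dformD[OF hd e'])
        from eventually_compose_filterlim[OF this lim]
        show "\<forall>\<^sub>F x in nhds y. \<forall>vs. length vs = j \<longrightarrow>
            \<bar>F (a *\<^sub>R x + b) vs - F ?z vs - a * dform F ?z ((x - y) # vs)\<bar> \<le> e * norm (x - y) * (\<Prod>v\<leftarrow>vs. norm v)"
        proof eventually_elim
          case (elim x)
          show ?case
          proof (intro allI impI)
            fix vs :: "'a list" assume len: "length vs = j"
            have eq: "a *\<^sub>R x + b - ?z = a *\<^sub>R (x - y)" by (simp add: algebra_simps)
            have "dform F ?z ((a *\<^sub>R (x - y)) # vs) = a * dform F ?z ((x - y) # vs)"
              using linear_scale[OF bounded_form_linear_hd[OF bf len]] by simp
            with elim len have "\<bar>F (a *\<^sub>R x + b) vs - F ?z vs - a * dform F ?z ((x - y) # vs)\<bar>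
                \<le> e / (\<bar>a\<bar> + 1) * norm (a *\<^sub>R (x - y)) * (\<Prod>v\<leftarrow>vs. norm v)"
              unfolding eq by metis
            also have "\<dots> = \<bar>a\<bar> / (\<bar>a\<bar> + 1) * (e * norm (x - y) * (\<Prod>v\<leftarrow>vs. norm v))" by simp
            also have "\<dots> \<le> 1 * (e * norm (x - y) * (\<Prod>v\<leftarrow>vs. norm v))"
              using e by (intro mult_right_mono) auto
            finally show "\<bar>F (a *\<^sub>R x + b) vs - F ?z vs - a * dform F ?z ((x - y) # vs)\<bar>
                \<le> e * norm (x - y) * (\<Prod>v\<leftarrow>vs. norm v)" by simp
          qed
        qed
      qed
    qed
  }
qed

section \<open>Closure properties of \<open>C_class\<close>\<close>

lemma C_class_const: "(\<lambda>x. c) \<in> C_class k"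
  by (simp add: C_class_iff Ck_form_const)

lemma C_class_add: "f \<in> C_class k \<Longrightarrow> g \<in> C_class k \<Longrightarrow> (\<lambda>x. f x + g x) \<in> C_class k"
  by (simp add: C_class_iff Ck_form_add)

lemma C_class_scale: "f \<in> C_class k \<Longrightarrow> (\<lambda>x. c * f x) \<in> C_class k"
  by (simp add: C_class_iff Ck_form_scale)

lemma C_class_diff: "f \<in> C_class k \<Longrightarrow> g \<in> C_class k \<Longrightarrow> (\<lambda>x. f x - g x) \<in> C_class k"
  using C_class_add[of f k "\<lambda>x. (- 1) * g x"] C_class_scale[of g k "- 1"] by simp

lemma C_class_affine: "f \<in> C_class k \<Longrightarrow> (\<lambda>x. f (a *\<^sub>R x + b)) \<in> C_class k"
  by (simp add: C_class_iff Ck_form_affine[where F="\<lambda>x vs. f x"])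

lemma C_class_compose:
  assumes "\<And>m t. (d m has_real_derivative d (Suc m) t) (at t)" "f \<in> C_class k"
  shows "(\<lambda>x. d 0 (f x)) \<in> C_class k"
  unfolding C_class_iff
proof (intro allI impI)
  fix n x assume "enat n \<le> k"
  with assms(2) show "Ck_form n 0 (\<lambda>x vs. d 0 (f x)) x"
    by (intro Ck_form_compose[of d, OF assms(1)]) (simp add: C_class_iff)
qed

text \<open>\<open>Ck_form\<close> depends on germs only, so \<open>g\<close> may change from point
  to point. This is how the limit of a locally stationary sequence inherits smoothness.\<close>

lemma C_class_local:
  assumes "\<And>x. \<exists>g \<in> C_class k. \<forall>\<^sub>F y in nhds x. f y = g y"
  shows "f \<in> C_class k"
  unfolding C_class_iff
proof (intro allI impI)
  fix n x assume n: "enat n \<le> k"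
  obtain g where "g \<in> C_class k" and ev: "\<forall>\<^sub>F y in nhds x. f y = g y" using assms by blast
  with n have "Ck_form n 0 (\<lambda>x vs. g x) x" by (simp add: C_class_iff)
  then show "Ck_form n 0 (\<lambda>x vs. f x) x"
    by (rule Ck_form_cong[rotated]) (use ev in \<open>auto elim: eventually_mono\<close>)
qed

section \<open>A smooth ramp\<close>

text \<open>The derivative is left anonymous, so that sums, products and affine substitutions need
  no formula for higher derivatives. A concrete sequence of derivatives is recovered at the end by
  iterating \<open>deriv\<close>.\<close>

fun diff_times :: "nat \<Rightarrow> (real \<Rightarrow> real) \<Rightarrow> bool" where
  "diff_times 0 f \<longleftrightarrow> True"
| "diff_times (Suc n) f \<longleftrightarrow> (\<exists>f'. (\<forall>t. (f has_real_derivative f' t) (at t)) \<and> diff_times n f')"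

lemma diff_times_mono: "diff_times (Suc n) f \<Longrightarrow> diff_times n f"
  by (induction n arbitrary: f) auto

lemma diff_times_const: "diff_times n (\<lambda>t. c)"
  by (induction n arbitrary: c) (auto intro!: exI[of _ "\<lambda>t. 0"])

lemma diff_times_add: "diff_times n f \<Longrightarrow> diff_times n g \<Longrightarrow> diff_times n (\<lambda>t. f t + g t)"
proof (induction n arbitrary: f g)
  case (Suc n)
  then obtain f' g' where "\<And>t. (f has_real_derivative f' t) (at t)" "diff_times n f'"
    "\<And>t. (g has_real_derivative g' t) (at t)" "diff_times n g'" by auto
  with Suc.IH show ?case
    by (auto intro!: exI[of _ "\<lambda>t. f' t + g' t"] derivative_intros)
qed simp

lemma diff_times_mult: "diff_times n f \<Longrightarrow> diff_times n g \<Longrightarrow> diff_times n (\<lambda>t. f t * g t)"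
proof (induction n arbitrary: f g)
  case (Suc n)
  then obtain f' g' where f': "\<And>t. (f has_real_derivative f' t) (at t)" "diff_times n f'"
    and g': "\<And>t. (g has_real_derivative g' t) (at t)" "diff_times n g'" by auto
  have "diff_times n f" "diff_times n g" using Suc.prems by (auto intro: diff_times_mono simp del: diff_times.simps)
  then have "diff_times n (\<lambda>t. f' t * g t + g' t * f t)"
    using f' g' by (intro diff_times_add Suc.IH)
  moreover have "((\<lambda>t. f t * g t) has_real_derivative f' t * g t + g' t * f t) (at t)" for t
    using f' g' by (auto intro!: derivative_eq_intros)
  ultimately show ?case by (auto intro!: exI[of _ "\<lambda>t. f' t * g t + g' t * f t"])
qed simp

lemma diff_times_affine: "diff_times n f \<Longrightarrow> diff_times n (\<lambda>t. f (a * t + b))"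
proof (induction n arbitrary: f)
  case (Suc n)
  then obtain f' where f': "\<And>t. (f has_real_derivative f' t) (at t)" "diff_times n f'" by auto
  then have "diff_times n (\<lambda>t. f' (a * t + b) * a)"
    by (intro diff_times_mult diff_times_const Suc.IH)
  moreover have "((\<lambda>t. f (a * t + b)) has_real_derivative f' (a * t + b) * a) (at t)" for t
    by (rule DERIV_chain2[OF f'(1)]) (auto intro!: derivative_eq_intros)
  ultimately show ?case by (auto intro!: exI[of _ "\<lambda>t. f' (a * t + b) * a"])
qed simp

lemma diff_times_deriv:
  assumes "diff_times (Suc n) f"
  shows "(f has_real_derivative deriv f t) (at t)" "diff_times n (deriv f)"
proof -
  obtain f' where f': "\<And>t. (f has_real_derivative f' t) (at t)" "diff_times n f'" using assms by auto
  then have "f' = deriv f" by (intro ext DERIV_imp_deriv[symmetric])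
  with f' show "(f has_real_derivative deriv f t) (at t)" "diff_times n (deriv f)" by auto
qed

text \<open>The classical \<open>exp (- 1 / t)\<close>, extended by 0. The polynomial in
  \<open>1 / t\<close> makes the family closed under differentiation, which turns smoothness into a
  plain induction.\<close>

definition flat :: "real poly \<Rightarrow> real \<Rightarrow> real"
  where "flat p t = (if t > 0 then poly p (1 / t) * exp (- (1 / t)) else 0)"

lemma poly_over_exp_tendsto_0:
  "((\<lambda>s::real. poly p s * s ^ m * exp (- s)) \<longlongrightarrow> 0) at_top"
proof (induction p arbitrary: m)
  case (pCons a p)
  have "((\<lambda>s. a * (s ^ m / exp s) + poly p s * s ^ Suc m * exp (- s)) \<longlongrightarrow> a * 0 + 0) at_top"
    by (intro tendsto_intros tendsto_power_div_exp_0 pCons.IH)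
  then show ?case by (simp add: algebra_simps exp_minus divide_inverse)
qed simp

text \<open>With \<open>s = 1 / t\<close> the chain rule contributes \<open>- s\<^sup>2\<close>, so
  \<open>p\<close> becomes \<open>s\<^sup>2 * (p - p')\<close>. At 0 the right difference quotient
  is \<open>poly p s * s * exp (- s)\<close> for \<open>s\<close> tending to infinity.\<close>

lemma flat_deriv:
  "(flat p has_real_derivative flat ([:0, 0, 1:] * (p - pderiv p)) t) (at t)"
proof -
  consider "t > 0" | "t < 0" | "t = 0" by linarith
  then show ?thesis
  proof cases
    case 1
    have inv: "((\<lambda>t. 1 / t) has_real_derivative - (1 / t)\<^sup>2) (at t)"
      using 1 by (auto intro!: derivative_eq_intros simp: power2_eq_square)
    have "((\<lambda>t. poly p (1 / t) * exp (- (1 / t))) has_real_derivative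
        poly (pderiv p) (1 / t) * - (1 / t)\<^sup>2 * exp (- (1 / t)) +
        exp (- (1 / t)) * - (- (1 / t)\<^sup>2) * poly p (1 / t)) (at t)"
      by (intro DERIV_mult DERIV_chain2[OF poly_DERIV inv] DERIV_chain2[OF DERIV_exp] DERIV_minus inv)
    also have "poly (pderiv p) (1 / t) * - (1 / t)\<^sup>2 * exp (- (1 / t)) +
        exp (- (1 / t)) * - (- (1 / t)\<^sup>2) * poly p (1 / t) = flat ([:0, 0, 1:] * (p - pderiv p)) t"
      using 1 by (simp add: flat_def power2_eq_square algebra_simps)
    finally have "((\<lambda>t. poly p (1 / t) * exp (- (1 / t))) has_real_derivative
        flat ([:0, 0, 1:] * (p - pderiv p)) t) (at t)" .
    then show ?thesis
      by (rule has_field_derivative_transform_within_open[where S="{0<..}"])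
        (use 1 in \<open>auto simp: flat_def\<close>)
  next
    case 2
    have "((\<lambda>t. 0) has_real_derivative flat ([:0, 0, 1:] * (p - pderiv p)) t) (at t)"
      using 2 by (simp add: flat_def)
    then show ?thesis
      by (rule has_field_derivative_transform_within_open[where S="{..<0}"])
        (use 2 in \<open>auto simp: flat_def\<close>)
  next
    case 3
    have "((\<lambda>h. poly p (inverse h) * inverse h ^ 1 * exp (- inverse h)) \<longlongrightarrow> 0) (at_right (0::real))"
      by (rule filterlim_compose[OF poly_over_exp_tendsto_0 filterlim_inverse_at_top_right])
    then have "((\<lambda>h. flat p h / h) \<longlongrightarrow> 0) (at_right 0)"
      by (rule Lim_transform_eventually)
        (auto simp: flat_def eventually_at_filter divide_inverse mult_ac)
    moreover have "((\<lambda>h. flat p h / h) \<longlongrightarrow> 0) (at_left 0)"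
      by (rule tendsto_eventually) (auto simp: flat_def eventually_at_filter)
    ultimately have "((\<lambda>h. flat p h / h) \<longlongrightarrow> 0) (at 0)"
      by (simp add: filterlim_split_at)
    then show ?thesis by (simp add: DERIV_def 3 flat_def[of _ 0])
  qed
qed

lemma diff_times_flat: "diff_times n (flat p)"
  by (induction n arbitrary: p) (auto intro!: exI flat_deriv)

lemma antiderivative_from_left:
  fixes b :: "real \<Rightarrow> real"
  assumes "continuous_on UNIV b" "\<And>t. t \<le> - 1 \<Longrightarrow> b t = 0"
  obtains B where "\<And>t. (B has_real_derivative b t) (at t)" "\<And>t. t \<le> - 1 \<Longrightarrow> B t = 0"
proof
  \<comment> \<open>The base point only has to lie below \<open>- 1\<close>: for
    \<open>t < - 1\<close> the integral is locally constant 0, and for the other \<open>t\<close> it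
    leaves \<open>t\<close> in the interior of the interval used below.\<close>
  let ?B = "\<lambda>t. integral {- 3..t} b"
  show 0: "?B t = 0" if "t \<le> - 1" for t
  proof -
    have "?B t = integral {- 3..t} (\<lambda>_. 0)"
      using that assms(2) by (intro integral_cong) auto
    then show ?thesis by simp
  qed
  show "(?B has_real_derivative b t) (at t)" for t
  proof (cases "t < - 1")
    case True
    have "((\<lambda>t. 0) has_real_derivative b t) (at t)" using True assms(2) by simp
    then show ?thesis
      by (rule has_field_derivative_transform_within_open[where S="{..<- 1}"])
        (use True 0 in auto)
  next
    case False
    have "(?B has_real_derivative b t) (at t within {- 3..t + 1})"
      using False by (intro integral_has_real_derivative continuous_on_subset[OF assms(1)]) auto
    moreover have "t \<in> interior {- 3..t + 1}" using False by (simp add: interior_atLeastAtMost_real)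
    ultimately show ?thesis using at_within_interior[of t "{- 3..t + 1}"] by metis
  qed
qed

text \<open>A bump \<open>b\<close> on \<open>(- 1, 1)\<close> is integrated and normalised to a
  smooth step \<open>\<sigma>\<close>, which is integrated once more. The slope of the result is
  \<open>\<sigma>\<close>, hence between 0 and 1; beyond 1 it is a line \<open>t + c\<close>, and
  the offset \<open>c\<close> still has to be removed.\<close>

lemma smooth_ramp:
  obtains d :: "nat \<Rightarrow> real \<Rightarrow> real" where
    "\<And>n t. (d n has_real_derivative d (Suc n) t) (at t)"
    "\<And>t. t \<le> - 1 \<Longrightarrow> d 0 t = 0" "\<And>t. t \<ge> 1 \<Longrightarrow> d 0 t = t"
    "\<And>t. 0 \<le> d 1 t" "\<And>t. d 1 t \<le> 1"
proof -
  define b where "b t = flat 1 (1 * t + 1) * flat 1 (- 1 * t + 1)" for t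
  have b_smooth: "diff_times n b" for n
    unfolding b_def[abs_def] by (intro diff_times_mult diff_times_affine diff_times_flat)
  then have "\<exists>b'. \<forall>t. (b has_real_derivative b' t) (at t)" by (metis diff_times.simps(2))
  then have b_cont: "continuous_on UNIV b"
    by (metis DERIV_isCont continuous_at_imp_continuous_on)
  have b0: "b t = 0" if "t \<le> - 1 \<or> t \<ge> 1" for t using that by (auto simp: b_def flat_def)
  have b_nonneg: "b t \<ge> 0" for t by (simp add: b_def flat_def)
  have b_pos: "b t > 0" if "- 1 < t" "t < 1" for t using that by (simp add: b_def flat_def)
  obtain B where B: "\<And>t. (B has_real_derivative b t) (at t)" "\<And>t. t \<le> - 1 \<Longrightarrow> B t = 0"
    using antiderivative_from_left[OF b_cont] b0 by metis
  have B_mono: "B s \<le> B t" if "s \<le> t" for s t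
    using B(1) b_nonneg by (intro DERIV_nonneg_imp_nondecreasing[OF that]) blast
  have B_nonneg: "B t \<ge> 0" for t
    using B_mono[of "min t (- 1)" t] B(2)[of "min t (- 1)"] by simp
  have "B (- 1/2) < B (1/2)"
  proof (rule DERIV_pos_imp_increasing[where f=B])
    fix t :: real assume "- 1/2 \<le> t" "t \<le> 1/2"
    then show "\<exists>y. (B has_real_derivative y) (at t) \<and> y > 0"
      by (intro exI[of _ "b t"] conjI B(1) b_pos) auto
  qed simp
  then have I: "B 1 > 0" using B_mono[of "1/2" 1] B_nonneg[of "- 1/2"] by linarith
  have B1: "B t = B 1" if "t \<ge> 1" for t
  proof (rule antisym)
    show "B t \<le> B 1"
    proof (rule DERIV_nonpos_imp_nonincreasing[OF that, where f=B])
      fix s :: real assume "1 \<le> s" "s \<le> t"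
      then show "\<exists>y. (B has_real_derivative y) (at s) \<and> y \<le> 0"
        using B(1)[of s] b0[of s] by auto
    qed
  qed (rule B_mono[OF that])
  define \<sigma> where "\<sigma> t = B t / B 1" for t
  have \<sigma>_deriv: "(\<sigma> has_real_derivative b t * (1 / B 1)) (at t)" for t
    unfolding \<sigma>_def[abs_def] using B(1) I by (auto intro!: derivative_eq_intros)
  have \<sigma>_smooth: "diff_times n \<sigma>" for n
  proof (cases n)
    case (Suc m)
    have "diff_times m (\<lambda>t. b t * (1 / B 1))" by (intro diff_times_mult diff_times_const b_smooth)
    with \<sigma>_deriv show ?thesis
      unfolding Suc by (auto intro!: exI[of _ "\<lambda>t. b t * (1 / B 1)"])
  qed simp
  have \<sigma>: "0 \<le> \<sigma> t" "\<sigma> t \<le> 1" for t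
    using B_nonneg I B_mono[of t "max t 1"] B1[of "max t 1"] by (auto simp: \<sigma>_def)
  have "continuous_on UNIV \<sigma>"
    using \<sigma>_deriv by (metis DERIV_isCont continuous_at_imp_continuous_on)
  moreover have "\<sigma> t = 0" if "t \<le> - 1" for t using B(2) that by (simp add: \<sigma>_def)
  ultimately obtain \<rho> where \<rho>: "\<And>t. (\<rho> has_real_derivative \<sigma> t) (at t)" "\<And>t. t \<le> - 1 \<Longrightarrow> \<rho> t = 0"
    using antiderivative_from_left by metis
  define c where "c = \<rho> 1 - 1"
  have \<rho>_line: "\<rho> t = t + c" if "t \<ge> 1" for t
  proof -
    have d: "((\<lambda>s. \<rho> s - s) has_real_derivative \<sigma> s - 1) (at s)" for s
      using \<rho>(1) by (auto intro!: derivative_eq_intros)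
    have "\<sigma> s - 1 = 0" if "s \<ge> 1" for s using B1[OF that] I by (simp add: \<sigma>_def)
    then have "\<exists>y. ((\<lambda>s. \<rho> s - s) has_real_derivative y) (at s) \<and> y \<le> 0"
      "\<exists>y. ((\<lambda>s. \<rho> s - s) has_real_derivative y) (at s) \<and> 0 \<le> y" if "s \<ge> 1" for s
      using d[of s] that by auto
    then have "\<rho> t - t \<le> \<rho> 1 - 1" "\<rho> t - t \<ge> \<rho> 1 - 1"
      using DERIV_nonpos_imp_nonincreasing[OF that, of "\<lambda>s. \<rho> s - s"]
        DERIV_nonneg_imp_nondecreasing[OF that, of "\<lambda>s. \<rho> s - s"] by blast+
    then show ?thesis by (simp add: c_def)
  qed
  have "\<rho> (- 1) \<le> \<rho> 1"
    using \<rho>(1) \<sigma>(1) by (intro DERIV_nonneg_imp_nondecreasing[where f=\<rho>]) (simp, blast)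
  moreover have "\<rho> 1 - 1 \<le> \<rho> (- 1) - (- 1)"
  proof (rule DERIV_nonpos_imp_nonincreasing[where f="\<lambda>s. \<rho> s - s"])
    fix s
    have "((\<lambda>s. \<rho> s - s) has_real_derivative \<sigma> s - 1) (at s)"
      using \<rho>(1) by (auto intro!: derivative_eq_intros)
    then show "\<exists>y. ((\<lambda>s. \<rho> s - s) has_real_derivative y) (at s) \<and> y \<le> 0"
      using \<sigma>(2)[of s] by (intro exI[of _ "\<sigma> s - 1"]) auto
  qed simp
  ultimately have c: "- 1 \<le> c" "c \<le> 1" using \<rho>(2)[of "- 1"] by (auto simp: c_def)
  \<comment> \<open>Shifting by \<open>c\<close> turns the line \<open>t + c\<close> into the
    identity, and compressing by 2 makes room for the shift: since
    \<open>\<bar>c\<bar> \<le> 1\<close>, the argument is at least 1 for \<open>t \<ge> 1\<close>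
    and at most \<open>- 1\<close> for \<open>t \<le> - 1\<close>. So \<open>c\<close> itself need
    not be computed, and the slopes stay values of \<open>\<sigma>\<close>.\<close>
  define r where "r t = (1/2) * \<rho> (2 * t + (- c))" for t
  have \<rho>_smooth: "diff_times n \<rho>" for n
    using \<rho>(1) \<sigma>_smooth by (cases n) (auto intro!: exI[of _ \<sigma>])
  have r_smooth: "diff_times n r" for n
    unfolding r_def[abs_def] by (intro diff_times_mult diff_times_const diff_times_affine \<rho>_smooth)
  have "((\<lambda>t. (1/2) * \<rho> (2 * t + (- c))) has_real_derivative (1/2) * (\<sigma> (2 * t + (- c)) * 2)) (at t)" for t
    by (intro DERIV_cmult DERIV_chain2[OF \<rho>(1)]) (auto intro!: derivative_eq_intros)
  then have r_deriv: "(r has_real_derivative \<sigma> (2 * t + (- c))) (at t)" for t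
    unfolding r_def[abs_def] by simp
  have smooth_iter: "\<forall>m. diff_times m ((deriv ^^ n) r)" for n
    by (induction n) (auto simp: r_smooth intro: diff_times_deriv simp del: diff_times.simps)
  show thesis
  proof (rule that[of "\<lambda>n. (deriv ^^ n) r"])
    show "((deriv ^^ n) r has_real_derivative (deriv ^^ Suc n) r t) (at t)" for n t
      using diff_times_deriv(1)[of 0 "(deriv ^^ n) r"] smooth_iter by simp
    have "(deriv ^^ 1) r t = \<sigma> (2 * t + (- c))" for t
      using r_deriv by (simp add: DERIV_imp_deriv)
    then show "0 \<le> (deriv ^^ 1) r t" "(deriv ^^ 1) r t \<le> 1" for t using \<sigma> by simp_all
  qed (use c \<rho>(2) \<rho>_line in \<open>auto simp: r_def\<close>)
qed

section \<open>Smooth suprema\<close>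

text \<open>The whole sequence is fixed, not only the ramp, because \<open>C_class_compose\<close>
  takes all derivatives of the outer function.\<close>

definition ramp_derivs :: "nat \<Rightarrow> real \<Rightarrow> real"
  where "ramp_derivs = (SOME d. (\<forall>n t. (d n has_real_derivative d (Suc n) t) (at t)) \<and>
    (\<forall>t\<le>-1. d 0 t = 0) \<and> (\<forall>t\<ge>1. d 0 t = t) \<and> (\<forall>t. 0 \<le> d 1 t \<and> d 1 t \<le> 1))"

definition ramp :: "real \<Rightarrow> real"
  where "ramp = ramp_derivs 0"

lemma ramp_derivs:
  "(ramp_derivs n has_real_derivative ramp_derivs (Suc n) t) (at t)"
  "t \<le> - 1 \<Longrightarrow> ramp t = 0" "t \<ge> 1 \<Longrightarrow> ramp t = t"
  "0 \<le> ramp_derivs 1 t" "ramp_derivs 1 t \<le> 1"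
proof -
  have "\<exists>d :: nat \<Rightarrow> real \<Rightarrow> real. (\<forall>n t. (d n has_real_derivative d (Suc n) t) (at t)) \<and>
    (\<forall>t\<le>-1. d 0 t = 0) \<and> (\<forall>t\<ge>1. d 0 t = t) \<and> (\<forall>t. 0 \<le> d 1 t \<and> d 1 t \<le> 1)"
    by (rule smooth_ramp) blast
  from someI_ex[OF this] show "(ramp_derivs n has_real_derivative ramp_derivs (Suc n) t) (at t)"
    "t \<le> - 1 \<Longrightarrow> ramp t = 0" "t \<ge> 1 \<Longrightarrow> ramp t = t" "0 \<le> ramp_derivs 1 t" "ramp_derivs 1 t \<le> 1"
    unfolding ramp_def ramp_derivs_def[symmetric] by blast+
qed

lemma ramp_deriv: "(ramp has_real_derivative ramp_derivs 1 t) (at t)"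
  using ramp_derivs(1)[of 0 t] by (simp add: ramp_def)

lemma ramp_mono: "s \<le> t \<Longrightarrow> ramp s \<le> ramp t"
  using ramp_deriv ramp_derivs(4) by (intro DERIV_nonneg_imp_nondecreasing[where f=ramp]) (simp, blast)

lemma ramp_diff_le:
  assumes "s \<le> t"
  shows "ramp t - ramp s \<le> t - s"
proof -
  have "ramp t - t \<le> ramp s - s"
  proof (rule DERIV_nonpos_imp_nonincreasing[OF assms, where f="\<lambda>u. ramp u - u"])
    fix u
    have "((\<lambda>u. ramp u - u) has_real_derivative ramp_derivs 1 u - 1) (at u)"
      using ramp_deriv by (auto intro!: derivative_eq_intros)
    then show "\<exists>y. ((\<lambda>u. ramp u - u) has_real_derivative y) (at u) \<and> y \<le> 0"
      using ramp_derivs(5)[of u] by (intro exI[of _ "ramp_derivs 1 u - 1"]) auto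
  qed
  then show ?thesis by simp
qed

lemma ramp_lipschitz: "\<bar>ramp s - ramp t\<bar> \<le> \<bar>s - t\<bar>"
  using ramp_mono[of s t] ramp_mono[of t s] ramp_diff_le[of s t] ramp_diff_le[of t s] by linarith

lemma ramp_bounds: "0 \<le> ramp t" "t \<le> ramp t" "ramp t \<le> max 0 t + 1"
proof -
  show 0: "0 \<le> ramp t" using ramp_mono[of "min t (- 1)" t] ramp_derivs(2)[of "min t (- 1)"] by simp
  show "t \<le> ramp t"
    using ramp_diff_le[of t "max t 1"] ramp_derivs(3)[of "max t 1"] by simp
  show "ramp t \<le> max 0 t + 1"
    using ramp_diff_le[of "- 1" t] ramp_derivs(2)[of "- 1"] ramp_derivs(2)[of t] by (cases "t \<ge> - 1") auto
qed

lemma C_class_ramp: "f \<in> C_class k \<Longrightarrow> (\<lambda>x. ramp (f x)) \<in> C_class k"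
  unfolding ramp_def by (rule C_class_compose[of ramp_derivs, OF ramp_derivs(1)])

section \<open>The smooth maximum of two numbers\<close>

definition smax :: "real \<Rightarrow> real \<Rightarrow> real \<Rightarrow> real"
  where "smax e a b = b + e * ramp ((a - b) / e)"

lemma smax_ge:
  assumes "e > 0"
  shows "a \<le> smax e a b" "b \<le> smax e a b"
  using ramp_bounds(1,2)[of "(a - b) / e"] assms by (auto simp: smax_def field_simps)

lemma smax_le:
  assumes "e > 0" "a \<le> s" "b \<le> s"
  shows "smax e a b \<le> s + e"
proof -
  have "e * ramp ((a - b) / e) \<le> e * (max 0 ((a - b) / e) + 1)"
    using ramp_bounds(3)[of "(a - b) / e"] assms by (intro mult_left_mono) auto
  also have "\<dots> = max 0 (a - b) + e"
    using assms by (auto simp: max_def field_simps)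
  finally show ?thesis using assms by (auto simp: smax_def)
qed

lemma smax_eq_left:
  assumes "e > 0" "b + e \<le> a"
  shows "smax e a b = a"
  using assms ramp_derivs(3)[of "(a - b) / e"] by (simp add: smax_def field_simps)

text \<open>Monotonicity in \<open>a\<close> is that of \<open>ramp\<close>. Monotonicity in
  \<open>b\<close> holds because the slope of \<open>ramp\<close> is at most 1, so the ramp loses no
  more than the summand \<open>b\<close> gains.\<close>

lemma smax_mono:
  assumes e: "e > 0" and "a \<le> a'" "b \<le> b'"
  shows "smax e a b \<le> smax e a' b'"
proof -
  have "ramp ((a - b) / e) \<le> ramp ((a' - b) / e)"
    using assms by (intro ramp_mono) (simp add: divide_right_mono)
  moreover have "ramp ((a' - b) / e) - ramp ((a' - b') / e) \<le> (a' - b) / e - (a' - b') / e"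
    using assms by (intro ramp_diff_le) (simp add: divide_right_mono)
  ultimately have "ramp ((a - b) / e) \<le> ramp ((a' - b') / e) + (b' - b) / e"
    by (simp add: diff_divide_distrib)
  then have "e * ramp ((a - b) / e) \<le> e * (ramp ((a' - b') / e) + (b' - b) / e)"
    using e by (intro mult_left_mono) auto
  then show ?thesis using e by (simp add: smax_def distrib_left)
qed

text \<open>A monotone function of two numbers that commutes with adding a constant to both is
  1-Lipschitz for the sup norm. No constant is lost, so iteration is free.\<close>

lemma smax_lipschitz:
  assumes e: "e > 0" and "\<bar>a - a'\<bar> \<le> s" "\<bar>b - b'\<bar> \<le> s"
  shows "\<bar>smax e a b - smax e a' b'\<bar> \<le> s"
proof -
  have shift: "smax e (a + s) (b + s) = smax e a b + s" for a b by (simp add: smax_def)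
  have "smax e a b \<le> smax e (a' + s) (b' + s)" "smax e a' b' \<le> smax e (a + s) (b + s)"
    using assms by (auto intro!: smax_mono)
  then show ?thesis unfolding shift by linarith
qed

lemma C_class_smax:
  assumes "f \<in> C_class k" "g \<in> C_class k"
  shows "(\<lambda>x. smax e (f x) (g x)) \<in> C_class k"
proof -
  have "(\<lambda>x. g x + e * ramp ((1 / e) * (f x - g x))) \<in> C_class k"
    by (intro C_class_add C_class_scale C_class_ramp C_class_diff assms)
  then show ?thesis by (simp add: smax_def)
qed

section \<open>Iterated smooth maxima\<close>

fun seqmax :: "real \<Rightarrow> (nat \<Rightarrow> 'a \<Rightarrow> real) \<Rightarrow> nat \<Rightarrow> 'a \<Rightarrow> real"
  where
    "seqmax E h 0 x = h 0 x"
  | "seqmax E h (Suc n) x = smax (E / 2 ^ Suc n) (seqmax E h n x) (h (Suc n) x)"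

lemma seqmax_ge: "E > 0 \<Longrightarrow> i \<le> n \<Longrightarrow> h i x \<le> seqmax E h n x"
proof (induction n)
  case (Suc n)
  then have "seqmax E h n x \<le> seqmax E h (Suc n) x" "h (Suc n) x \<le> seqmax E h (Suc n) x"
    by (simp_all add: smax_ge del: power_Suc)
  with Suc show ?case by (cases "i = Suc n") auto
qed simp

lemma seqmax_le:
  assumes "E > 0" "\<And>i. i \<le> n \<Longrightarrow> h i x \<le> s"
  shows "seqmax E h n x \<le> s + E"
proof -
  \<comment> \<open>The total of the first \<open>n\<close> tolerances
    \<open>E / 2 ^ i\<close>.\<close>
  have "seqmax E h n x \<le> s + E * (1 - 1 / 2 ^ n)"
    using assms(2)
  proof (induction n)
    case (Suc n)
    have "seqmax E h (Suc n) x \<le> s + E * (1 - 1 / 2 ^ n) + E / 2 ^ Suc n"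
      unfolding seqmax.simps
    proof (rule smax_le)
      show "seqmax E h n x \<le> s + E * (1 - 1 / 2 ^ n)" using Suc by simp
      have "0 \<le> E * (1 - 1 / 2 ^ n)" using assms(1) by simp
      then show "h (Suc n) x \<le> s + E * (1 - 1 / 2 ^ n)" using Suc.prems[of "Suc n"] by simp
    qed (use assms in simp)
    then show ?case by (simp add: field_simps)
  qed simp
  moreover have "E * (1 - 1 / 2 ^ n) \<le> E * 1" using assms(1) by (intro mult_left_mono) auto
  ultimately show ?thesis by simp
qed

lemma C_class_seqmax:
  assumes "\<And>i. h i \<in> C_class k"
  shows "seqmax E h n \<in> C_class k"
proof (induction n)
  case 0
  have "seqmax E h 0 = h 0" by (rule ext) simp
  then show ?case using assms by simp
next
  case (Suc n)
  have "seqmax E h (Suc n) = (\<lambda>x. smax (E / 2 ^ Suc n) (seqmax E h n x) (h (Suc n) x))"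
    by (rule ext) simp
  then show ?case using C_class_smax[OF Suc assms] by simp
qed

lemma seqmax_lipschitz:
  assumes "E > 0" "\<And>i x y. \<bar>h i x - h i y\<bar> \<le> L * norm (x - y)"
  shows "\<bar>seqmax E h n x - seqmax E h n y\<bar> \<le> L * norm (x - y)"
  using assms by (induction n) (auto intro!: smax_lipschitz)

text \<open>In \<open>loc\<close> the index \<open>m\<close> is uniform near \<open>x\<close>, while
  the dominating member \<open>i\<close> may depend on both \<open>y\<close> and \<open>n\<close>.
  The running maximum lies above \<open>h i y\<close>, so a later member stays below it by
  \<open>E\<close>, which exceeds every tolerance, and \<open>smax_eq_left\<close> makes the step
  trivial.\<close>

lemma smooth_supremum:
  fixes h :: "nat \<Rightarrow> 'a::real_normed_vector \<Rightarrow> real"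
  assumes E: "E > 0" and C: "\<And>i. h i \<in> C_class k"
    and lip: "\<And>i x y. \<bar>h i x - h i y\<bar> \<le> L * norm (x - y)"
    and loc: "\<And>x. \<exists>m. \<forall>\<^sub>F y in nhds x. \<forall>n>m. \<exists>i\<le>m. h n y + E \<le> h i y"
  obtains g where "g \<in> C_class k" "\<And>x y. \<bar>g x - g y\<bar> \<le> L * norm (x - y)"
    "\<And>n x. h n x \<le> g x" "\<And>x s. (\<And>n. h n x \<le> s) \<Longrightarrow> g x \<le> s + E"
proof -
  obtain m where m: "\<And>x. \<forall>\<^sub>F y in nhds x. \<forall>n>m x. \<exists>i\<le>m x. h n y + E \<le> h i y"
    by atomize_elim (intro choice allI loc)
  have stable: "seqmax E h n y = seqmax E h k y"
    if dom: "\<forall>n>k. \<exists>i\<le>k. h n y + E \<le> h i y" and "k \<le> n" for n k y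
    using \<open>k \<le> n\<close>
  proof (induction n rule: dec_induct)
    case (step n)
    then obtain i where i: "i \<le> k" "h (Suc n) y + E \<le> h i y" using dom by (meson less_Suc_eq_le)
    have "h i y \<le> seqmax E h n y" using i step E by (intro seqmax_ge) auto
    moreover have "E / 2 ^ Suc n \<le> E / 1" using E one_le_power[of "2::real" "Suc n"]
      by (intro divide_left_mono) (auto simp del: power_Suc)
    ultimately have "seqmax E h (Suc n) y = seqmax E h n y"
      unfolding seqmax.simps using i E by (intro smax_eq_left) auto
    then show ?case using step.IH by simp
  qed simp
  \<comment> \<open>The index varies with the point. Comparisons of two points pass to the larger
    index, where both values are already stationary.\<close>
  define g where "g x = seqmax E h (m x) x" for x
  have g: "g x = seqmax E h n x" if "n \<ge> m x" for n x
    using stable[OF eventually_nhds_x_imp_x[OF m] that] by (simp add: g_def)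
  show thesis
  proof
    show "g \<in> C_class k"
    proof (rule C_class_local)
      fix x
      have "\<forall>\<^sub>F y in nhds x. g y = seqmax E h (m x) y"
        using m[of x]
      proof eventually_elim
        case (elim y)
        from stable[OF this, of "max (m x) (m y)"] g[of y "max (m x) (m y)"] show ?case by simp
      qed
      then show "\<exists>f\<in>C_class k. \<forall>\<^sub>F y in nhds x. g y = f y"
        by (rule bexI[of _ "seqmax E h (m x)"]) (rule C_class_seqmax[OF C])
    qed
    show "\<bar>g x - g y\<bar> \<le> L * norm (x - y)" for x y
      using g[of x "max (m x) (m y)"] g[of y "max (m x) (m y)"] seqmax_lipschitz[OF E lip] by simp
    show "h n x \<le> g x" for n x
      using g[of x "max (m x) n"] seqmax_ge[OF E, of n "max (m x) n" h x] by simp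
    show "g x \<le> s + E" if "\<And>n. h n x \<le> s" for x s
      unfolding g_def using E that by (intro seqmax_le) auto
  qed
qed

text \<open>Near a point where the given bump is nonzero it is close to a nonzero constant. Dividing
  by that constant, zooming in and clipping smoothly from both sides gives a plateau at height 1 and
  values in the unit interval.\<close>

lemma normalised_bump:
  fixes \<phi> :: "'a::real_normed_vector \<Rightarrow> real"
  assumes "\<phi> \<in> C_class_bs k \<inter> Lip" "\<phi> \<noteq> (\<lambda>x. 0)"
  obtains \<psi> :: "'a \<Rightarrow> real" and R L where "\<psi> \<in> C_class k" "R \<ge> 1" "L \<ge> 0"
    "\<And>x y. \<bar>\<psi> x - \<psi> y\<bar> \<le> L * norm (x - y)" "\<And>x. 0 \<le> \<psi> x" "\<And>x. \<psi> x \<le> 1"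
    "\<And>x. norm x \<le> 1 \<Longrightarrow> \<psi> x = 1" "\<And>x. norm x \<ge> R \<Longrightarrow> \<psi> x = 0"
proof -
  obtain p where p: "\<phi> p \<noteq> 0" using assms(2) by auto
  obtain R0 where \<phi>: "\<phi> \<in> C_class k" and R0: "\<And>x. x \<notin> ball 0 R0 \<Longrightarrow> \<phi> x = 0"
    using assms(1) by (auto simp: C_class_bs_def)
  obtain L0 where "L0-lipschitz_on UNIV \<phi>" using assms(1) by (auto simp: Lip_def)
  then have L0: "L0 \<ge> 0" "\<And>x y. \<bar>\<phi> x - \<phi> y\<bar> \<le> L0 * norm (x - y)"
    by (auto simp: lipschitz_on_def dist_norm)
  define c where "c = 1 / \<phi> p"
  \<comment> \<open>So small that \<open>c * \<phi>\<close>, which is 1 at \<open>p\<close>, stays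
    above \<open>2/3\<close> on the zoomed unit ball.\<close>
  define r where "r = 1 / (3 * (\<bar>c\<bar> * L0 + 1))"
  have r: "r > 0" using L0 by (auto simp: r_def add_nonneg_pos)
  \<comment> \<open>Levels matched to the ramp: where \<open>c * \<phi> \<ge> 2/3\<close>, both
    \<open>u\<close> and \<open>u - 2\<close> are at least 1 and the two ramps differ by 2; where
    \<open>\<phi>\<close> is 0, \<open>u = - 1\<close> and both ramps vanish.\<close>
  define u where "u x = 6 * (c * \<phi> (r *\<^sub>R x + p)) + (- 1)" for x
  define \<psi> where "\<psi> x = (1/2) * (ramp (u x) - ramp (u x + (- 2)))" for x
  have u: "u \<in> C_class k"
    unfolding u_def[abs_def] by (intro C_class_add C_class_scale C_class_const C_class_affine \<phi>)
  define Lc where "Lc = 6 * \<bar>c\<bar> * L0 * r"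
  have u_lip: "\<bar>u x - u y\<bar> \<le> Lc * norm (x - y)" for x y
  proof -
    have "u x - u y = 6 * c * (\<phi> (r *\<^sub>R x + p) - \<phi> (r *\<^sub>R y + p))"
      by (simp add: u_def algebra_simps)
    then have "\<bar>u x - u y\<bar> = 6 * \<bar>c\<bar> * \<bar>\<phi> (r *\<^sub>R x + p) - \<phi> (r *\<^sub>R y + p)\<bar>"
      by (simp add: abs_mult)
    also have "\<dots> \<le> 6 * \<bar>c\<bar> * (L0 * norm (r *\<^sub>R x + p - (r *\<^sub>R y + p)))"
      by (intro mult_left_mono L0(2)) auto
    also have "r *\<^sub>R x + p - (r *\<^sub>R y + p) = r *\<^sub>R (x - y)" by (simp add: algebra_simps)
    finally show ?thesis using r by (simp add: Lc_def)
  qed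
  show thesis
  proof
    show "\<psi> \<in> C_class k"
      unfolding \<psi>_def[abs_def] by (intro C_class_scale C_class_diff C_class_ramp C_class_add C_class_const u)
    show "max 1 ((R0 + norm p) / r) \<ge> 1" by simp
    show "Lc \<ge> 0" using L0 r by (simp add: Lc_def)
    show "\<bar>\<psi> x - \<psi> y\<bar> \<le> Lc * norm (x - y)" for x y
    proof -
      have "\<psi> x - \<psi> y = (1/2) * ((ramp (u x) - ramp (u y)) - (ramp (u x + (- 2)) - ramp (u y + (- 2))))"
        by (simp add: \<psi>_def algebra_simps)
      then have "\<bar>\<psi> x - \<psi> y\<bar> = (1/2) * \<bar>(ramp (u x) - ramp (u y)) - (ramp (u x + (- 2)) - ramp (u y + (- 2)))\<bar>"
        by (simp only: abs_mult)
      also have "\<dots> \<le> (1/2) * (\<bar>ramp (u x) - ramp (u y)\<bar> + \<bar>ramp (u x + (- 2)) - ramp (u y + (- 2))\<bar>)"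
        by (intro mult_left_mono abs_triangle_ineq4) simp
      also have "\<dots> \<le> (1/2) * (\<bar>u x - u y\<bar> + \<bar>(u x + (- 2)) - (u y + (- 2))\<bar>)"
        by (intro mult_left_mono add_mono ramp_lipschitz) simp
      also have "\<dots> = \<bar>u x - u y\<bar>" by simp
      also have "\<dots> \<le> Lc * norm (x - y)" by (rule u_lip)
      finally show ?thesis .
    qed
    show "0 \<le> \<psi> x" "\<psi> x \<le> 1" for x
      using ramp_mono[of "u x + (- 2)" "u x"] ramp_diff_le[of "u x + (- 2)" "u x"] by (auto simp: \<psi>_def)
    show "\<psi> x = 1" if "norm x \<le> 1" for x
    proof -
      have "\<bar>c * \<phi> (r *\<^sub>R x + p) - c * \<phi> p\<bar> = \<bar>c\<bar> * \<bar>\<phi> (r *\<^sub>R x + p) - \<phi> p\<bar>"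
        by (simp add: abs_mult flip: right_diff_distrib)
      also have "\<dots> \<le> \<bar>c\<bar> * (L0 * norm (r *\<^sub>R x + p - p))" by (intro mult_left_mono L0) auto
      also have "\<dots> \<le> \<bar>c\<bar> * (L0 * r)"
        using that r L0(1) by (intro mult_left_mono) auto
      also have "\<dots> = (\<bar>c\<bar> * L0) / (\<bar>c\<bar> * L0 + 1) / 3" by (simp add: r_def)
      also have "\<dots> \<le> 1 / 3" using L0(1) by (intro divide_right_mono) (auto simp: divide_le_eq_1 add_nonneg_pos)
      finally have "\<bar>c * \<phi> (r *\<^sub>R x + p) - c * \<phi> p\<bar> \<le> 1/3" .
      moreover have "c * \<phi> p = 1" using p by (simp add: c_def)
      ultimately have "c * \<phi> (r *\<^sub>R x + p) \<ge> 2/3" by linarith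
      then show ?thesis by (simp add: \<psi>_def u_def ramp_derivs(3))
    qed
    show "\<psi> x = 0" if "norm x \<ge> max 1 ((R0 + norm p) / r)" for x
    proof -
      have "R0 + norm p \<le> r * norm x" using that r by (simp add: field_simps)
      also have "\<dots> \<le> norm (r *\<^sub>R x + p) + norm p"
        using norm_triangle_ineq4[of "r *\<^sub>R x + p" p] r by simp
      finally have "\<phi> (r *\<^sub>R x + p) = 0" by (intro R0) simp
      then show ?thesis by (simp add: \<psi>_def u_def ramp_derivs(2))
    qed
  qed
qed

text \<open>A substitute for the norm, which need not be smooth. The functions
  \<open>n * (1 - \<psi> (x / n))\<close> are all \<open>L\<close>-Lipschitz by scaling, vanish on
  the ball of radius \<open>n\<close> and equal \<open>n\<close> outside the ball of radius
  \<open>n * R\<close>, so their supremum grows like the norm.\<close>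

lemma smooth_coarse_norm:
  fixes \<psi> :: "'a::real_normed_vector \<Rightarrow> real"
  assumes C: "\<psi> \<in> C_class k" and R: "R \<ge> 1" and L: "L \<ge> 0"
    and lip: "\<And>x y. \<bar>\<psi> x - \<psi> y\<bar> \<le> L * norm (x - y)"
    and bd: "\<And>x. 0 \<le> \<psi> x" "\<And>x. \<psi> x \<le> 1"
    and one: "\<And>x. norm x \<le> 1 \<Longrightarrow> \<psi> x = 1" and zero: "\<And>x. norm x \<ge> R \<Longrightarrow> \<psi> x = 0"
  obtains \<Phi> :: "'a \<Rightarrow> real" where "\<Phi> \<in> C_class k" "\<And>x y. \<bar>\<Phi> x - \<Phi> y\<bar> \<le> L * norm (x - y)"
    "\<And>x. norm x \<le> 2 * R * \<Phi> x" "\<And>x. \<Phi> x \<le> norm x + 2"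
proof -
  \<comment> \<open>Index 0 is the constant 1, equal to the margin of the smooth supremum: it
    dominates every member that vanishes, and near a given point all members of large index
    do.\<close>
  define h where "h n x = (if n = 0 then 1 else real n * (1 - \<psi> ((1 / real n) *\<^sub>R x + 0)))" for n and x :: 'a
  have hC: "h n \<in> C_class k" for n
  proof (cases "n = 0")
    case False
    then have "h n = (\<lambda>x. real n * (1 - \<psi> ((1 / real n) *\<^sub>R x + 0)))" by (auto simp: h_def)
    then show ?thesis using C by (simp only:) (intro C_class_scale C_class_diff C_class_const C_class_affine)
  qed (simp add: h_def[abs_def] C_class_const)
  have hlip: "\<bar>h n x - h n y\<bar> \<le> L * norm (x - y)" for n x y
  proof (cases "n = 0")
    case False
    then have "\<bar>h n x - h n y\<bar> = real n * \<bar>\<psi> ((1 / real n) *\<^sub>R y) - \<psi> ((1 / real n) *\<^sub>R x)\<bar>"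
      by (simp add: h_def abs_mult flip: right_diff_distrib)
    also have "\<dots> \<le> real n * (L * norm ((1 / real n) *\<^sub>R y - (1 / real n) *\<^sub>R x))"
      by (intro mult_left_mono lip) auto
    also have "(1 / real n) *\<^sub>R y - (1 / real n) *\<^sub>R x = (1 / real n) *\<^sub>R (y - x)" by (simp add: algebra_simps)
    finally show ?thesis using False by (simp add: norm_minus_commute)
  qed (simp add: h_def L)
  have h0: "h n x = 0" if "norm x \<le> real n" "n > 0" for n x
    using that one[of "(1 / real n) *\<^sub>R x"] by (simp add: h_def field_simps)
  have hle: "h n x \<le> norm x + 1" for n x
  proof (cases "norm x \<le> real n \<or> n = 0")
    case False
    then have "h n x \<le> real n * 1"
      using bd[of "(1 / real n) *\<^sub>R x"] by (simp add: h_def)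
    with False show ?thesis by simp
  next
    case True
    then show ?thesis using h0[of x n] by (cases "n = 0") (auto simp: h_def[of 0])
  qed
  have loc: "\<exists>m. \<forall>\<^sub>F y in nhds x. \<forall>n>m. \<exists>i\<le>m. h n y + 1 \<le> h i y" for x
  proof -
    obtain m where m: "norm x + 1 \<le> real m" using real_arch_simple by blast
    have "\<forall>\<^sub>F y in nhds x. dist y x < 1" by (rule eventually_nhds_metric[THEN iffD2]) (auto intro: exI[of _ 1])
    then have "\<forall>\<^sub>F y in nhds x. \<forall>n>m. \<exists>i\<le>m. h n y + 1 \<le> h i y"
    proof eventually_elim
      case (elim y)
      have "norm y \<le> norm x + 1" using elim norm_triangle_sub[of y x] by (simp add: dist_norm)
      with m have "h n y = 0" if "n > m" for n using that by (intro h0) auto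
      then show ?case by (auto intro!: exI[of _ 0] simp: h_def[of 0])
    qed
    then show ?thesis ..
  qed
  obtain g where g: "g \<in> C_class k" "\<And>x y. \<bar>g x - g y\<bar> \<le> L * norm (x - y)"
    "\<And>n x. h n x \<le> g x" "\<And>x s. (\<And>n. h n x \<le> s) \<Longrightarrow> g x \<le> s + 1"
    using smooth_supremum[OF zero_less_one hC hlip loc] by blast
  show thesis
  proof (rule that[OF g(1,2)])
    fix x
    show "g x \<le> norm x + 2" using g(4)[OF hle, of x] by simp
    show "norm x \<le> 2 * R * g x"
    proof (cases "norm x \<le> 2 * R")
      case True
      have "2 * R * 1 \<le> 2 * R * g x" using g(3)[of 0 x] R by (intro mult_left_mono) (auto simp: h_def)
      with True show ?thesis by simp
    next
      case False
      \<comment> \<open>The largest index whose member is already saturated at \<open>x\<close>;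
        rounding down costs at most a factor 2, since \<open>n \<ge> 1\<close>.\<close>
      define n where "n = nat \<lfloor>norm x / R\<rfloor>"
      have q: "norm x / R > 2" using False R by (simp add: field_simps)
      have n: "real n \<le> norm x / R" "norm x / R < real n + 1" "n \<ge> 1"
        using q unfolding n_def by linarith+
      have "norm ((1 / real n) *\<^sub>R x) \<ge> R" using n R by (simp add: field_simps)
      then have "h n x = real n" using n zero by (simp add: h_def)
      then have "real n \<le> g x" using g(3)[of n x] by simp
      moreover have "norm x / R \<le> 2 * real n" using n by simp
      ultimately have "norm x / R \<le> 2 * g x" by linarith
      then show ?thesis using R by (simp add: field_simps)
    qed
  qed
qed

section \<open>Smoothing at a given scale\<close>

text \<open>The value \<open>f (p n)\<close> of a point of a dense sequence competes in the smooth supremum only near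
  \<open>p n\<close>, because of the smooth coarse norm, and only away from the earlier points \<open>p i\<close>,
  because of the smooth supremum \<open>c n\<close> of the bumps at these points.  So the family is locally
  dominated by finitely many members although the bumps need not be locally finite.\<close>
lemma smooth_approximation_coarse_lipschitz:
  fixes \<psi> :: "'a::real_normed_vector \<Rightarrow> real" and p :: "nat \<Rightarrow> 'a"
  assumes C: "\<psi> \<in> C_class k" and R: "R \<ge> 1" and L: "L \<ge> 0"
    and lip: "\<And>x y. \<bar>\<psi> x - \<psi> y\<bar> \<le> L * norm (x - y)"
    and bd: "\<And>x. 0 \<le> \<psi> x" "\<And>x. \<psi> x \<le> 1"
    and one: "\<And>x. norm x \<le> 1 \<Longrightarrow> \<psi> x = 1" and zero: "\<And>x. norm x \<ge> R \<Longrightarrow> \<psi> x = 0"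
    and dense: "\<And>x. \<exists>n. norm (x - p n) < 1"
  obtains D where "D > 0" "\<And>f :: 'a \<Rightarrow> real. (\<And>x y. \<bar>f x - f y\<bar> \<le> norm (x - y) + 1) \<Longrightarrow>
    \<exists>g \<in> C_class k. (\<forall>x y. \<bar>g x - g y\<bar> \<le> D * norm (x - y)) \<and> (\<forall>x. \<bar>f x - g x\<bar> \<le> D)"
proof -
  obtain \<Phi> :: "'a \<Rightarrow> real" where \<Phi>: "\<Phi> \<in> C_class k" "\<And>x y. \<bar>\<Phi> x - \<Phi> y\<bar> \<le> L * norm (x - y)"
    "\<And>x. norm x \<le> 2 * R * \<Phi> x" "\<And>x. \<Phi> x \<le> norm x + 2"
    using smooth_coarse_norm[OF C R L lip bd one zero] by blast
  \<comment> \<open>\<open>A\<close> bounds what a candidate centred within \<open>R\<close> of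
    \<open>x\<close> loses against \<open>f x\<close>, apart from the penalty. A full penalty
    \<open>K\<close> exceeds the reduced one \<open>K * (3/4)\<close> by \<open>A + 2\<close>: this
    pays for \<open>A\<close>, for the 1 in \<open>H_le\<close> and for the margin 1 of the smooth
    supremum.\<close>
  define A where "A = R + 1 + 2 * R * (R + 2)"
  define K where "K = 4 * (A + 2)"
  have A: "A \<ge> 0" using R by (simp add: A_def)
  then have K: "K \<ge> 0" by (simp add: K_def)
  \<comment> \<open>The shift by one makes \<open>c n\<close> see exactly the points before
    \<open>p n\<close>; the constant 0 in front keeps it nonnegative.\<close>
  define h where "h n x = (case n of 0 \<Rightarrow> 0 | Suc i \<Rightarrow> \<psi> (1 *\<^sub>R x + (- p i)))" for n x
  have hC: "h n \<in> C_class k" for n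
    unfolding h_def[abs_def] by (cases n) (simp_all only: nat.case C_class_const C_class_affine[OF C])
  have hlip: "\<bar>h n x - h n y\<bar> \<le> L * norm (x - y)" for n x y
    using lip[of "x - p (n - 1)" "y - p (n - 1)"] L by (cases n) (simp_all add: h_def)
  \<comment> \<open>The tolerance \<open>1/4\<close> keeps two levels apart: \<open>c n\<close> is
    at most \<open>3/4\<close> where all earlier bumps are at most \<open>1/2\<close>, and at least
    1 where one of them is 1.\<close>
  define c where "c = seqmax (1/4) h"
  have cC: "c n \<in> C_class k" for n unfolding c_def by (rule C_class_seqmax[OF hC])
  have clip: "\<bar>c n x - c n y\<bar> \<le> L * norm (x - y)" for n x y
    unfolding c_def by (rule seqmax_lipschitz[OF _ hlip]) simp
  have c_nonneg: "c n x \<ge> 0" for n x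
    using seqmax_ge[of "1/4" 0 n h x] by (simp add: c_def h_def)
  have c_ge: "\<psi> (x - p i) \<le> c n x" if "i < n" for i n x
    using seqmax_ge[of "1/4" "Suc i" n h x] that by (simp add: c_def h_def)
  have c_le: "c n x \<le> 3/4" if "\<And>i. i < n \<Longrightarrow> \<psi> (x - p i) \<le> 1/2" for n x
  proof -
    have "h i x \<le> 1/2" if "i \<le> n" for i
      using \<open>\<And>i. i < n \<Longrightarrow> \<psi> (x - p i) \<le> 1/2\<close>[of "i - 1"] that by (cases i) (simp_all add: h_def)
    from seqmax_le[of "1/4" n h x, OF _ this] show ?thesis by (simp add: c_def)
  qed
  define D where "D = 2 * R * L + K * L + A + K + 2"
  have D: "D > 0" using A K R L by (auto simp: D_def intro!: add_nonneg_pos add_nonneg_nonneg)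
  show thesis
  proof (rule that[OF D])
    fix f :: "'a \<Rightarrow> real"
    assume f: "\<And>x y. \<bar>f x - f y\<bar> \<le> norm (x - y) + 1"
    define H where "H n x = f (p n) - (2 * R * \<Phi> (1 *\<^sub>R x + (- p n)) + K * c n x)" for n x
    have HC: "H n \<in> C_class k" for n
      unfolding H_def[abs_def]
      by (intro C_class_diff C_class_const C_class_add C_class_scale C_class_affine \<Phi>(1) cC)
    have Hlip: "\<bar>H n x - H n y\<bar> \<le> (2 * R * L + K * L) * norm (x - y)" for n x y
    proof -
      have "\<bar>2 * R * (\<Phi> (x - p n) - \<Phi> (y - p n))\<bar> \<le> 2 * R * (L * norm (x - y))"
        unfolding abs_mult using R \<Phi>(2)[of "x - p n" "y - p n"] by (intro mult_mono) auto
      moreover have "\<bar>K * (c n x - c n y)\<bar> \<le> K * (L * norm (x - y))"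
        unfolding abs_mult using K clip[of n x y] by (intro mult_mono) auto
      ultimately show ?thesis by (simp add: H_def algebra_simps)
    qed
    \<comment> \<open>\<open>2 * R * \<Phi>\<close> is at least the norm and absorbs the growth of
      \<open>f\<close> away from \<open>p n\<close>; the coarse error 1 remains.\<close>
    have H_le: "H n x \<le> f x + 1 - K * c n x" for n x
      using f[of "p n" x] \<Phi>(3)[of "x - p n"] by (simp add: H_def norm_minus_commute)
    then have H_le': "H n x \<le> f x + 1" for n x
      using mult_nonneg_nonneg[OF K c_nonneg[of n x]] by (smt (verit))
    have H_ge: "\<exists>i\<le>m. f x - A - K * (3/4) \<le> H i x" if "norm (x - p m) < 1" for m x
    proof -
      \<comment> \<open>Minimality keeps all earlier bumps at most \<open>1/2\<close> at
        \<open>x\<close>, which limits the penalty, while a nonzero bump at \<open>p i\<close> keeps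
        \<open>p i\<close> within \<open>R\<close> of \<open>x\<close>.\<close>
      define i where "i = (LEAST i. \<psi> (x - p i) > 1/2)"
      have m: "\<psi> (x - p m) > 1/2" using one[of "x - p m"] that by simp
      have i: "\<psi> (x - p i) > 1/2" unfolding i_def by (rule LeastI[of _ m]) (rule m)
      have "\<psi> (x - p j) \<le> 1/2" if "j < i" for j
        using not_less_Least[OF that[unfolded i_def]] by simp
      then have "c i x \<le> 3/4" by (rule c_le)
      then have c: "K * c i x \<le> K * (3/4)" using K by (rule mult_left_mono)
      have n: "norm (x - p i) \<le> R" using i zero[of "x - p i"] by (cases "norm (x - p i) \<ge> R") auto
      then have "2 * R * \<Phi> (x - p i) \<le> 2 * R * (R + 2)"
        using \<Phi>(4)[of "x - p i"] R by (intro mult_left_mono) auto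
      then have "f x - A - K * (3/4) \<le> H i x"
        using f[of x "p i"] n c by (simp add: H_def A_def)
      moreover have "i \<le> m" unfolding i_def by (rule Least_le) (rule m)
      ultimately show ?thesis by blast
    qed
    have loc: "\<exists>m. \<forall>\<^sub>F y in nhds x. \<forall>n>m. \<exists>i\<le>m. H n y + 1 \<le> H i y" for x
    proof -
      obtain m where m: "norm (x - p m) < 1" using dense by blast
      have "open (ball (p m) 1)" "x \<in> ball (p m) 1"
        using m by (simp_all add: dist_norm norm_minus_commute)
      then have "\<forall>\<^sub>F y in nhds x. y \<in> ball (p m) 1" by (rule eventually_nhds_in_open)
      then have "\<forall>\<^sub>F y in nhds x. \<forall>n>m. \<exists>i\<le>m. H n y + 1 \<le> H i y"
      proof eventually_elim
        case (elim y)
        then have y: "norm (y - p m) < 1" by (simp add: dist_norm norm_minus_commute)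
        then obtain i where i: "i \<le> m" "f y - A - K * (3/4) \<le> H i y" using H_ge by blast
        have "H n y + 1 \<le> H i y" if "n > m" for n
        proof -
          have "1 \<le> c n y" using c_ge[OF that, of y] one[of "y - p m"] y by simp
          then have "K * 1 \<le> K * c n y" using K by (rule mult_left_mono)
          moreover have "K * 1 = 4 * A + 8" "K * (3/4) = 3 * A + 6" by (simp_all add: K_def)
          ultimately show ?thesis using H_le[of n y] i(2) by linarith
        qed
        with i(1) show ?case by blast
      qed
      then show ?thesis ..
    qed
    obtain g where g: "g \<in> C_class k" "\<And>x y. \<bar>g x - g y\<bar> \<le> (2 * R * L + K * L) * norm (x - y)"
      "\<And>n x. H n x \<le> g x" "\<And>x s. (\<And>n. H n x \<le> s) \<Longrightarrow> g x \<le> s + 1"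
      using smooth_supremum[OF zero_less_one HC Hlip loc] by blast
    show "\<exists>g \<in> C_class k. (\<forall>x y. \<bar>g x - g y\<bar> \<le> D * norm (x - y)) \<and> (\<forall>x. \<bar>f x - g x\<bar> \<le> D)"
    proof (intro bexI[OF _ g(1)] conjI allI)
      fix x y :: 'a
      have "2 * R * L + K * L \<le> D" using A K by (simp add: D_def)
      then have "(2 * R * L + K * L) * norm (x - y) \<le> D * norm (x - y)" by (intro mult_right_mono) auto
      with g(2)[of x y] show "\<bar>g x - g y\<bar> \<le> D * norm (x - y)" by linarith
    next
      fix x
      obtain m where "norm (x - p m) < 1" using dense by blast
      from H_ge[OF this] obtain i where "f x - A - K * (3/4) \<le> H i x" by blast
      then have "f x - A - K * (3/4) \<le> g x" using g(3)[of i x] by linarith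
      moreover have "g x \<le> f x + 2" using g(4)[of x "f x + 1", OF H_le'] by simp
      moreover have "A + K + 2 \<le> D" using R L K by (simp add: D_def)
      moreover have "K * (3/4) \<le> K" using K by simp
      ultimately show "\<bar>f x - g x\<bar> \<le> D" using A K unfolding abs_le_iff by linarith
    qed
  qed
qed

text \<open>A segment of length at most \<open>n\<close> is cut into \<open>n\<close> pieces of
  length at most 1, the induction splitting off the last one. Rounding the length up costs the
  additive 1.\<close>

lemma coarse_lipschitz_from_unit_scale:
  fixes f :: "'a::real_normed_vector \<Rightarrow> real"
  assumes unit: "\<And>x y. norm (x - y) \<le> 1 \<Longrightarrow> \<bar>f x - f y\<bar> \<le> 1"
  shows "\<bar>f x - f y\<bar> \<le> norm (x - y) + 1"
proof -
  have steps: "\<bar>f x - f y\<bar> \<le> real n" if "norm (x - y) \<le> real n" for n y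
    using that
  proof (induction n arbitrary: y)
    case (Suc n)
    define z where "z = x + (real n / real (Suc n)) *\<^sub>R (y - x)"
    have "x - z = (real n / real (Suc n)) *\<^sub>R (x - y)"
      by (simp add: z_def algebra_simps)
    then have "norm (x - z) = real n / real (Suc n) * norm (x - y)" by simp
    also have "\<dots> \<le> real n / real (Suc n) * real (Suc n)" by (intro mult_left_mono Suc.prems) auto
    finally have "\<bar>f x - f z\<bar> \<le> real n" by (intro Suc.IH) simp
    moreover have "z - y = (1 - real n / real (Suc n)) *\<^sub>R (x - y)"
      by (simp add: z_def algebra_simps)
    moreover have "1 - real n / real (Suc n) = 1 / real (Suc n)" by (simp add: field_simps)
    ultimately have "norm (z - y) = 1 / real (Suc n) * norm (x - y)" by simp
    also have "\<dots> \<le> 1 / real (Suc n) * real (Suc n)" by (intro mult_left_mono Suc.prems) auto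
    finally have "\<bar>f z - f y\<bar> \<le> 1" by (intro unit) simp
    with \<open>\<bar>f x - f z\<bar> \<le> real n\<close> show ?case by simp
  qed simp
  have "norm (x - y) \<le> real (nat \<lceil>norm (x - y)\<rceil>)" by linarith
  from steps[OF this] have "\<bar>f x - f y\<bar> \<le> real_of_int \<lceil>norm (x - y)\<rceil>" by simp
  also have "\<dots> \<le> norm (x - y) + 1" by (rule of_int_ceiling_le_add_one)
  finally show ?thesis .
qed

text \<open>Soft thresholding makes the approximation vanish wherever \<open>f\<close> does.\<close>
lemma smooth_approximation:
  fixes \<phi> :: "'a::real_normed_vector \<Rightarrow> real"
  assumes sep: "separable_space (euclidean :: 'a topology)"
    and \<phi>: "\<phi> \<in> C_class_bs k \<inter> Lip" "\<phi> \<noteq> (\<lambda>x. 0)"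
  obtains D where "D > 0" "\<forall>(f :: 'a \<Rightarrow> real) r M. r > 0 \<and> M > 0 \<and>
    (\<forall>x y. norm (x - y) \<le> r \<longrightarrow> \<bar>f x - f y\<bar> \<le> M) \<longrightarrow>
    (\<exists>g \<in> C_class k. (\<forall>x y. \<bar>g x - g y\<bar> \<le> D * M / r * norm (x - y)) \<and>
      (\<forall>x. \<bar>f x - g x\<bar> \<le> D * M) \<and> (\<forall>x. f x = 0 \<longrightarrow> g x = 0))"
proof -
  obtain S :: "'a set" where S: "countable S" "closure S = UNIV"
    using sep by (auto simp: separable_space_def)
  then have "S \<noteq> {}" by auto
  have dense: "\<exists>n. norm (x - from_nat_into S n) < 1" for x
  proof -
    have "x \<in> closure S" using S by simp
    then obtain s where s: "s \<in> S" "dist s x < 1" using closure_approachable[of x S] zero_less_one by blast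
    then obtain n where "from_nat_into S n = s" using from_nat_into_surj[OF S(1)] by blast
    with s(2) show ?thesis by (auto simp: dist_norm norm_minus_commute)
  qed
  obtain \<psi> :: "'a \<Rightarrow> real" and R L where \<psi>: "\<psi> \<in> C_class k" "R \<ge> 1" "L \<ge> 0"
    "\<And>x y. \<bar>\<psi> x - \<psi> y\<bar> \<le> L * norm (x - y)" "\<And>x. 0 \<le> \<psi> x" "\<And>x. \<psi> x \<le> 1"
    "\<And>x. norm x \<le> 1 \<Longrightarrow> \<psi> x = 1" "\<And>x. norm x \<ge> R \<Longrightarrow> \<psi> x = 0"
    using normalised_bump[OF \<phi>] by blast
  obtain D where D: "D > 0" and approx: "\<And>f :: 'a \<Rightarrow> real. (\<And>x y. \<bar>f x - f y\<bar> \<le> norm (x - y) + 1) \<Longrightarrow>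
    \<exists>g \<in> C_class k. (\<forall>x y. \<bar>g x - g y\<bar> \<le> D * norm (x - y)) \<and> (\<forall>x. \<bar>f x - g x\<bar> \<le> D)"
    using smooth_approximation_coarse_lipschitz[OF \<psi> dense] by blast
  \<comment> \<open>An odd function that is flat on \<open>[- D, D]\<close> and within
    \<open>2 * D\<close> of the identity. The approximation is off by at most \<open>D\<close>, so
    at zeros of \<open>f\<close> it lies in the flat part.\<close>
  define s where "s t = D * (ramp ((1 / D) * t + (- 2)) - ramp ((- 1 / D) * t + (- 2)))" for t
  have s_zero: "s t = 0" if "\<bar>t\<bar> \<le> D" for t
  proof -
    have "(1 / D) * t \<le> 1" "(- 1 / D) * t \<le> 1" using that D by (auto simp: field_simps)
    then show ?thesis by (simp add: s_def ramp_derivs(2))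
  qed
  have s_near: "\<bar>s t - t\<bar> \<le> 2 * D" for t
  proof -
    have pos: "\<bar>D * ramp ((1 / D) * t + (- 2)) - t\<bar> \<le> 2 * D" "ramp ((- 1 / D) * t + (- 2)) = 0" if "t \<ge> 0" for t
    proof -
      have "(1 / D) * t + (- 2) \<le> ramp ((1 / D) * t + (- 2))" "0 \<le> ramp ((1 / D) * t + (- 2))"
        "ramp ((1 / D) * t + (- 2)) \<le> max 0 ((1 / D) * t + (- 2)) + 1"
        by (rule ramp_bounds)+
      note this[THEN mult_left_mono, OF less_imp_le[OF D]]
      moreover have "D * (max 0 ((1 / D) * t + (- 2)) + 1) = max 0 (t - 2 * D) + D"
        using D by (auto simp: max_def field_simps)
      moreover have "D * ((1 / D) * t + (- 2)) = t - 2 * D" using D by (simp add: field_simps)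
      ultimately have "t - 2 * D \<le> D * ramp ((1 / D) * t + (- 2))" "0 \<le> D * ramp ((1 / D) * t + (- 2))"
        "D * ramp ((1 / D) * t + (- 2)) \<le> max 0 (t - 2 * D) + D" by (simp_all only: mult_zero_right)
      then show "\<bar>D * ramp ((1 / D) * t + (- 2)) - t\<bar> \<le> 2 * D"
        using that D by (auto simp only: abs_le_iff max_def split: if_splits)
      have "(- 1 / D) * t \<le> 0" using that D by (simp add: field_simps)
      then show "ramp ((- 1 / D) * t + (- 2)) = 0" by (intro ramp_derivs(2)) simp
    qed
    show ?thesis
    proof (cases "t \<ge> 0")
      case True
      then show ?thesis using pos[of t] by (simp add: s_def)
    next
      case False
      then show ?thesis using pos[of "- t"] by (simp add: s_def)
    qed
  qed
  have s_lip: "\<bar>s t - s u\<bar> \<le> 2 * \<bar>t - u\<bar>" for t u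
  proof -
    have "\<bar>s t - s u\<bar> \<le> D * (\<bar>((1 / D) * t + (- 2)) - ((1 / D) * u + (- 2))\<bar>
        + \<bar>((- 1 / D) * t + (- 2)) - ((- 1 / D) * u + (- 2))\<bar>)"
      unfolding s_def right_diff_distrib[symmetric] abs_mult
      using D ramp_lipschitz[of "(1 / D) * t + (- 2)" "(1 / D) * u + (- 2)"]
        ramp_lipschitz[of "(- 1 / D) * t + (- 2)" "(- 1 / D) * u + (- 2)"]
      by (intro mult_mono) linarith+
    also have "((1 / D) * t + (- 2)) - ((1 / D) * u + (- 2)) = (t - u) / D"
      by (simp add: diff_divide_distrib)
    also have "((- 1 / D) * t + (- 2)) - ((- 1 / D) * u + (- 2)) = - ((t - u) / D)"
      by (simp add: diff_divide_distrib)
    also have "D * (\<bar>(t - u) / D\<bar> + \<bar>- ((t - u) / D)\<bar>) = 2 * \<bar>t - u\<bar>" using D by simp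
    finally show ?thesis .
  qed
  \<comment> \<open>The error \<open>D\<close> of the approximation plus the error
    \<open>2 * D\<close> of the thresholding; the Lipschitz constant only doubles.\<close>
  have D3: "3 * D > 0" using D by simp
  show thesis
  proof (rule that[OF D3], intro allI impI, elim conjE)
    fix f :: "'a \<Rightarrow> real" and r M :: real
    assume r: "r > 0" and M: "M > 0" and "\<forall>x y. norm (x - y) \<le> r \<longrightarrow> \<bar>f x - f y\<bar> \<le> M"
    then have f: "\<And>x y. norm (x - y) \<le> r \<Longrightarrow> \<bar>f x - f y\<bar> \<le> M" by blast
    define f1 where "f1 x = f (r *\<^sub>R x) / M" for x
    have "\<bar>f1 x - f1 y\<bar> \<le> 1" if "norm (x - y) \<le> 1" for x y
    proof -
      have "norm (r *\<^sub>R x - r *\<^sub>R y) \<le> r"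
        using that r by (simp flip: scaleR_diff_right)
      from f[OF this] show ?thesis using M by (simp add: f1_def flip: diff_divide_distrib)
    qed
    then have "\<bar>f1 x - f1 y\<bar> \<le> norm (x - y) + 1" for x y
      by (rule coarse_lipschitz_from_unit_scale)
    from approx[OF this] obtain g1 where g1: "g1 \<in> C_class k" "\<And>x y. \<bar>g1 x - g1 y\<bar> \<le> D * norm (x - y)" "\<And>x. \<bar>f1 x - g1 x\<bar> \<le> D"
      by blast
    define g where "g x = M * s (g1 ((1 / r) *\<^sub>R x + 0))" for x
    have "g \<in> C_class k"
      unfolding g_def[abs_def] s_def
      by (intro C_class_scale C_class_diff C_class_ramp C_class_add C_class_const C_class_affine g1)
    moreover have "\<bar>g x - g y\<bar> \<le> 3 * D * M / r * norm (x - y)" for x y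
    proof -
      have "\<bar>g x - g y\<bar> = M * \<bar>s (g1 ((1 / r) *\<^sub>R x)) - s (g1 ((1 / r) *\<^sub>R y))\<bar>"
        using M by (simp add: g_def abs_mult flip: right_diff_distrib)
      also have "\<dots> \<le> M * (2 * (D * norm ((1 / r) *\<^sub>R x - (1 / r) *\<^sub>R y)))"
        using M s_lip[of "g1 ((1 / r) *\<^sub>R x)" "g1 ((1 / r) *\<^sub>R y)"] g1(2)[of "(1 / r) *\<^sub>R x" "(1 / r) *\<^sub>R y"]
        by (intro mult_left_mono) auto
      also have "(1 / r) *\<^sub>R x - (1 / r) *\<^sub>R y = (1 / r) *\<^sub>R (x - y)" by (simp add: scaleR_diff_right)
      also have "M * (2 * (D * norm ((1 / r) *\<^sub>R (x - y)))) = 2 * (D * M / r * norm (x - y))"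
        using r by simp
      also have "\<dots> \<le> 3 * (D * M / r * norm (x - y))"
        using r D M by (intro mult_right_mono) auto
      finally show ?thesis by simp
    qed
    moreover have "\<bar>f x - g x\<bar> \<le> 3 * D * M" for x
    proof -
      define y where "y = (1 / r) *\<^sub>R x"
      have "f x - g x = M * (f1 y - s (g1 y))"
        using M r by (simp add: g_def f1_def y_def field_simps)
      then have "\<bar>f x - g x\<bar> = M * \<bar>f1 y - s (g1 y)\<bar>" using M by (simp add: abs_mult)
      also have "\<dots> \<le> M * (3 * D)"
        using M s_near[of "g1 y"] g1(3)[of y] by (intro mult_left_mono) linarith+
      finally show ?thesis by (simp add: mult_ac)
    qed
    moreover have "g x = 0" if "f x = 0" for x
      using g1(3)[of "(1 / r) *\<^sub>R x"] that r s_zero[of "g1 ((1 / r) *\<^sub>R x)"] by (simp add: g_def f1_def)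
    ultimately show "\<exists>g \<in> C_class k. (\<forall>x y. \<bar>g x - g y\<bar> \<le> 3 * D * M / r * norm (x - y)) \<and>
      (\<forall>x. \<bar>f x - g x\<bar> \<le> 3 * D * M) \<and> (\<forall>x. f x = 0 \<longrightarrow> g x = 0)"
      by blast
  qed
qed

section \<open>Vanishing oscillation\<close>

lemma tendsto_ennreal_0_iff:
  fixes F :: "'b \<Rightarrow> ennreal"
  shows "(F \<longlongrightarrow> 0) net \<longleftrightarrow> (\<forall>e>0. \<forall>\<^sub>F x in net. F x \<le> ennreal e)"
proof
  assume "(F \<longlongrightarrow> 0) net"
  then show "\<forall>e>0. \<forall>\<^sub>F x in net. F x \<le> ennreal e"
    by (auto dest!: order_tendstoD(2)[where a="ennreal _"] elim!: eventually_mono)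
next
  assume e: "\<forall>e>0. \<forall>\<^sub>F x in net. F x \<le> ennreal e"
  show "(F \<longlongrightarrow> 0) net"
  proof (rule order_tendstoI)
    fix a :: ennreal assume "0 < a"
    then obtain b where b: "0 < b" "b < a" using dense by blast
    then have "b < top" using less_le_trans top_greatest by blast
    with b(1) obtain r where "b = ennreal r" "r > 0"
      by (cases b) (auto simp: ennreal_less_zero_iff)
    with e have "\<forall>\<^sub>F x in net. F x \<le> b" by blast
    then show "\<forall>\<^sub>F x in net. F x < a"
      by (rule eventually_mono) (use b(2) in \<open>auto intro: order_le_less_trans\<close>)
  qed auto
qed

lemma Lip_iff: "g \<in> Lip \<longleftrightarrow> (\<exists>L\<ge>0. \<forall>x y. \<bar>g x - g y\<bar> \<le> L * norm (x - y))"
  by (auto simp: Lip_def lipschitz_on_def dist_norm)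

lemma bounded_support_bounded:
  assumes "g \<in> Lip" "\<And>x. x \<notin> ball 0 R \<Longrightarrow> g x = 0"
  obtains B :: real where "B \<ge> 0" "\<And>x. \<bar>g x\<bar> \<le> B"
proof -
  obtain L where L: "L \<ge> 0" "\<And>x y. \<bar>g x - g y\<bar> \<le> L * norm (x - y)"
    using assms(1) Lip_iff by blast
  have "\<bar>g x\<bar> \<le> \<bar>g 0\<bar> + L * \<bar>R\<bar>" for x
  proof (cases "x \<in> ball 0 R")
    case True
    then have "L * norm (x - 0) \<le> L * \<bar>R\<bar>" using L by (intro mult_left_mono) auto
    with L(2)[of x 0] show ?thesis by linarith
  qed (use assms(2) L in simp)
  with L(1) show thesis by (intro that[of "\<bar>g 0\<bar> + L * \<bar>R\<bar>"]) auto
qed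

locale vanishing_modulus =
  fixes \<omega> :: "real \<Rightarrow> real"
  assumes pos: "t > 0 \<Longrightarrow> \<omega> t > 0"
    and mono: "mono_on {0<..} \<omega>"
    and infinity: "filterlim \<omega> at_top at_top"
    and ratio: "((\<lambda>t. t / \<omega> t) \<longlongrightarrow> 0) (at_right 0)"
begin

section \<open>Suprema as pointwise estimates\<close>

lemma osc_le_iff:
  assumes "x \<noteq> y"
  shows "osc \<omega> x y f \<le> e \<longleftrightarrow> \<bar>f x - f y\<bar> \<le> e * \<omega> (norm (x - y))"
  using pos[of "norm (x - y)"] assms by (simp add: osc_def pos_divide_le_eq)

lemma holder_seminorm_le_iff:
  assumes "e \<ge> 0"
  shows "holder_seminorm \<omega> f \<le> ennreal e \<longleftrightarrow>
    (\<forall>x y. x \<noteq> y \<longrightarrow> \<bar>f x - f y\<bar> \<le> e * \<omega> (norm (x - y)))"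
  using assms
  by (auto simp: holder_seminorm_def SUP_le_iff ennreal_le_iff osc_le_iff)

lemma osc_scale_le_iff:
  assumes "e \<ge> 0" "\<delta> > 0"
  shows "osc_scale \<omega> \<delta> f \<le> ennreal e \<longleftrightarrow>
    (\<forall>x y. norm (x - y) = \<delta> \<longrightarrow> \<bar>f x - f y\<bar> \<le> e * \<omega> \<delta>)"
  using assms pos[OF assms(2)]
  by (auto simp: osc_scale_def osc_def SUP_le_iff ennreal_le_iff pos_divide_le_eq)

lemma osc_far_le_iff:
  assumes "e \<ge> 0"
  shows "osc_far \<omega> \<delta> f \<le> ennreal e \<longleftrightarrow>
    (\<forall>x y. x \<noteq> y \<and> norm x > \<delta> \<and> norm y > \<delta> \<longrightarrow> \<bar>f x - f y\<bar> \<le> e * \<omega> (norm (x - y)))"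
  using assms
  by (auto simp: osc_far_def SUP_le_iff ennreal_le_iff osc_le_iff)

lemma holder_space_iff:
  shows "f \<in> holder_space \<omega> \<longleftrightarrow>
    (\<exists>K\<ge>0. \<forall>x y. x \<noteq> y \<longrightarrow> \<bar>f x - f y\<bar> \<le> K * \<omega> (norm (x - y)))"
proof
  assume "f \<in> holder_space \<omega>"
  then have "holder_seminorm \<omega> f < top" by (simp add: holder_space_def)
  then obtain K where "K \<ge> 0" "holder_seminorm \<omega> f = ennreal K"
    by (cases "holder_seminorm \<omega> f") auto
  then have "holder_seminorm \<omega> f \<le> ennreal K" by simp
  with \<open>K \<ge> 0\<close> show "\<exists>K\<ge>0. \<forall>x y. x \<noteq> y \<longrightarrow> \<bar>f x - f y\<bar> \<le> K * \<omega> (norm (x - y))"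
    using holder_seminorm_le_iff by blast
next
  assume "\<exists>K\<ge>0. \<forall>x y. x \<noteq> y \<longrightarrow> \<bar>f x - f y\<bar> \<le> K * \<omega> (norm (x - y))"
  then obtain K where "holder_seminorm \<omega> f \<le> ennreal K"
    using holder_seminorm_le_iff by blast
  then show "f \<in> holder_space \<omega>"
    by (simp add: holder_space_def) (meson ennreal_less_top order_le_less_trans)
qed

lemma VC_small_iff:
  shows "f \<in> VC_small \<omega> \<longleftrightarrow> f \<in> holder_space \<omega> \<and>
    (\<forall>e>0. \<exists>d>0. \<forall>x y. x \<noteq> y \<and> norm (x - y) < d \<longrightarrow> \<bar>f x - f y\<bar> \<le> e * \<omega> (norm (x - y)))"
proof -
  have "(\<forall>\<^sub>F \<delta> in at_right 0. osc_scale \<omega> \<delta> f \<le> ennreal e) \<longleftrightarrow>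
      (\<exists>d>0. \<forall>x y. x \<noteq> y \<and> norm (x - y) < d \<longrightarrow> \<bar>f x - f y\<bar> \<le> e * \<omega> (norm (x - y)))" (is "?L \<longleftrightarrow> ?R")
    if e: "e > 0" for e
  proof
    assume ?L
    then obtain d where "d > 0" and d: "\<And>\<delta>. \<delta> > 0 \<Longrightarrow> \<delta> < d \<Longrightarrow> osc_scale \<omega> \<delta> f \<le> ennreal e"
      unfolding eventually_at_right_field by blast
    have "\<bar>f x - f y\<bar> \<le> e * \<omega> (norm (x - y))" if "x \<noteq> y" "norm (x - y) < d" for x y
      using d[OF _ that(2)] that osc_scale_le_iff[of e "norm (x - y)" f] e by simp
    with \<open>d > 0\<close> show ?R by blast
  next
    assume ?R
    then obtain d where "d > 0"
      and d: "\<And>x y. x \<noteq> y \<Longrightarrow> norm (x - y) < d \<Longrightarrow> \<bar>f x - f y\<bar> \<le> e * \<omega> (norm (x - y))" by blast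
    have "osc_scale \<omega> \<delta> f \<le> ennreal e" if \<delta>: "\<delta> > 0" "\<delta> < d" for \<delta>
      unfolding osc_scale_le_iff[OF less_imp_le[OF e] \<delta>(1)]
    proof (intro allI impI)
      fix x y :: 'a assume "norm (x - y) = \<delta>"
      with d[of x y] \<delta> show "\<bar>f x - f y\<bar> \<le> e * \<omega> \<delta>" by auto
    qed
    with \<open>d > 0\<close> show ?L unfolding eventually_at_right_field by blast
  qed
  then show ?thesis by (simp add: VC_small_def tendsto_ennreal_0_iff)
qed

lemma VC_large_iff:
  shows "f \<in> VC_large \<omega> \<longleftrightarrow> f \<in> holder_space \<omega> \<and>
    (\<forall>e>0. \<exists>N. \<forall>x y. x \<noteq> y \<and> norm (x - y) > N \<longrightarrow> \<bar>f x - f y\<bar> \<le> e * \<omega> (norm (x - y)))"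
proof -
  have "(\<forall>\<^sub>F \<delta> in at_top. osc_scale \<omega> \<delta> f \<le> ennreal e) \<longleftrightarrow>
      (\<exists>N. \<forall>x y. x \<noteq> y \<and> norm (x - y) > N \<longrightarrow> \<bar>f x - f y\<bar> \<le> e * \<omega> (norm (x - y)))" (is "?L \<longleftrightarrow> ?R")
    if e: "e > 0" for e
  proof
    assume ?L
    then obtain N where N: "\<And>\<delta>. \<delta> > N \<Longrightarrow> osc_scale \<omega> \<delta> f \<le> ennreal e"
      unfolding eventually_at_top_dense by blast
    have "\<bar>f x - f y\<bar> \<le> e * \<omega> (norm (x - y))" if "x \<noteq> y" "norm (x - y) > N" for x y
      using N[OF that(2)] that osc_scale_le_iff[of e "norm (x - y)" f] e by simp
    then show ?R by blast
  next
    assume ?R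
    then obtain N where N: "\<And>x y. x \<noteq> y \<Longrightarrow> norm (x - y) > N \<Longrightarrow> \<bar>f x - f y\<bar> \<le> e * \<omega> (norm (x - y))"
      by blast
    have "osc_scale \<omega> \<delta> f \<le> ennreal e" if "\<delta> > max N 0" for \<delta>
    proof -
      have \<delta>: "\<delta> > 0" using that by simp
      show ?thesis
        unfolding osc_scale_le_iff[OF less_imp_le[OF e] \<delta>]
      proof (intro allI impI)
        fix x y :: 'a assume "norm (x - y) = \<delta>"
        with N[of x y] that show "\<bar>f x - f y\<bar> \<le> e * \<omega> \<delta>" by auto
      qed
    qed
    then show ?L unfolding eventually_at_top_dense by blast
  qed
  then show ?thesis by (simp add: VC_large_def tendsto_ennreal_0_iff)
qed

lemma VC_far_iff:
  shows "f \<in> VC_far \<omega> \<longleftrightarrow> f \<in> holder_space \<omega> \<and>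
    (\<forall>e>0. \<exists>N. \<forall>x y. x \<noteq> y \<and> norm x > N \<and> norm y > N \<longrightarrow> \<bar>f x - f y\<bar> \<le> e * \<omega> (norm (x - y)))"
proof -
  have "(\<forall>\<^sub>F \<delta> in at_top. osc_far \<omega> \<delta> f \<le> ennreal e) \<longleftrightarrow>
      (\<exists>N. \<forall>x y. x \<noteq> y \<and> norm x > N \<and> norm y > N \<longrightarrow> \<bar>f x - f y\<bar> \<le> e * \<omega> (norm (x - y)))"
    (is "?L \<longleftrightarrow> ?R") if e: "e > 0" for e
  proof
    assume ?L
    \<comment> \<open>\<open>osc_far\<close> decreases as its threshold grows, so one threshold says
      as much as all large ones.\<close>
    then obtain N where "osc_far \<omega> N f \<le> ennreal e" unfolding eventually_at_top_linorder by blast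
    then show ?R unfolding osc_far_le_iff[OF less_imp_le[OF e]] by blast
  next
    assume ?R
    then obtain N where "\<And>x y. x \<noteq> y \<Longrightarrow> norm x > N \<Longrightarrow> norm y > N \<Longrightarrow> \<bar>f x - f y\<bar> \<le> e * \<omega> (norm (x - y))"
      by blast
    then have "osc_far \<omega> \<delta> f \<le> ennreal e" if "\<delta> \<ge> N" for \<delta>
      unfolding osc_far_le_iff[OF less_imp_le[OF e]] using that by simp
    then show ?L unfolding eventually_at_top_linorder by blast
  qed
  then show ?thesis by (simp add: VC_far_def tendsto_ennreal_0_iff)
qed

lemma holder_closure_iff:
  shows "f \<in> holder_closure \<omega> C \<longleftrightarrow> f \<in> holder_space \<omega> \<and>
    (\<forall>e>0. \<exists>g\<in>C. \<forall>x y. x \<noteq> y \<longrightarrow> \<bar>(g x - f x) - (g y - f y)\<bar> \<le> e * \<omega> (norm (x - y)))"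
proof -
  have "(\<exists>F. (\<forall>n::nat. F n \<in> C) \<and> (\<lambda>n. holder_seminorm \<omega> (\<lambda>x. F n x - f x)) \<longlonglongrightarrow> 0) \<longleftrightarrow>
      (\<forall>e>0. \<exists>g\<in>C. holder_seminorm \<omega> (\<lambda>x. g x - f x) \<le> ennreal e)" (is "?L \<longleftrightarrow> ?R")
  proof
    assume ?L
    then obtain F where F: "\<And>n::nat. F n \<in> C" "(\<lambda>n. holder_seminorm \<omega> (\<lambda>x. F n x - f x)) \<longlonglongrightarrow> 0" by blast
    show ?R
    proof (intro allI impI)
      fix e :: real assume "e > 0"
      with F(2) have "\<forall>\<^sub>F n in sequentially. holder_seminorm \<omega> (\<lambda>x. F n x - f x) \<le> ennreal e"
        by (simp add: tendsto_ennreal_0_iff)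
      then obtain n where "holder_seminorm \<omega> (\<lambda>x. F n x - f x) \<le> ennreal e"
        using eventually_happens by fastforce
      with F(1) show "\<exists>g\<in>C. holder_seminorm \<omega> (\<lambda>x. g x - f x) \<le> ennreal e" by blast
    qed
  next
    assume R: ?R
    have "\<forall>n::nat. \<exists>g. g \<in> C \<and> holder_seminorm \<omega> (\<lambda>x. g x - f x) \<le> ennreal (inverse (real (Suc n)))"
    proof
      fix n
      have "inverse (real (Suc n)) > 0" by simp
      then show "\<exists>g. g \<in> C \<and> holder_seminorm \<omega> (\<lambda>x. g x - f x) \<le> ennreal (inverse (real (Suc n)))"
        using R by blast
    qed
    from choice[OF this] obtain F where F: "\<And>n. F n \<in> C"
      "\<And>n. holder_seminorm \<omega> (\<lambda>x. F n x - f x) \<le> ennreal (inverse (real (Suc n)))" by blast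
    have "(\<lambda>n. ennreal (inverse (real (Suc n)))) \<longlonglongrightarrow> 0"
      using tendsto_ennrealI[OF LIMSEQ_inverse_real_of_nat] by simp
    then have "(\<lambda>n. holder_seminorm \<omega> (\<lambda>x. F n x - f x)) \<longlonglongrightarrow> 0"
      by (rule tendsto_sandwich[where f="\<lambda>_. 0", OF _ _ tendsto_const, rotated -1])
        (auto intro!: always_eventually F(2) simp del: of_nat_Suc)
    with F(1) show ?L by blast
  qed
  then show ?thesis
    by (simp add: holder_closure_def holder_seminorm_le_iff)
qed

section \<open>The ratio of \<open>t\<close> to \<open>\<omega> t\<close>\<close>

lemma ratio_small:
  assumes "c > 0"
  obtains d where "d > 0" "\<And>t. 0 < t \<Longrightarrow> t < d \<Longrightarrow> t \<le> c * \<omega> t"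
proof -
  have "\<forall>\<^sub>F t in at_right 0. t / \<omega> t < c" using ratio assms by (rule order_tendstoD(2))
  then obtain d where "d > 0" and d: "\<And>t. 0 < t \<Longrightarrow> t < d \<Longrightarrow> t / \<omega> t < c"
    unfolding eventually_at_right_field by blast
  then show thesis using that[of d] pos by (auto simp: pos_divide_less_eq less_imp_le)
qed

text \<open>Near 0 this is the limit of the ratio; away from 0 monotonicity keeps
  \<open>\<omega> t\<close> above some \<open>\<omega> d > 0\<close>, without any continuity of
  \<open>\<omega>\<close>.\<close>

lemma ratio_bounded:
  obtains B where "B > 0" "\<And>t. 0 < t \<Longrightarrow> t \<le> T \<Longrightarrow> t \<le> B * \<omega> t"
proof -
  obtain d where d: "d > 0" "\<And>t. 0 < t \<Longrightarrow> t < d \<Longrightarrow> t \<le> 1 * \<omega> t"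
    using ratio_small[OF zero_less_one] by blast
  define B where "B = 1 + \<bar>T\<bar> / \<omega> d"
  have B: "B \<ge> 1" "B * \<omega> d \<ge> \<bar>T\<bar>" using pos[OF d(1)] by (auto simp: B_def field_simps)
  show thesis
  proof (rule that[of B])
    fix t :: real assume t: "0 < t" "t \<le> T"
    show "t \<le> B * \<omega> t"
    proof (cases "t < d")
      case True
      then have "t \<le> 1 * \<omega> t" using d(2) t by simp
      also have "\<dots> \<le> B * \<omega> t" using B pos[OF t(1)] by (intro mult_right_mono) auto
      finally show ?thesis .
    next
      case False
      then have "\<omega> d \<le> \<omega> t" using d(1) by (intro mono_onD[OF mono]) auto
      then have "B * \<omega> d \<le> B * \<omega> t" using B by (intro mult_left_mono) auto
      with B t show ?thesis by linarith
    qed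
  qed (use B in simp)
qed

text \<open>Below the smoothing scale \<open>r\<close> the smoothed function oscillates like \<open>\<omega> r / r * t\<close>.  As \<open>\<omega> t / t\<close> need not
  be almost decreasing, \<open>r\<close> has to be chosen for this to be \<open>O(\<omega> t)\<close>.\<close>
lemma almost_minimal_ratio:
  assumes "\<delta> > 0"
  obtains r where "0 < r" "r \<le> \<delta>" "\<And>t. 0 < t \<Longrightarrow> t \<le> r \<Longrightarrow> \<omega> r / r * t \<le> 2 * \<omega> t"
proof -
  obtain B where B: "B > 0" "\<And>t. 0 < t \<Longrightarrow> t \<le> \<delta> \<Longrightarrow> t \<le> B * \<omega> t"
    using ratio_bounded[where T=\<delta>] by blast
  \<comment> \<open>The infimum is positive by \<open>ratio_bounded\<close> but need not be
    attained, since \<open>\<omega>\<close> may jump; accepting twice the infimum yields the factor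
    2.\<close>
  define m where "m = (INF t\<in>{0<..\<delta>}. \<omega> t / t)"
  have ne: "{0<..\<delta>} \<noteq> {}" using \<open>\<delta> > 0\<close> by simp
  have lower: "1 / B \<le> \<omega> t / t" if "t \<in> {0<..\<delta>}" for t
    using B(1) B(2)[of t] that by (simp add: field_simps)
  have "1 / B \<le> m" unfolding m_def by (rule cINF_greatest[OF ne lower])
  moreover have "0 < 1 / B" using B(1) by simp
  ultimately have "m > 0" by linarith
  then have "m < 2 * m" by simp
  moreover have bdd: "bdd_below ((\<lambda>t. \<omega> t / t) ` {0<..\<delta>})" by (rule bdd_belowI2[OF lower])
  ultimately obtain r where r: "r \<in> {0<..\<delta>}" "\<omega> r / r < 2 * m"
    unfolding m_def cINF_less_iff[OF ne bdd] by blast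
  show thesis
  proof (rule that[of r])
    fix t :: real assume t: "0 < t" "t \<le> r"
    have "m \<le> \<omega> t / t" unfolding m_def using t r(1) by (intro cINF_lower[OF bdd]) auto
    with r(2) have "\<omega> r / r \<le> 2 * (\<omega> t / t)" by linarith
    then have "\<omega> r / r * t \<le> 2 * (\<omega> t / t) * t" using t by (intro mult_right_mono) auto
    with t show "\<omega> r / r * t \<le> 2 * \<omega> t" by simp
  qed (use r in auto)
qed

section \<open>Closures lie in the vanishing classes\<close>

lemma closure_Lip_subset_VC_small:
  fixes C :: "('a::real_normed_vector \<Rightarrow> real) set"
  assumes C: "C \<subseteq> Lip"
  shows "holder_closure \<omega> C \<subseteq> VC_small \<omega>"
proof
  fix f assume f: "f \<in> holder_closure \<omega> C"
  show "f \<in> VC_small \<omega>"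
    unfolding VC_small_iff
  proof (intro conjI allI impI)
    show "f \<in> holder_space \<omega>" using f by (simp add: holder_closure_def)
    fix e :: real assume e: "e > 0"
    then have "e/2 > 0" by simp
    then obtain g where g: "g \<in> C"
      "\<And>x y. x \<noteq> y \<Longrightarrow> \<bar>(g x - f x) - (g y - f y)\<bar> \<le> e/2 * \<omega> (norm (x - y))"
      using f unfolding holder_closure_iff by blast
    obtain L where L: "L \<ge> 0" "\<And>x y. \<bar>g x - g y\<bar> \<le> L * norm (x - y)"
      using C g(1) Lip_iff by blast
    \<comment> \<open>At small distances \<open>L * t\<close> is a small multiple of
      \<open>\<omega> t\<close>, so the Lipschitz approximant uses half of \<open>e\<close> and the
      approximation error the other half.\<close>
    have "e / (2 * (L + 1)) > 0" using e L by simp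
    then obtain d where d: "d > 0" "\<And>t. 0 < t \<Longrightarrow> t < d \<Longrightarrow> t \<le> e / (2 * (L + 1)) * \<omega> t"
      using ratio_small by blast
    have "\<bar>f x - f y\<bar> \<le> e * \<omega> (norm (x - y))" if "x \<noteq> y \<and> norm (x - y) < d" for x y
    proof -
      define t where "t = norm (x - y)"
      have t: "0 < t" "t < d" using that by (auto simp: t_def)
      have "L * t \<le> (L + 1) * t" using t by simp
      also have "\<dots> \<le> (L + 1) * (e / (2 * (L + 1)) * \<omega> t)" using d(2)[OF t] L by (intro mult_left_mono) auto
      also have "\<dots> = e/2 * \<omega> t"
      proof -
        have "c * (e / (2 * c) * W) = e/2 * W" if "c \<noteq> 0" for c W :: real using that by simp
        from this[of "L + 1"] L(1) show ?thesis by (metis add_nonneg_pos less_irrefl zero_less_one)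
      qed
      finally have "\<bar>g x - g y\<bar> \<le> e/2 * \<omega> t" using L(2)[of x y] by (simp add: t_def)
      moreover have "\<bar>(g x - f x) - (g y - f y)\<bar> \<le> e/2 * \<omega> t" using g(2) that by (simp add: t_def)
      moreover have "e * \<omega> t = e/2 * \<omega> t + e/2 * \<omega> t" by simp
      ultimately show ?thesis unfolding t_def[symmetric] by linarith
    qed
    with d(1) show "\<exists>d>0. \<forall>x y. x \<noteq> y \<and> norm (x - y) < d \<longrightarrow> \<bar>f x - f y\<bar> \<le> e * \<omega> (norm (x - y))"
      by blast
  qed
qed

text \<open>At large distances a bounded approximant is negligible because \<open>\<omega>\<close>
  tends to infinity. Far from the origin it vanishes, and \<open>f\<close> oscillates there only by
  the approximation error.\<close>

lemma closure_bounded_support_subset_VC: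
  fixes C :: "('a::real_normed_vector \<Rightarrow> real) set"
  assumes C: "C \<subseteq> Lip" "\<And>g. g \<in> C \<Longrightarrow> \<exists>R. \<forall>x. x \<notin> ball 0 R \<longrightarrow> g x = 0"
  shows "holder_closure \<omega> C \<subseteq> VC \<omega>"
proof
  fix f assume f: "f \<in> holder_closure \<omega> C"
  then have fh: "f \<in> holder_space \<omega>" by (simp add: holder_closure_def)
  have approx: "\<exists>g\<in>C. \<forall>x y. x \<noteq> y \<longrightarrow> \<bar>(g x - f x) - (g y - f y)\<bar> \<le> e * \<omega> (norm (x - y))" if "e > 0" for e
    using f that unfolding holder_closure_iff by blast
  have "f \<in> VC_large \<omega>"
    unfolding VC_large_iff
  proof (intro conjI allI impI fh)
    fix e :: real assume e: "e > 0"
    then obtain g where g: "g \<in> C"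
      "\<And>x y. x \<noteq> y \<Longrightarrow> \<bar>(g x - f x) - (g y - f y)\<bar> \<le> e/2 * \<omega> (norm (x - y))"
      using approx[of "e/2"] by auto
    obtain B where B: "B \<ge> 0" "\<And>x. \<bar>g x\<bar> \<le> B"
      using bounded_support_bounded[of g] C g(1) by (metis subsetD)
    have "\<forall>\<^sub>F t in at_top. 4 * B / e \<le> \<omega> t" using infinity by (simp add: filterlim_at_top)
    then obtain N where N: "\<And>t. t > N \<Longrightarrow> 4 * B / e \<le> \<omega> t"
      unfolding eventually_at_top_dense by blast
    have "\<bar>f x - f y\<bar> \<le> e * \<omega> (norm (x - y))" if "x \<noteq> y \<and> norm (x - y) > N" for x y
    proof -
      define W where "W = \<omega> (norm (x - y))"
      have "2 * B \<le> e/2 * W" using N[of "norm (x - y)"] that e by (simp add: W_def field_simps)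
      then have "\<bar>g x - g y\<bar> \<le> e/2 * W" using B(2)[of x] B(2)[of y] by linarith
      moreover have "\<bar>(g x - f x) - (g y - f y)\<bar> \<le> e/2 * W" using g(2) that by (simp add: W_def)
      moreover have "e * W = e/2 * W + e/2 * W" by simp
      ultimately show ?thesis unfolding W_def[symmetric] by linarith
    qed
    then show "\<exists>N. \<forall>x y. x \<noteq> y \<and> norm (x - y) > N \<longrightarrow> \<bar>f x - f y\<bar> \<le> e * \<omega> (norm (x - y))"
      by blast
  qed
  moreover have "f \<in> VC_far \<omega>"
    unfolding VC_far_iff
  proof (intro conjI allI impI fh)
    fix e :: real assume e: "e > 0"
    then obtain g where g: "g \<in> C"
      "\<And>x y. x \<noteq> y \<Longrightarrow> \<bar>(g x - f x) - (g y - f y)\<bar> \<le> e * \<omega> (norm (x - y))"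
      using approx[of e] by auto
    obtain R where "\<And>x. x \<notin> ball 0 R \<Longrightarrow> g x = 0" using C(2)[OF g(1)] by blast
    then have "\<bar>f x - f y\<bar> \<le> e * \<omega> (norm (x - y))" if "x \<noteq> y \<and> norm x > R \<and> norm y > R" for x y
      using g(2)[of x y] that by simp
    then show "\<exists>N. \<forall>x y. x \<noteq> y \<and> norm x > N \<and> norm y > N \<longrightarrow> \<bar>f x - f y\<bar> \<le> e * \<omega> (norm (x - y))"
      by blast
  qed
  moreover have "f \<in> VC_small \<omega>"
    using closure_Lip_subset_VC_small[OF C(1)] f by blast
  ultimately show "f \<in> VC \<omega>" by (simp add: VC_def)
qed

text \<open>The cut-off is the median of \<open>- w\<close>, \<open>f - f 0\<close> and \<open>w\<close> for a cone \<open>w\<close> so wide that its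
  oscillation is negligible at every scale.\<close>
lemma bounded_support_approximation:
  fixes f :: "'a::real_normed_vector \<Rightarrow> real"
  assumes f: "f \<in> VC_large \<omega>" "f \<in> VC_far \<omega>" and \<eta>: "\<eta> > 0"
  obtains h where "\<exists>R. \<forall>x. x \<notin> ball 0 R \<longrightarrow> h x = 0"
    "\<And>x y. x \<noteq> y \<Longrightarrow> \<bar>(h x - f x) - (h y - f y)\<bar> \<le> 2 * \<eta> * \<omega> (norm (x - y))"
    "\<And>x y. x \<noteq> y \<Longrightarrow> \<bar>f x - f y\<bar> \<le> \<eta> * \<omega> (norm (x - y)) \<Longrightarrow> \<bar>h x - h y\<bar> \<le> \<eta> * \<omega> (norm (x - y))"
proof -
  obtain K where K: "K \<ge> 0" "\<And>x y. x \<noteq> y \<Longrightarrow> \<bar>f x - f y\<bar> \<le> K * \<omega> (norm (x - y))"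
    using f(1) holder_space_iff[of f] by (auto simp: VC_large_def)
  obtain \<Delta> where \<Delta>: "\<And>x y. x \<noteq> y \<Longrightarrow> norm (x - y) > \<Delta> \<Longrightarrow> \<bar>f x - f y\<bar> \<le> \<eta> * \<omega> (norm (x - y))"
    using VC_large_iff[THEN iffD1, OF f(1), THEN conjunct2, rule_format, OF \<eta>] by blast
  obtain N where N: "\<And>x y. x \<noteq> y \<Longrightarrow> norm x > N \<Longrightarrow> norm y > N \<Longrightarrow> \<bar>f x - f y\<bar> \<le> \<eta> * \<omega> (norm (x - y))"
    using VC_far_iff[THEN iffD1, OF f(2), THEN conjunct2, rule_format, OF \<eta>] by blast
  \<comment> \<open>A point outside the ball of radius \<open>N1\<close> is either paired with a
    point beyond \<open>N\<close>, or more than \<open>\<Delta>\<close> away from its partner. Hence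
    \<open>f\<close> has small oscillation on every pair not contained in that ball.\<close>
  define N1 where "N1 = \<bar>N\<bar> + \<bar>\<Delta>\<bar> + 1"
  have N1: "N1 > 0" "N \<le> N1" "N1 - N > \<Delta>" by (auto simp: N1_def)
  \<comment> \<open>The height of the cone: \<open>f - f 0\<close> passes uncut on the ball of
    radius \<open>N1\<close>.\<close>
  define A where "A = K * \<omega> N1 + 1"
  have A: "A > 0" using K(1) pos[OF N1(1)] by (simp add: A_def add_nonneg_pos)
  have f_le_A: "\<bar>f x - f 0\<bar> \<le> A" if "norm x \<le> N1" for x
  proof (cases "x = 0")
    case False
    then have "\<bar>f x - f 0\<bar> \<le> K * \<omega> (norm x)" using K(2)[of x 0] by simp
    also have "\<dots> \<le> K * \<omega> N1"
      using False that K(1) N1(1) by (intro mult_left_mono mono_onD[OF mono]) auto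
    finally show ?thesis by (simp add: A_def)
  qed (use A in simp)
  have "\<forall>\<^sub>F t in at_top. A / \<eta> \<le> \<omega> t" using infinity by (simp add: filterlim_at_top)
  then obtain T where T: "\<And>t. t > T \<Longrightarrow> A / \<eta> \<le> \<omega> t"
    unfolding eventually_at_top_dense by blast
  obtain B where B: "B > 0" "\<And>t. 0 < t \<Longrightarrow> t \<le> T \<Longrightarrow> t \<le> B * \<omega> t"
    using ratio_bounded[where T=T] by blast
  \<comment> \<open>\<open>N1 \<le> \<rho>\<close> puts the ball of radius \<open>N1\<close> on the
    plateau, and the other bound makes the slope \<open>A / \<rho>\<close> at most
    \<open>\<eta> / B\<close>, enough for distances up to \<open>T\<close>. Beyond \<open>T\<close>
    the height \<open>A\<close> itself is small against \<open>\<omega>\<close>.\<close>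
  define \<rho> where "\<rho> = max N1 (A * B / \<eta>)"
  have \<rho>: "\<rho> > 0" "N1 \<le> \<rho>" "A * B / \<eta> \<le> \<rho>" using N1 by (auto simp: \<rho>_def)
  define w where "w x = A * max 0 (min 1 (2 - norm x / \<rho>))" for x :: 'a
  have w_inner: "w x = A" if "norm x \<le> N1" for x
  proof -
    have "norm x / \<rho> \<le> 1" using that \<rho> by (simp add: field_simps)
    then show ?thesis by (simp add: w_def)
  qed
  have w_outer: "w x = 0" if "norm x \<ge> 2 * \<rho>" for x
    using that \<rho> by (simp add: w_def field_simps)
  have w_nonneg: "w x \<ge> 0" for x using A by (simp add: w_def)
  have w_osc: "\<bar>w x - w y\<bar> \<le> \<eta> * \<omega> (norm (x - y))" if "x \<noteq> y" for x y
  proof (cases "norm (x - y) > T")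
    case True
    have "w z \<le> A" for z
      using A mult_left_mono[of "max 0 (min 1 (2 - norm z / \<rho>))" 1 A] by (simp add: w_def)
    then have "\<bar>w x - w y\<bar> \<le> A"
      using w_nonneg[of x] w_nonneg[of y] unfolding abs_le_iff by (smt (verit))
    also have "\<dots> \<le> \<eta> * \<omega> (norm (x - y))" using T[OF True] \<eta> by (simp add: field_simps)
    finally show ?thesis .
  next
    case False
    define t where "t = norm (x - y)"
    have t: "0 < t" "t \<le> T" using that False by (auto simp: t_def)
    have "\<bar>max 0 (min 1 (2 - a)) - max 0 (min 1 (2 - b))\<bar> \<le> \<bar>a - b\<bar>" for a b :: real by linarith
    then have "\<bar>w x - w y\<bar> \<le> A * \<bar>norm x / \<rho> - norm y / \<rho>\<bar>"
      unfolding w_def right_diff_distrib[symmetric] abs_mult using A by (intro mult_mono) auto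
    also have "\<dots> = A * (\<bar>norm x - norm y\<bar> / \<rho>)"
      using \<rho>(1) by (simp flip: diff_divide_distrib)
    also have "\<dots> \<le> A * (t / \<rho>)"
      using A \<rho>(1) norm_triangle_ineq3[of x y] by (intro mult_left_mono divide_right_mono) (auto simp: t_def)
    also have "\<dots> \<le> A * (B * \<omega> t / \<rho>)"
      using A B(2)[OF t] \<rho>(1) by (intro mult_left_mono divide_right_mono) auto
    also have "\<dots> = A * B / \<rho> * \<omega> t" by simp
    also have "\<dots> \<le> \<eta> * \<omega> t"
      using \<rho>(1,3) \<eta> pos[OF t(1)] by (intro mult_right_mono) (auto simp: field_simps)
    finally show ?thesis by (simp add: t_def)
  qed
  define h where "h x = max (- w x) (min (w x) (f x - f 0))" for x
  have h_osc: "\<bar>h x - h y\<bar> \<le> \<eta> * \<omega> (norm (x - y))"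
    if "x \<noteq> y" "\<bar>f x - f y\<bar> \<le> \<eta> * \<omega> (norm (x - y))" for x y
  proof -
    have "\<bar>max (- a) (min a b) - max (- a') (min a' b')\<bar> \<le> s"
      if "\<bar>a - a'\<bar> \<le> s" "\<bar>b - b'\<bar> \<le> s" for a b a' b' s :: real using that by linarith
    from this[OF w_osc[OF that(1)], of "f x - f 0" "f y - f 0"] that(2) show ?thesis
      by (simp add: h_def)
  qed
  have h_inner: "h x = f x - f 0" if "norm x \<le> N1" for x
    using f_le_A[OF that] w_inner[OF that] by (simp add: h_def abs_le_iff max_def min_def)
  have h_outer: "h x = 0" if "x \<notin> ball 0 (2 * \<rho>)" for x
    using w_outer[of x] that by (simp add: h_def)
  have f_osc: "\<bar>f x - f y\<bar> \<le> \<eta> * \<omega> (norm (x - y))" if "x \<noteq> y" "norm y > N1" for x y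
  proof (cases "norm x > N")
    case True
    then show ?thesis using N that N1 by force
  next
    case False
    have "norm y - norm x \<le> norm (x - y)" using norm_triangle_ineq2[of y x] by (simp add: norm_minus_commute)
    then show ?thesis using \<Delta>[OF that(1)] that(2) False N1(3) by linarith
  qed
  show thesis
  proof (rule that[of h])
    show "\<exists>R. \<forall>x. x \<notin> ball 0 R \<longrightarrow> h x = 0" using h_outer by blast
    show "\<bar>h x - h y\<bar> \<le> \<eta> * \<omega> (norm (x - y))"
      if "x \<noteq> y" "\<bar>f x - f y\<bar> \<le> \<eta> * \<omega> (norm (x - y))" for x y by (rule h_osc[OF that])
    show "\<bar>(h x - f x) - (h y - f y)\<bar> \<le> 2 * \<eta> * \<omega> (norm (x - y))" if "x \<noteq> y" for x y
    proof (cases "norm x \<le> N1 \<and> norm y \<le> N1")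
      \<comment> \<open>Inside the ball \<open>h\<close> differs from \<open>f\<close> by the
        constant \<open>f 0\<close>. On any other pair both \<open>f\<close> and \<open>h\<close>
        have small oscillation, one \<open>\<eta>\<close> each.\<close>
      case True
      then show ?thesis using h_inner[of x] h_inner[of y] \<eta> pos[of "norm (x - y)"] that by simp
    next
      case False
      then have "\<bar>f x - f y\<bar> \<le> \<eta> * \<omega> (norm (x - y))"
        using f_osc[OF that] f_osc[OF that[symmetric]] by (auto simp: abs_minus_commute norm_minus_commute)
      with h_osc[OF that this] show ?thesis by linarith
    qed
  qed
qed

text \<open>At distances from \<open>r\<close> on, the uniform error \<open>D * M\<close> enters
  twice and is compared with \<open>\<omega>\<close> by monotonicity. Below \<open>r\<close>,
  \<open>g\<close> contributes its Lipschitz bound, at most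
  \<open>2 * D * \<eta> * \<omega> t\<close> by the choice of \<open>r\<close>, and \<open>h\<close>
  its own small oscillation; this gives \<open>1 + 2 * D\<close>.\<close>

lemma smoothing_small_scales:
  fixes h :: "'a::real_normed_vector \<Rightarrow> real"
  assumes D: "D > 0"
    and approx: "\<forall>(f :: 'a \<Rightarrow> real) r M. r > 0 \<and> M > 0 \<and>
      (\<forall>x y. norm (x - y) \<le> r \<longrightarrow> \<bar>f x - f y\<bar> \<le> M) \<longrightarrow>
      (\<exists>g \<in> C_class k. (\<forall>x y. \<bar>g x - g y\<bar> \<le> D * M / r * norm (x - y)) \<and>
        (\<forall>x. \<bar>f x - g x\<bar> \<le> D * M) \<and> (\<forall>x. f x = 0 \<longrightarrow> g x = 0))"
    and \<eta>: "\<eta> > 0" and "\<delta> > 0"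
    and h: "\<forall>x y. x \<noteq> y \<and> norm (x - y) < \<delta> \<longrightarrow> \<bar>h x - h y\<bar> \<le> \<eta> * \<omega> (norm (x - y))"
  shows "\<exists>g. g \<in> C_class k \<and> g \<in> Lip \<and> (\<forall>x. h x = 0 \<longrightarrow> g x = 0) \<and>
    (\<forall>x y. x \<noteq> y \<longrightarrow> \<bar>(g x - h x) - (g y - h y)\<bar> \<le> (1 + 2 * D) * \<eta> * \<omega> (norm (x - y)))"
proof -
  \<comment> \<open>Halving turns \<open>norm (x - y) \<le> r\<close> into the strict inequality
    that \<open>h\<close> requires.\<close>
  have "\<delta> / 2 > 0" using \<open>\<delta> > 0\<close> by simp
  then obtain r where r: "0 < r" "r \<le> \<delta> / 2" "\<And>t. 0 < t \<Longrightarrow> t \<le> r \<Longrightarrow> \<omega> r / r * t \<le> 2 * \<omega> t"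
    using almost_minimal_ratio by blast
  define M where "M = \<eta> * \<omega> r"
  have M: "M > 0" using \<eta> pos[OF r(1)] by (simp add: M_def)
  have hM: "\<bar>h x - h y\<bar> \<le> M" if "norm (x - y) \<le> r" for x y
  proof (cases "x = y")
    case False
    then have "\<bar>h x - h y\<bar> \<le> \<eta> * \<omega> (norm (x - y))" using h r that by simp
    also have "\<dots> \<le> M"
      unfolding M_def using \<eta> False that r by (intro mult_left_mono mono_onD[OF mono]) auto
    finally show ?thesis .
  qed (use M in simp)
  have "\<exists>g \<in> C_class k. (\<forall>x y. \<bar>g x - g y\<bar> \<le> D * M / r * norm (x - y)) \<and>
      (\<forall>x. \<bar>h x - g x\<bar> \<le> D * M) \<and> (\<forall>x. h x = 0 \<longrightarrow> g x = 0)"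
    by (intro approx[THEN spec, THEN spec, THEN spec, THEN mp] conjI allI impI r(1) M hM)
  then obtain g where g: "g \<in> C_class k"
    "\<And>x y. \<bar>g x - g y\<bar> \<le> D * M / r * norm (x - y)" "\<And>x. \<bar>h x - g x\<bar> \<le> D * M"
    "\<And>x. h x = 0 \<Longrightarrow> g x = 0" by blast
  show ?thesis
  proof (intro exI[of _ g] conjI allI impI g(1,4))
    have "D * M / r \<ge> 0" using D M r by simp
    with g(2) show "g \<in> Lip" unfolding Lip_iff by blast
    fix x y :: 'a assume that: "x \<noteq> y"
    show "\<bar>(g x - h x) - (g y - h y)\<bar> \<le> (1 + 2 * D) * \<eta> * \<omega> (norm (x - y))"
    proof -
      define t where "t = norm (x - y)"
      define W where "W = \<eta> * \<omega> t"
      have t: "t > 0" using that by (simp add: t_def)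
      have W: "W > 0" using \<eta> pos[OF t] by (simp add: W_def)
      have expand: "(1 + 2 * D) * \<eta> * \<omega> t = W + 2 * (D * W)" by (simp add: W_def algebra_simps)
      show ?thesis
      proof (cases "t \<ge> r")
        case True
        then have "M \<le> W" unfolding M_def W_def using \<eta> r t
          by (intro mult_left_mono mono_onD[OF mono]) auto
        then have "D * M \<le> D * W" using D by (intro mult_left_mono) auto
        then show ?thesis
          unfolding t_def[symmetric] expand using g(3)[of x] g(3)[of y] W by linarith
      next
        case False
        have "D * M / r * t = D * (\<eta> * (\<omega> r / r * t))" by (simp add: M_def)
        also have "\<dots> \<le> D * (\<eta> * (2 * \<omega> t))"
          using r(3)[of t] t False D \<eta> by (intro mult_left_mono) auto
        also have "\<dots> = 2 * (D * W)" by (simp add: W_def)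
        finally have "\<bar>g x - g y\<bar> \<le> 2 * (D * W)" using g(2)[of x y] by (simp add: t_def)
        moreover have "\<bar>h x - h y\<bar> \<le> W" using h that False r(1,2) by (simp add: W_def t_def)
        ultimately show ?thesis unfolding t_def[symmetric] expand by linarith
      qed
    qed
  qed
qed

end

theorem theorem1p3:
  fixes k :: enat
    and \<omega> :: "real \<Rightarrow> real"
    and C_db :: real
  assumes separable: "separable_space (euclidean :: 'a::real_normed_vector topology)"
    and bump: "\<exists>\<phi> :: 'a \<Rightarrow> real. \<phi> \<in> C_class_bs k \<inter> Lip \<and> \<phi> \<noteq> (\<lambda>x. 0)"
    and omega_pos: "\<And>t. t > 0 \<Longrightarrow> \<omega> t > 0"
    and omega_mono: "mono_on {0<..} \<omega>"
    and omega_zero: "(\<omega> \<longlongrightarrow> 0) (at_right 0)"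
    and omega_infinity: "filterlim \<omega> at_top at_top"
    and omega_ratio: "((\<lambda>t. t / \<omega> t) \<longlongrightarrow> 0) (at_right 0)"
    and C_db: "C_db > 1"
    and omega_doubling: "\<And>t. t > 0 \<Longrightarrow> \<omega> (2 * t) \<le> C_db * \<omega> t"
  shows "holder_closure \<omega> (C_class k \<inter> Lip \<inter> holder_space \<omega>) = (VC_small \<omega> :: ('a \<Rightarrow> real) set) \<and>
         holder_closure \<omega> (C_class_bs k \<inter> Lip) = (VC \<omega> :: ('a \<Rightarrow> real) set)"
proof -
  interpret vanishing_modulus \<omega>
    by unfold_locales (fact omega_pos omega_mono omega_infinity omega_ratio)+
  obtain \<phi> :: "'a \<Rightarrow> real" where \<phi>: "\<phi> \<in> C_class_bs k \<inter> Lip" "\<phi> \<noteq> (\<lambda>x. 0)" using bump by blast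
  obtain D where D: "D > 0" and approx: "\<forall>(f :: 'a \<Rightarrow> real) r M. r > 0 \<and> M > 0 \<and>
      (\<forall>x y. norm (x - y) \<le> r \<longrightarrow> \<bar>f x - f y\<bar> \<le> M) \<longrightarrow>
      (\<exists>g \<in> C_class k. (\<forall>x y. \<bar>g x - g y\<bar> \<le> D * M / r * norm (x - y)) \<and>
        (\<forall>x. \<bar>f x - g x\<bar> \<le> D * M) \<and> (\<forall>x. f x = 0 \<longrightarrow> g x = 0))"
    using smooth_approximation[OF separable \<phi>] by blast
  note smoothing = smoothing_small_scales[OF D approx]
  have "VC_small \<omega> \<subseteq> holder_closure \<omega> (C_class k \<inter> Lip \<inter> (holder_space \<omega> :: ('a \<Rightarrow> real) set))"
  proof
    fix f :: "'a \<Rightarrow> real" assume f: "f \<in> VC_small \<omega>"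
    then have fh: "f \<in> holder_space \<omega>" by (simp add: VC_small_def)
    then obtain K where K: "K \<ge> 0" "\<And>x y. x \<noteq> y \<Longrightarrow> \<bar>f x - f y\<bar> \<le> K * \<omega> (norm (x - y))"
      using holder_space_iff[of f] by auto
    show "f \<in> holder_closure \<omega> (C_class k \<inter> Lip \<inter> holder_space \<omega>)"
      unfolding holder_closure_iff
    proof (intro conjI allI impI fh)
      fix e :: real assume e: "e > 0"
      define \<eta> where "\<eta> = e / (1 + 2 * D)"
      have \<eta>: "\<eta> > 0" "(1 + 2 * D) * \<eta> = e" using e D by (simp_all add: \<eta>_def)
      obtain \<delta> where \<delta>: "\<delta> > 0"
        "\<forall>x y. x \<noteq> y \<and> norm (x - y) < \<delta> \<longrightarrow> \<bar>f x - f y\<bar> \<le> \<eta> * \<omega> (norm (x - y))"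
        using VC_small_iff[THEN iffD1, OF f, THEN conjunct2, rule_format, OF \<eta>(1)] by blast
      from smoothing[OF \<eta>(1) \<delta>] obtain g where "g \<in> C_class k \<and> g \<in> Lip \<and>
        (\<forall>x. f x = 0 \<longrightarrow> g x = 0) \<and>
        (\<forall>x y. x \<noteq> y \<longrightarrow> \<bar>(g x - f x) - (g y - f y)\<bar> \<le> (1 + 2 * D) * \<eta> * \<omega> (norm (x - y)))" ..
      then have g: "g \<in> C_class k" "g \<in> Lip"
        "\<And>x y. x \<noteq> y \<Longrightarrow> \<bar>(g x - f x) - (g y - f y)\<bar> \<le> e * \<omega> (norm (x - y))"
        unfolding \<eta>(2) by simp_all
      have "\<bar>g x - g y\<bar> \<le> (K + e) * \<omega> (norm (x - y))" if "x \<noteq> y" for x y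
        using K(2)[OF that] g(3)[OF that] unfolding distrib_right by linarith
      then have "g \<in> holder_space \<omega>"
        unfolding holder_space_iff using K(1) e by (intro exI[of _ "K + e"]) auto
      with g show "\<exists>g\<in>C_class k \<inter> Lip \<inter> holder_space \<omega>.
          \<forall>x y. x \<noteq> y \<longrightarrow> \<bar>(g x - f x) - (g y - f y)\<bar> \<le> e * \<omega> (norm (x - y))" by blast
    qed
  qed
  moreover have "VC \<omega> \<subseteq> holder_closure \<omega> (C_class_bs k \<inter> (Lip :: ('a \<Rightarrow> real) set))"
  proof
    fix f :: "'a \<Rightarrow> real" assume "f \<in> VC \<omega>"
    then have f: "f \<in> VC_small \<omega>" "f \<in> VC_large \<omega>" "f \<in> VC_far \<omega>" and fh: "f \<in> holder_space \<omega>"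
      by (auto simp: VC_def VC_small_def)
    show "f \<in> holder_closure \<omega> (C_class_bs k \<inter> Lip)"
      unfolding holder_closure_iff
    proof (intro conjI allI impI fh)
      fix e :: real assume e: "e > 0"
      \<comment> \<open>The error is \<open>(1 + 2 * D) * \<eta>\<close> from the smoothing and
        \<open>2 * \<eta>\<close> from the truncation.\<close>
      define \<eta> where "\<eta> = e / (3 + 2 * D)"
      have \<eta>: "\<eta> > 0" using e D by (simp add: \<eta>_def)
      have sum: "(1 + 2 * D) * \<eta> * W + 2 * \<eta> * W = e * W" for W
      proof -
        have "(1 + 2 * D) * \<eta> * W + 2 * \<eta> * W = ((3 + 2 * D) * \<eta>) * W"
          by (simp add: algebra_simps)
        also have "(3 + 2 * D) * \<eta> = e" using D by (simp add: \<eta>_def)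
        finally show ?thesis .
      qed
      obtain h where h: "\<exists>R. \<forall>x. x \<notin> ball 0 R \<longrightarrow> h x = 0"
        "\<And>x y. x \<noteq> y \<Longrightarrow> \<bar>(h x - f x) - (h y - f y)\<bar> \<le> 2 * \<eta> * \<omega> (norm (x - y))"
        "\<And>x y. x \<noteq> y \<Longrightarrow> \<bar>f x - f y\<bar> \<le> \<eta> * \<omega> (norm (x - y)) \<Longrightarrow> \<bar>h x - h y\<bar> \<le> \<eta> * \<omega> (norm (x - y))"
        using bounded_support_approximation[OF f(2,3) \<eta>]
        by blast
      obtain \<delta> where \<delta>: "\<delta> > 0"
        "\<And>x y. x \<noteq> y \<Longrightarrow> norm (x - y) < \<delta> \<Longrightarrow> \<bar>f x - f y\<bar> \<le> \<eta> * \<omega> (norm (x - y))"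
        using VC_small_iff[THEN iffD1, OF f(1), THEN conjunct2, rule_format, OF \<eta>] by blast
      have "\<forall>x y. x \<noteq> y \<and> norm (x - y) < \<delta> \<longrightarrow> \<bar>h x - h y\<bar> \<le> \<eta> * \<omega> (norm (x - y))"
        using h(3) \<delta>(2) by simp
      from smoothing[OF \<eta> \<delta>(1) this] obtain g where "g \<in> C_class k \<and> g \<in> Lip \<and>
        (\<forall>x. h x = 0 \<longrightarrow> g x = 0) \<and>
        (\<forall>x y. x \<noteq> y \<longrightarrow> \<bar>(g x - h x) - (g y - h y)\<bar> \<le> (1 + 2 * D) * \<eta> * \<omega> (norm (x - y)))" ..
      then have g: "g \<in> C_class k" "g \<in> Lip" "\<And>x. h x = 0 \<Longrightarrow> g x = 0"
        "\<And>x y. x \<noteq> y \<Longrightarrow> \<bar>(g x - h x) - (g y - h y)\<bar> \<le> (1 + 2 * D) * \<eta> * \<omega> (norm (x - y))"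
        by simp_all
      have "g \<in> C_class_bs k" using g(1,3) h(1) unfolding C_class_bs_def by blast
      moreover have "\<bar>(g x - f x) - (g y - f y)\<bar> \<le> e * \<omega> (norm (x - y))" if "x \<noteq> y" for x y
        using g(4)[OF that] h(2)[OF that] sum[of "\<omega> (norm (x - y))"] by linarith
      ultimately show "\<exists>g\<in>C_class_bs k \<inter> Lip.
          \<forall>x y. x \<noteq> y \<longrightarrow> \<bar>(g x - f x) - (g y - f y)\<bar> \<le> e * \<omega> (norm (x - y))" using g(2) by blast
    qed
  qed
  moreover have "holder_closure \<omega> (C_class k \<inter> Lip \<inter> (holder_space \<omega> :: ('a \<Rightarrow> real) set)) \<subseteq> VC_small \<omega>"
    by (rule closure_Lip_subset_VC_small) auto
  moreover have "holder_closure \<omega> (C_class_bs k \<inter> (Lip :: ('a \<Rightarrow> real) set)) \<subseteq> VC \<omega>"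
    by (rule closure_bounded_support_subset_VC)
      (auto simp: C_class_bs_def)
  ultimately show ?thesis by blast
qed

end
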